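(* Let $1<p<2$, $b>0$, $\beta=p-1$ (so $0<\beta<1$), $C>0$, $\alpha>0$. Let $u_0$ be a nonnegative continuous function on $\mathbb{R}$ with $u_0\sim C(-x)_+^{\alpha}$ as $x\to 0^-$ and $\eta(0)=0$, and let $u$ be the unique weak solution of $$u_t-\big(|u_x|^{p-2}u_x\big)_x+bu^{\beta}=0,\quad x\in\mathbb{R},\ 0<t<T;\qquad u(x,0)=u_0(x),\quad x\in\mathbb{R}.$$ Then there is an infinite speed of propagation, and for every $\epsilon>0$ there exists $\delta_\epsilon=\delta(\epsilon)>0$ such that $$t^{1/(2-p)}\phi(x)\le u(x,t)\le(t+\epsilon)^{1/(2-p)}\phi(x)\qquad\text{for } 0<x<+\infty,\ 0\le t\le\delta_\epsilon,$$ where $\phi\ge 0$ is the solution of the problem $$\big(|\phi'(x)|^{p-2}\phi'(x)\big)'=\frac{1}{2-p}\phi(x)+b\,\phi^{p-1}(x),\quad 0<x<+\infty;\qquad \phi(0)=1,\quad \phi(\infty)=0.$$ Moreover, there is $\delta>0$ such that for each fixed $t\in(0,\delta]$ $$\log u(x,t)\sim-\Big(\frac{b}{p-1}\Big)^{1/p}x\qquad\text{as } x\to+\infty.$$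
   Context: Notation: $(s)_+=\max(s,0)$; $f(y)\sim g(y)$ as $y\to y_0$ means $\lim_{y\to y_0}f(y)/g(y)=1$; $\phi(\infty)=\lim_{x\to+\infty}\phi(x)$. Here $0<T\le+\infty$, and $\eta(t)=\sup\{x:u(x,t)>0\}$. Standing assumptions: $u_0\ge0$ is continuous with $\eta(0)=\sup\{x:u_0(x)>0\}=0$. The behaviour of $u_0$ as $x\to-\infty$ has no influence: $u_0$ is either bounded, or unbounded with a growth condition as $x\to-\infty$ suitable for existence, uniqueness and comparison results for the Cauchy problem. Weak solution: a measurable function $u\ge0$ is a weak solution in $\mathbb{R}\times[0,T]$ if $u\in C_{loc}(0,T;L^2_{loc}(\mathbb{R}))\cap L^p_{loc}(0,T;W^{1,p}_{loc}(\mathbb{R})\cap L^{1+\beta}_{loc}(\mathbb{R}))$; for every $[t_0,t_1]\subset(0,T]$ and all $\mu_1,\mu_2\in C^1[t_0,t_1]$ with $\mu_1<\mu_2$ on $[t_0,t_1]$, $$\int_{\mu_1(t)}^{\mu_2(t)}u\phi\,dx\Big|_{t_0}^{t_1}+\int_{t_0}^{t_1}\int_{\mu_1(t)}^{\mu_2(t)}\big(-u\phi_t+|u_x|^{p-2}u_x\phi_x+bu^\beta\phi\big)dx\,dt=0$$ for every test function $\phi\in C^{2,1}_{x,t}(\overline D)$ vanishing on $x=\mu_i(t)$, $t_0\le t\le t_1$, $i=1,2$, where $D=\{(x,t):\mu_1(t)<x<\mu_2(t),\ t_0<t<t_1\}$ (this test function is unrelated to the ODE solution $\phi$ in the claim);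 and $\lim_{t\downarrow0}u(x,t)=u_0(x)$ for all $x\in\mathbb{R}$. "Infinite speed of propagation" means that there is no finite interface: $\eta(t)=+\infty$ for all sufficiently small $t>0$.
   Formalization: The weak solution u is taken to be its continuous representative on R×[0,T], and uniqueness is meant among continuous weak solutions; for merely measurable u, changes on null sets destroy uniqueness and the pointwise bounds. *)

theory Defs
  imports "HOL-Analysis.Analysis" "HOL-Library.Landau_Symbols"
begin

definition interface :: "(real \<Rightarrow> real) \<Rightarrow> ereal" where
  "interface f = Sup (ereal ` {x. f x > 0})"

definition time_dom :: "ereal \<Rightarrow> real set" where
  "time_dom T = {t. 0 \<le> t \<and> ereal t \<le> T}"

text \<open>The value at \<open>s = 0\<close> is \<open>0\<close> also for \<open>p < 2\<close>.\<close>

definition plap_flux :: "real \<Rightarrow> real \<Rightarrow> real" where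
  "plap_flux p s = \<bar>s\<bar> powr (p - 2) * s"

definition has_weak_deriv :: "(real \<Rightarrow> real) \<Rightarrow> (real \<Rightarrow> real) \<Rightarrow> bool" where
  "has_weak_deriv f g \<longleftrightarrow>
     (\<forall>a b. set_integrable lebesgue {a..b} f \<and> set_integrable lebesgue {a..b} g) \<and>
     (\<forall>\<psi> \<psi>'. (\<forall>x. (\<psi> has_real_derivative \<psi>' x) (at x)) \<and> continuous_on UNIV \<psi>' \<and>
        bounded {x. \<psi> x \<noteq> 0} \<longrightarrow>
        (LINT x|lebesgue. f x * \<psi>' x) = - (LINT x|lebesgue. g x * \<psi> x))"

definition C1_on :: "real \<Rightarrow> real \<Rightarrow> (real \<Rightarrow> real) \<Rightarrow> bool" where
  "C1_on t0 t1 \<mu> \<longleftrightarrow>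
     (\<exists>\<mu>'. (\<forall>t\<in>{t0..t1}. (\<mu> has_real_derivative \<mu>' t) (at t within {t0..t1})) \<and>
           continuous_on {t0..t1} \<mu>')"

definition curve_dom :: "(real \<Rightarrow> real) \<Rightarrow> (real \<Rightarrow> real) \<Rightarrow> real \<Rightarrow> real \<Rightarrow> (real \<times> real) set" where
  "curve_dom \<mu>1 \<mu>2 t0 t1 = {(x, t). \<mu>1 t < x \<and> x < \<mu>2 t \<and> t0 < t \<and> t < t1}"

text \<open>\<open>\<psi> \<in> C^{2,1}_{x,t}\<close> on the closure of the open set \<open>D\<close>: the functions \<open>\<psi>x\<close>, \<open>\<psi>xx\<close>, \<open>\<psi>t\<close>
  are the derivatives in \<open>D\<close>, extended continuously to the closure.\<close>

definition C21_closure ::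
  "(real \<times> real) set \<Rightarrow> (real \<Rightarrow> real \<Rightarrow> real) \<Rightarrow> (real \<Rightarrow> real \<Rightarrow> real) \<Rightarrow>
   (real \<Rightarrow> real \<Rightarrow> real) \<Rightarrow> (real \<Rightarrow> real \<Rightarrow> real) \<Rightarrow> bool" where
  "C21_closure D \<psi> \<psi>x \<psi>xx \<psi>t \<longleftrightarrow>
     (\<forall>f\<in>{\<psi>, \<psi>x, \<psi>xx, \<psi>t}. continuous_on (closure D) (\<lambda>(x, t). f x t)) \<and>
     (\<forall>(x, t)\<in>D.
        ((\<lambda>y. \<psi> y t) has_real_derivative \<psi>x x t) (at x) \<and>
        ((\<lambda>y. \<psi>x y t) has_real_derivative \<psi>xx x t) (at x) \<and>
        ((\<lambda>s. \<psi> x s) has_real_derivative \<psi>t x t) (at t))"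

text \<open>The subscript \<open>loc\<close> in time refers to compact subintervals of \<open>(0, T]\<close>, the same intervals
  as in the integral identity.\<close>

definition C_loc_L2_loc :: "ereal \<Rightarrow> (real \<Rightarrow> real \<Rightarrow> real) \<Rightarrow> bool" where
  "C_loc_L2_loc T u \<longleftrightarrow>
     (\<forall>a b. \<forall>t \<in> time_dom T - {0}.
        set_integrable lebesgue {a..b} (\<lambda>x. (u x t)\<^sup>2) \<and>
        ((\<lambda>s. LINT x:{a..b}|lebesgue. (u x s - u x t)\<^sup>2) \<longlongrightarrow> 0) (at t within time_dom T - {0}))"

text \<open>\<open>u \<in> L^p_loc(0, T; W^{1,p}_loc \<inter> L^{1+\<beta>}_loc)\<close> with weak spatial derivative \<open>ux\<close>.\<close>

definition Lp_loc_W1p_loc ::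
  "real \<Rightarrow> real \<Rightarrow> ereal \<Rightarrow> (real \<Rightarrow> real \<Rightarrow> real) \<Rightarrow> (real \<Rightarrow> real \<Rightarrow> real) \<Rightarrow> bool" where
  "Lp_loc_W1p_loc p \<beta> T u ux \<longleftrightarrow>
     (AE t in lebesgue. t \<in> time_dom T \<longrightarrow> has_weak_deriv (\<lambda>x. u x t) (\<lambda>x. ux x t)) \<and>
     (\<lambda>(x, t). ux x t) \<in> borel_measurable (lebesgue_on (UNIV \<times> time_dom T)) \<and>
     (\<forall>a b t0 t1. 0 < t0 \<and> t0 < t1 \<and> ereal t1 \<le> T \<longrightarrow>
        set_integrable lebesgue ({a..b} \<times> {t0..t1}) (\<lambda>(x, t). \<bar>u x t\<bar> powr p) \<and>
        set_integrable lebesgue ({a..b} \<times> {t0..t1}) (\<lambda>(x, t). \<bar>ux x t\<bar> powr p) \<and>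
        (AE t in lebesgue. t \<in> {t0..t1} \<longrightarrow>
           set_integrable lebesgue {a..b} (\<lambda>x. \<bar>u x t\<bar> powr (1 + \<beta>))) \<and>
        set_integrable lebesgue {t0..t1}
          (\<lambda>t. (LINT x:{a..b}|lebesgue. \<bar>u x t\<bar> powr (1 + \<beta>)) powr (p / (1 + \<beta>))))"

definition integral_identity ::
  "real \<Rightarrow> real \<Rightarrow> real \<Rightarrow> ereal \<Rightarrow> (real \<Rightarrow> real \<Rightarrow> real) \<Rightarrow> (real \<Rightarrow> real \<Rightarrow> real) \<Rightarrow> bool" where
  "integral_identity p b \<beta> T u ux \<longleftrightarrow>
     (\<forall>t0 t1 \<mu>1 \<mu>2 \<psi> \<psi>x \<psi>xx \<psi>t.
        0 < t0 \<and> t0 < t1 \<and> ereal t1 \<le> T \<and>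
        C1_on t0 t1 \<mu>1 \<and> C1_on t0 t1 \<mu>2 \<and> (\<forall>t\<in>{t0..t1}. \<mu>1 t < \<mu>2 t) \<and>
        C21_closure (curve_dom \<mu>1 \<mu>2 t0 t1) \<psi> \<psi>x \<psi>xx \<psi>t \<and>
        (\<forall>t\<in>{t0..t1}. \<psi> (\<mu>1 t) t = 0 \<and> \<psi> (\<mu>2 t) t = 0) \<longrightarrow>
        (LINT x:{\<mu>1 t1..\<mu>2 t1}|lebesgue. u x t1 * \<psi> x t1) -
        (LINT x:{\<mu>1 t0..\<mu>2 t0}|lebesgue. u x t0 * \<psi> x t0) +
        (LINT z:curve_dom \<mu>1 \<mu>2 t0 t1|lebesgue.
           (case z of (x, t) \<Rightarrow>
              - u x t * \<psi>t x t + plap_flux p (ux x t) * \<psi>x x t + b * u x t powr \<beta> * \<psi> x t)) = 0)"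

definition weak_solution ::
  "real \<Rightarrow> real \<Rightarrow> real \<Rightarrow> ereal \<Rightarrow> (real \<Rightarrow> real) \<Rightarrow> (real \<Rightarrow> real \<Rightarrow> real) \<Rightarrow> bool" where
  "weak_solution p b \<beta> T u0 u \<longleftrightarrow>
     (\<forall>x. \<forall>t \<in> time_dom T. 0 \<le> u x t) \<and>
     (\<lambda>(x, t). u x t) \<in> borel_measurable (lebesgue_on (UNIV \<times> time_dom T)) \<and>
     C_loc_L2_loc T u \<and>
     (\<exists>ux. Lp_loc_W1p_loc p \<beta> T u ux \<and> integral_identity p b \<beta> T u ux) \<and>
     (\<forall>x. u x 0 = u0 x \<and> ((\<lambda>t. u x t) \<longlongrightarrow> u0 x) (at_right 0))"

text \<open>Weak solutions are identified with their continuous representatives. Some such normalization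
  is needed both for pointwise statements and for uniqueness: the pointwise initial condition is
  not invariant under modification on null sets. (For instance, a solution whose initial datum
  contains an additional point mass at \<open>x = 5\<close> could be redefined on the line \<open>x = 5\<close> so as to
  attain \<open>u0\<close> at every point.)\<close>

definition continuous_weak_solution ::
  "real \<Rightarrow> real \<Rightarrow> real \<Rightarrow> ereal \<Rightarrow> (real \<Rightarrow> real) \<Rightarrow> (real \<Rightarrow> real \<Rightarrow> real) \<Rightarrow> bool" where
  "continuous_weak_solution p b \<beta> T u0 u \<longleftrightarrow>
     weak_solution p b \<beta> T u0 u \<and> continuous_on (UNIV \<times> time_dom T) (\<lambda>(x, t). u x t)"

definition unique_weak_solution ::
  "real \<Rightarrow> real \<Rightarrow> real \<Rightarrow> ereal \<Rightarrow> (real \<Rightarrow> real) \<Rightarrow> (real \<Rightarrow> real \<Rightarrow> real) \<Rightarrow> bool" where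
  "unique_weak_solution p b \<beta> T u0 u \<longleftrightarrow>
     continuous_weak_solution p b \<beta> T u0 u \<and>
     (\<forall>v. continuous_weak_solution p b \<beta> T u0 v \<longrightarrow> (\<forall>x. \<forall>t \<in> time_dom T. v x t = u x t))"

definition profile_solution :: "real \<Rightarrow> real \<Rightarrow> (real \<Rightarrow> real) \<Rightarrow> bool" where
  "profile_solution p b \<phi> \<longleftrightarrow>
     (\<forall>x\<ge>0. 0 \<le> \<phi> x) \<and> continuous_on {0..} \<phi> \<and>
     (\<exists>\<phi>'. \<forall>x>0.
        (\<phi> has_real_derivative \<phi>' x) (at x) \<and>
        ((\<lambda>y. plap_flux p (\<phi>' y)) has_real_derivative
           1 / (2 - p) * \<phi> x + b * \<phi> x powr (p - 1)) (at x)) \<and>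
     \<phi> 0 = 1 \<and> (\<phi> \<longlongrightarrow> 0) at_top"

end

(* Every positive solution of the profile equation gives the separable solution
   t^(1/(2-p)) phi(x) of the PDE, because the absorption exponent p - 1 has the same homogeneity as the flux.
   Both estimates are comparisons of u with small perturbations of such functions on rectangles.
   Below: phi extends to a half line x > -r0, so one compares on [-r,k] with t^(1/(2-p)) (phi(x) - phi(k)), where
   u0(-r) > 0. Above: a supersolution blowing up at a finite point bounds u on the half line x >= 0, a stationary
   supersolution then gives uniform decay as x grows, and finally one compares with (t+eps)^(1/(2-p)) (phi(x) + eta).

   Comparison of a weak solution with a classical one: mollify the equation in x and t with a product
   kernel (a piecewise polynomial, hence an admissible test function) and test with the square of a truncated
   difference. The only delicate term is the product of the mollified gradient and the mollified
   flux. By a symmetrization it is nonnegative up to the mean oscillation of u_x in L^p at the mollification scale. *)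

theory Submission
  imports Defs
begin

section \<open>Truncated powers, the mollification kernel and the flux\<close>

text \<open>For \<open>G t * f x\<close> with \<open>G t = (t + e) powr (1 / (2 - p))\<close>, the
  time derivative, the flux derivative and the absorption all carry the factor
  \<open>G t powr (p - 1)\<close>, because \<open>G'\<close> equals
  \<open>G powr (p - 1) / (2 - p)\<close>; what remains is an ODE for \<open>f\<close>. Its
  zeroth-order terms increase with \<open>f\<close>, while its flux term ignores constants. Hence
  \<phi> - \<phi>(k) yields a subsolution, \<phi> + \<eta> a supersolution, and both perturbations
  disappear in a limit. Two obstacles shape the barriers. Nothing is assumed about \<open>u\<close>
  as x tends to +\<infinity>, so the upper estimate must produce its own control at the right end of
  each rectangle. On the left, u(0, t) \<ge> t^(1/(2-p)) is a limit case of the claim, so the lower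
  comparison has to start where \<open>u0\<close> is positive; this is why \<phi> is extended to the
  left of 0. In the comparison, \<open>u\<close> has no time derivative, u_x lies only in L^p, and
  averaging does not commute with the nonlinear flux. The averaged flux is therefore never replaced
  by the flux of the averaged gradient.\<close>

lemma pos_part_power_deriv:
  fixes x :: real
  shows "((\<lambda>x. max 0 x ^ Suc (Suc n)) has_real_derivative real (Suc (Suc n)) * max 0 x ^ Suc n) (at x)"
proof -
  consider "x > 0" | "x < 0" | "x = 0" by linarith
  then show ?thesis
  proof cases
    case 1
    have "((\<lambda>x. x ^ Suc (Suc n)) has_real_derivative real (Suc (Suc n)) * x ^ Suc n) (at x)"
      by (rule derivative_eq_intros refl)+ simp
    moreover have "\<forall>\<^sub>F y in nhds x. y ^ Suc (Suc n) = max 0 y ^ Suc (Suc n)"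
      using eventually_nhds_in_open[of "{0<..}" x] 1 by (auto elim!: eventually_mono)
    ultimately show ?thesis
      using 1 by (subst DERIV_cong_ev[OF refl _ refl, symmetric]) auto
  next
    case 2
    have "((\<lambda>x. 0) has_real_derivative 0) (at x)" by simp
    moreover have "\<forall>\<^sub>F y in nhds x. 0 = max 0 y ^ Suc (Suc n)"
      using eventually_nhds_in_open[of "{..<0}" x] 2 by (auto elim!: eventually_mono)
    ultimately show ?thesis
      using 2 DERIV_cong_ev[of x x "\<lambda>x. 0" "\<lambda>x. max 0 x ^ Suc (Suc n)" 0 0] by simp
  next
    case 3
    have "(\<lambda>h::real. max 0 h ^ Suc n) \<midarrow>0\<rightarrow> max 0 0 ^ Suc n"
      by (intro tendsto_power tendsto_max tendsto_const tendsto_ident_at)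
    then have lim: "(\<lambda>h. max 0 h ^ Suc n) \<midarrow>0\<rightarrow> (0::real)" by simp
    have eq: "max 0 h ^ Suc (Suc n) / h = max 0 h ^ Suc n" if "h \<noteq> 0" for h :: real
      using that by (cases "h > 0") (auto simp: max_def)
    have "(\<lambda>h. max 0 h ^ Suc (Suc n) / h) \<midarrow>0\<rightarrow> (0::real)"
      by (rule Lim_transform_eventually[OF lim]) (auto simp: eventually_at_filter eq simp del: power_Suc)
    then show ?thesis unfolding 3 DERIV_def by simp
  qed
qed

lemma pos_part_cube_deriv [derivative_intros]:
  assumes "(f has_real_derivative D) (at x within S)"
  shows "((\<lambda>x. max 0 (f x) ^ 3) has_real_derivative 3 * max 0 (f x) ^ 2 * D) (at x within S)"
  using DERIV_chain2[OF pos_part_power_deriv[of 1 "f x"] assms]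
  by (simp add: numeral_2_eq_2 numeral_3_eq_3)

lemma pos_part_square_deriv [derivative_intros]:
  assumes "(f has_real_derivative D) (at x within S)"
  shows "((\<lambda>x. max 0 (f x) ^ 2) has_real_derivative 2 * max 0 (f x) * D) (at x within S)"
  using DERIV_chain2[OF pos_part_power_deriv[of 0 "f x"] assms]
  by (simp add: numeral_2_eq_2)

text \<open>The cube makes \<open>kern'\<close> itself differentiable, so a Lipschitz constant for
  it comes from the mean value theorem. On \<bar>x\<bar> \<le> r the truncation is inactive and the
  kernel is a polynomial. It is not normalized; \<open>kmass\<close> takes care of that
  later.\<close>

definition kern :: "real \<Rightarrow> real \<Rightarrow> real" where
  "kern r x = max 0 (r\<^sup>2 - x\<^sup>2) ^ 3"

definition kern' :: "real \<Rightarrow> real \<Rightarrow> real" where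
  "kern' r x = - 6 * x * max 0 (r\<^sup>2 - x\<^sup>2) ^ 2"

lemma kern_deriv: "(kern r has_real_derivative kern' r x) (at x within S)"
  unfolding kern_def[abs_def] kern'_def
  by (auto intro!: derivative_eq_intros)

lemma kern_nonneg [simp]: "0 \<le> kern r x"
  by (simp add: kern_def)

lemma kern_outside: "0 < r \<Longrightarrow> r \<le> \<bar>x\<bar> \<Longrightarrow> kern r x = 0"
  using abs_le_square_iff[of r x] by (simp add: kern_def max_def)

lemma kern'_outside: "0 < r \<Longrightarrow> r \<le> \<bar>x\<bar> \<Longrightarrow> kern' r x = 0"
  using abs_le_square_iff[of r x] by (simp add: kern'_def max_def)

lemma kern_inside: "\<bar>x\<bar> \<le> r \<Longrightarrow> kern r x = (r\<^sup>2 - x\<^sup>2) ^ 3"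
  using abs_le_square_iff[of x r] by (auto simp: kern_def max_def)

lemma kern'_inside: "\<bar>x\<bar> \<le> r \<Longrightarrow> kern' r x = - 6 * x * (r\<^sup>2 - x\<^sup>2) ^ 2"
  using abs_le_square_iff[of x r] by (auto simp: kern'_def max_def)

lemma kern'_lipschitz: "\<exists>L\<ge>0. \<forall>x y. \<bar>kern' r x - kern' r y\<bar> \<le> L * \<bar>x - y\<bar>"
proof -
  define k2 where "k2 x = - 6 * max 0 (r\<^sup>2 - x\<^sup>2) ^ 2 + 24 * x\<^sup>2 * max 0 (r\<^sup>2 - x\<^sup>2)" for x :: real
  have d: "(kern' r has_real_derivative k2 x) (at x)" for x
    unfolding kern'_def[abs_def] k2_def
    by (rule derivative_eq_intros pos_part_square_deriv[OF DERIV_diff[OF DERIV_const DERIV_power[OF DERIV_ident]]] refl)+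
      (simp add: power2_eq_square)
  define L where "L = 6 * (r\<^sup>2)\<^sup>2 + 24 * r\<^sup>2 * r\<^sup>2"
  have L: "\<bar>k2 x\<bar> \<le> L" for x
  proof (cases "x\<^sup>2 \<le> r\<^sup>2")
    case True
    have "max 0 (r\<^sup>2 - x\<^sup>2) ^ 2 \<le> (r\<^sup>2)\<^sup>2" using True by (intro power_mono) auto
    moreover have "x\<^sup>2 * max 0 (r\<^sup>2 - x\<^sup>2) \<le> r\<^sup>2 * r\<^sup>2" using True by (intro mult_mono) auto
    moreover have "0 \<le> x\<^sup>2 * max 0 (r\<^sup>2 - x\<^sup>2)" "0 \<le> max 0 (r\<^sup>2 - x\<^sup>2) ^ 2" by simp_all
    ultimately show ?thesis unfolding k2_def L_def by linarith
  next
    case False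
    then show ?thesis by (simp add: k2_def L_def max_def)
  qed
  have "\<bar>kern' r x - kern' r y\<bar> \<le> L * \<bar>x - y\<bar>" for x y
    using field_differentiable_bound[of UNIV "kern' r" k2 L x y] d L by auto
  moreover have "L \<ge> 0" by (simp add: L_def)
  ultimately show ?thesis by blast
qed

lemma kern'_bounded: "0 < r \<Longrightarrow> \<exists>K\<ge>0. \<forall>x. \<bar>kern' r x\<bar> \<le> K"
proof -
  assume r: "0 < r"
  obtain L where L: "L \<ge> 0" "\<And>x y. \<bar>kern' r x - kern' r y\<bar> \<le> L * \<bar>x - y\<bar>"
    using kern'_lipschitz by metis
  have "\<bar>kern' r x\<bar> \<le> L * r" for x
  proof (cases "r \<le> \<bar>x\<bar>")
    case True then show ?thesis using r L(1) by (simp add: kern'_outside)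
  next
    case False
    then have "\<bar>kern' r x\<bar> \<le> L * \<bar>x\<bar>" using L(2)[of x 0] by (simp add: kern'_def)
    also have "\<dots> \<le> L * r" using False L(1) by (intro mult_left_mono) auto
    finally show ?thesis .
  qed
  then show ?thesis using L(1) r by (intro exI[of _ "L * r"]) auto
qed

lemma kern_bounded: "\<bar>kern r x\<bar> \<le> (r\<^sup>2) ^ 3"
proof -
  have "max 0 (r\<^sup>2 - x\<^sup>2) ^ 3 \<le> (r\<^sup>2) ^ 3" by (intro power_mono) auto
  then show ?thesis unfolding kern_def by (simp del: power_mult_numeral)
qed

text \<open>Mean value bound for \<open>f z - z * f' x\<close>, whose derivative is at most
  \<open>L * \<bar>y - x\<bar>\<close> on the segment. Only a Lipschitz first derivative enters, at
  the price of \<open>L\<close> in place of \<open>L / 2\<close>.\<close>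

lemma quadratic_remainder:
  fixes f f' :: "real \<Rightarrow> real"
  assumes d: "\<And>x. (f has_real_derivative f' x) (at x)"
    and L: "\<And>x y. \<bar>f' x - f' y\<bar> \<le> L * \<bar>x - y\<bar>" and "L \<ge> 0"
  shows "\<bar>f y - f x - (y - x) * f' x\<bar> \<le> L * (y - x)\<^sup>2"
proof -
  have "\<bar>(f y - y * f' x) - (f x - x * f' x)\<bar> \<le> (L * \<bar>y - x\<bar>) * \<bar>y - x\<bar>"
  proof (rule field_differentiable_bound[of "closed_segment x y" _ "\<lambda>z. f' z - f' x", unfolded real_norm_def])
    show "((\<lambda>z. f z - z * f' x) has_real_derivative f' z - f' x) (at z within closed_segment x y)" for z
      by (auto intro!: derivative_eq_intros has_field_derivative_at_within[OF d])
    show "\<bar>f' z - f' x\<bar> \<le> L * \<bar>y - x\<bar>" if "z \<in> closed_segment x y" for z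
    proof -
      have "\<bar>f' z - f' x\<bar> \<le> L * \<bar>z - x\<bar>" by (rule L)
      also have "\<dots> \<le> L * \<bar>y - x\<bar>"
        using segment_bound1[OF that] \<open>L \<ge> 0\<close> by (intro mult_left_mono) (auto simp: abs_minus_commute)
      finally show ?thesis .
    qed
  qed auto
  then show ?thesis by (simp add: algebra_simps power2_eq_square abs_mult_self_eq)
qed

section \<open>Inequalities for the flux of the p-Laplacian\<close>

lemma plap_flux_eq: "plap_flux p s = sgn s * \<bar>s\<bar> powr (p - 1)"
proof (cases "s = 0")
  case False
  have "\<bar>s\<bar> powr (p - 1) = \<bar>s\<bar> powr (p - 2) * \<bar>s\<bar>"
    using False powr_add[of "\<bar>s\<bar>" "p - 2" 1] by simp
  then show ?thesis by (simp add: plap_flux_def sgn_if)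
qed (simp add: plap_flux_def)

lemma plap_flux_minus [simp]: "plap_flux p (- s) = - plap_flux p s"
  by (simp add: plap_flux_def)

lemma abs_plap_flux: "\<bar>plap_flux p s\<bar> = \<bar>s\<bar> powr (p - 1)"
  by (simp add: plap_flux_eq abs_mult sgn_if)

lemma plap_flux_measurable [measurable]: "plap_flux p \<in> borel_measurable borel"
  unfolding plap_flux_def[abs_def] by measurable

text \<open>Subadditivity of a concave power: the fractions \<open>a / b\<close> and
  \<open>(b - a) / b\<close> add up to 1 and lie in [0, 1], where s \<le> s^q.\<close>

lemma powr_diff_le:
  fixes a b :: real
  assumes "0 \<le> a" "a \<le> b" "0 \<le> q" "q \<le> 1"
  shows "b powr q - a powr q \<le> (b - a) powr q"
proof (cases "b = a")
  case False
  with assms have b: "0 < b" "a < b" by auto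
  have "a / b \<le> (a / b) powr q" using assms b
    powr_mono'[of q 1 "a / b"] by simp
  moreover have "(b - a) / b \<le> ((b - a) / b) powr q" using assms b
    powr_mono'[of q 1 "(b - a) / b"] by simp
  moreover have "a / b + (b - a) / b = 1" using b by (simp add: field_simps)
  ultimately have "1 \<le> (a / b) powr q + ((b - a) / b) powr q" by linarith
  then have "b powr q * 1 \<le> b powr q * ((a / b) powr q + ((b - a) / b) powr q)"
    by (intro mult_left_mono) auto
  also have "\<dots> = a powr q + (b - a) powr q"
    using assms b by (simp add: powr_divide field_simps)
  finally show ?thesis by simp
qed simp

lemma plap_flux_mono:
  assumes "1 < p" "a < b"
  shows "plap_flux p a < plap_flux p b"
proof -
  consider "0 \<le> a" | "a < 0" "0 < b" | "b = 0" | "b < 0" using assms by linarith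
  then show ?thesis
  proof cases
    case 1 then show ?thesis using assms by (auto simp: plap_flux_eq sgn_if intro!: powr_less_mono2)
  next
    case 2
    have "0 < \<bar>a\<bar> powr (p - 1)" "0 < \<bar>b\<bar> powr (p-1)" using 2 by auto
    then show ?thesis using 2 by (simp add: plap_flux_eq del: powr_gt_zero)
  next
    case 3 then show ?thesis using assms by (auto simp: plap_flux_eq sgn_if)
  next
    case 4
    have "(-b) powr (p - 1) < (-a) powr (p - 1)" using assms 4 by (intro powr_less_mono2) auto
    then show ?thesis using 4 assms by (simp add: plap_flux_eq sgn_if)
  qed
qed

lemma plap_flux_monotone:
  assumes "1 < p"
  shows "0 \<le> (a - b) * (plap_flux p a - plap_flux p b)"
  using plap_flux_mono[OF assms, of a b] plap_flux_mono[OF assms, of b a]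
  by (cases a b rule: linorder_cases) (auto simp: mult_nonpos_nonpos)

text \<open>For equal signs this is \<open>powr_diff_le\<close>. The factor 2 comes from opposite
  signs, where each of \<bar>a\<bar> and \<bar>b\<bar> is at most \<bar>a - b\<bar>.\<close>

lemma plap_flux_holder:
  assumes "1 < p" "p < 2"
  shows "\<bar>plap_flux p a - plap_flux p b\<bar> \<le> 2 * \<bar>a - b\<bar> powr (p - 1)"
proof (induction a b rule: linorder_wlog)
  case (sym a b)
  then show ?case by (simp add: abs_minus_commute)
next
  case (le a b)
  define q where "q = p - 1"
  have q: "0 < q" "q < 1" using assms by (auto simp: q_def)
  have nn: "0 \<le> \<bar>a - b\<bar> powr q" by simp
  consider "0 \<le> a" | "a < 0" "0 \<le> b" | "b < 0" using le by linarith
  then show ?case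
  proof cases
    case 1
    have "b powr q - a powr q \<le> (b - a) powr q" using 1 le q by (intro powr_diff_le) auto
    moreover have "a powr q \<le> b powr q" using 1 le q by (intro powr_mono2) auto
    ultimately show ?thesis using 1 le nn q by (simp add: plap_flux_eq flip: q_def) (auto simp: sgn_if abs_if)
  next
    case 2
    have "\<bar>a\<bar> powr q \<le> \<bar>a - b\<bar> powr q" "\<bar>b\<bar> powr q \<le> \<bar>a - b\<bar> powr q"
      "0 \<le> \<bar>a\<bar> powr q" "0 \<le> \<bar>b\<bar> powr q"
      using 2 q by (auto intro!: powr_mono2)
    moreover have "plap_flux p a = - (\<bar>a\<bar> powr q)" "plap_flux p b = \<bar>b\<bar> powr q"
      using 2 q by (cases "b = 0", auto simp: plap_flux_eq q_def sgn_if)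
    ultimately show ?thesis unfolding q_def[symmetric] by linarith
  next
    case 3
    have "(-a) powr q - (-b) powr q \<le> ((-a) - (-b)) powr q" using 3 le q by (intro powr_diff_le) auto
    moreover have "(-b) powr q \<le> (-a) powr q" using 3 le q by (intro powr_mono2) auto
    ultimately show ?thesis using 3 le nn q by (auto simp: plap_flux_eq q_def sgn_if abs_if)
  qed
qed

text \<open>Reduces a product of oscillations of gradient and flux to the p-th power of the
  oscillation of the gradient alone, which is controlled by integrability in L^p.\<close>

lemma plap_flux_diff_mult_le:
  assumes "1 < p" "p < 2"
  shows "(a - b) * (plap_flux p a - plap_flux p b) \<le> 2 * \<bar>a - b\<bar> powr p"
proof -
  have "(a - b) * (plap_flux p a - plap_flux p b) \<le> \<bar>a - b\<bar> * \<bar>plap_flux p a - plap_flux p b\<bar>"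
    by (metis abs_ge_self abs_mult)
  also have "\<dots> \<le> \<bar>a - b\<bar> * (2 * \<bar>a - b\<bar> powr (p - 1))"
    using plap_flux_holder[OF assms] by (intro mult_left_mono) auto
  also have "\<dots> = 2 * \<bar>a - b\<bar> powr p"
    using powr_add[of "\<bar>a - b\<bar>" 1 "p - 1"] by (cases "a = b") auto
  finally show ?thesis .
qed

text \<open>Each summand is at most the maximum. Three summands are needed because two values of the
  gradient are compared through two values of a continuous approximation.\<close>

lemma powr_sum3_le:
  fixes x y z :: real
  assumes "0 \<le> p" "0 \<le> x" "0 \<le> y" "0 \<le> z"
  shows "(x + y + z) powr p \<le> 3 powr p * (x powr p + y powr p + z powr p)"
proof -
  define m where "m = max x (max y z)"
  have "(x + y + z) powr p \<le> (3 * m) powr p" using assms by (intro powr_mono2) (auto simp: m_def)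
  also have "\<dots> = 3 powr p * m powr p" using assms by (simp add: powr_mult m_def)
  also have "m powr p \<le> x powr p + y powr p + z powr p"
    by (auto simp: m_def max_def add_nonneg_nonneg)
  finally show ?thesis by (simp add: mult_left_mono)
qed

section \<open>Mollification\<close>

lemma kern_continuous [continuous_intros]:
  "continuous_on S f \<Longrightarrow> continuous_on S (\<lambda>x. kern r (f x))"
  unfolding kern_def by (intro continuous_intros)

lemma kern'_continuous [continuous_intros]:
  "continuous_on S f \<Longrightarrow> continuous_on S (\<lambda>x. kern' r (f x))"
  unfolding kern'_def by (intro continuous_intros)

lemma kern_measurable [measurable]: "kern r \<in> borel_measurable borel"
  by (intro borel_measurable_continuous_onI continuous_intros)

lemma kern'_measurable [measurable]: "kern' r \<in> borel_measurable borel"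
  by (intro borel_measurable_continuous_onI continuous_intros)

lemma kern_minus: "kern r (x - y) = kern r (y - x)"
  by (simp add: kern_def power2_commute)

lemma fst_snd_measurable [measurable]:
  "(fst :: real \<times> real \<Rightarrow> real) \<in> borel_measurable borel" "(snd :: real \<times> real \<Rightarrow> real) \<in> borel_measurable borel"
  by (auto intro!: borel_measurable_continuous_onI continuous_intros)

text \<open>The derivative of a convolution with a kernel of class \<open>C\<^sup>1\<^sup>,\<^sup>1\<close> needs no domination argument:
  the Taylor remainder is quadratic, uniformly in the integration variable.\<close>

lemma convolution_deriv:
  fixes f a b :: "'a \<Rightarrow> real" and k k' :: "real \<Rightarrow> real"
  assumes f: "integrable M f" and [measurable]: "a \<in> borel_measurable M" "b \<in> borel_measurable M"
    and b: "\<And>z. \<bar>b z\<bar> \<le> B"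
    and d: "\<And>x. (k has_real_derivative k' x) (at x)"
    and L: "L \<ge> 0" "\<And>x y. \<bar>k' x - k' y\<bar> \<le> L * \<bar>x - y\<bar>"
    and K: "\<And>x. \<bar>k x\<bar> \<le> K" "\<And>x. \<bar>k' x\<bar> \<le> K"
    and [measurable]: "k \<in> borel_measurable borel" "k' \<in> borel_measurable borel"
  shows "((\<lambda>y. \<integral>z. f z * (k (a z - y) * b z) \<partial>M) has_real_derivative
            - (\<integral>z. f z * (k' (a z - y) * b z) \<partial>M)) (at y)"
proof -
  have [measurable]: "f \<in> borel_measurable M" using f by auto
  have B0: "0 \<le> B" using b[of undefined] by linarith
  have K0: "0 \<le> K" using K(1)[of undefined] by linarith
  have int: "integrable M (\<lambda>z. f z * (h (a z - y) * b z))"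
    if h: "\<And>x. \<bar>h x\<bar> \<le> K" and [measurable]: "h \<in> borel_measurable borel" for h y
  proof (rule Bochner_Integration.integrable_bound[of M "\<lambda>z. (K * B) * f z"])
    show "AE z in M. norm (f z * (h (a z - y) * b z)) \<le> norm (K * B * f z)"
    proof (intro AE_I2)
      fix z
      have "\<bar>f z\<bar> * (\<bar>h (a z - y)\<bar> * \<bar>b z\<bar>) \<le> \<bar>f z\<bar> * (K * B)"
        using h b K0 by (intro mult_left_mono mult_mono) auto
      then show "norm (f z * (h (a z - y) * b z)) \<le> norm (K * B * f z)"
        using K0 B0 by (simp add: abs_mult algebra_simps)
    qed
  qed (use f in auto)
  define J where "J y = (\<integral>z. f z * (k (a z - y) * b z) \<partial>M)" for y
  define J' where "J' = - (\<integral>z. f z * (k' (a z - y) * b z) \<partial>M)"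
  define C where "C = L * B * (\<integral>z. \<bar>f z\<bar> \<partial>M)"
  have C0: "0 \<le> C" using L B0 by (simp add: C_def)
  have main: "\<bar>J (y + h) - J y - h * J'\<bar> \<le> C * h\<^sup>2" for h
  proof -
    have eq: "J (y + h) - J y - h * J' =
        (\<integral>z. f z * (k (a z - (y + h)) * b z) - f z * (k (a z - y) * b z) + h * (f z * (k' (a z - y) * b z)) \<partial>M)"
      unfolding J_def J'_def
      using int[of k, OF K(1)] int[of k', OF K(2)] by simp
    have "\<bar>J (y + h) - J y - h * J'\<bar> \<le> (\<integral>z. \<bar>f z * (k (a z - (y + h)) * b z) - f z * (k (a z - y) * b z) + h * (f z * (k' (a z - y) * b z))\<bar> \<partial>M)"
      unfolding eq by (rule integral_abs_bound)
    also have "\<dots> \<le> (\<integral>z. (L * B * h\<^sup>2) * \<bar>f z\<bar> \<partial>M)"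
    proof (rule integral_mono)
      have i: "integrable M (\<lambda>z. f z * (k (a z - (y + h)) * b z))" "integrable M (\<lambda>z. f z * (k (a z - y) * b z))"
        "integrable M (\<lambda>z. f z * (k' (a z - y) * b z))"
        by (rule int[OF K(1)]; simp)+ (rule int[OF K(2)]; simp)
      show "integrable M (\<lambda>z. \<bar>f z * (k (a z - (y + h)) * b z) - f z * (k (a z - y) * b z) + h * (f z * (k' (a z - y) * b z))\<bar>)"
        by (rule integrable_abs[OF Bochner_Integration.integrable_add[OF Bochner_Integration.integrable_diff[OF i(1,2)] integrable_mult_right[OF i(3)]]])
      show "integrable M (\<lambda>z. L * B * h\<^sup>2 * \<bar>f z\<bar>)" using f by auto
      fix z
      have "\<bar>k (a z - (y + h)) - k (a z - y) + h * k' (a z - y)\<bar> \<le> L * h\<^sup>2"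
        using quadratic_remainder[of k k' L "a z - (y + h)" "a z - y", OF d L(2) L(1)] by (simp add: algebra_simps)
      then have "\<bar>f z\<bar> * (\<bar>k (a z - (y + h)) - k (a z - y) + h * k' (a z - y)\<bar> * \<bar>b z\<bar>) \<le> \<bar>f z\<bar> * ((L * h\<^sup>2) * B)"
        using b L by (intro mult_left_mono mult_mono) auto
      moreover have "f z * (k (a z - (y + h)) * b z) - f z * (k (a z - y) * b z) + h * (f z * (k' (a z - y) * b z))
          = f z * ((k (a z - (y + h)) - k (a z - y) + h * k' (a z - y)) * b z)" by (simp only: algebra_simps)
      ultimately show "\<bar>f z * (k (a z - (y + h)) * b z) - f z * (k (a z - y) * b z) + h * (f z * (k' (a z - y) * b z))\<bar>
          \<le> L * B * h\<^sup>2 * \<bar>f z\<bar>"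
        by (simp only: abs_mult mult_ac)
    qed
    also have "\<dots> = C * h\<^sup>2" by (simp add: C_def)
    finally show ?thesis .
  qed
  have "(\<lambda>h. (J (y + h) - J y) / h - J') \<midarrow>0\<rightarrow> 0"
  proof (rule Lim_null_comparison)
    show "\<forall>\<^sub>F h in at 0. norm ((J (y + h) - J y) / h - J') \<le> C * \<bar>h\<bar>"
      unfolding eventually_at_filter
    proof (intro always_eventually allI impI)
      fix h :: real assume "h \<noteq> 0"
      then have "(J (y + h) - J y) / h - J' = (J (y + h) - J y - h * J') / h" by (simp add: field_simps)
      then have "norm ((J (y + h) - J y) / h - J') = \<bar>J (y + h) - J y - h * J'\<bar> / \<bar>h\<bar>" by simp
      also have "\<dots> \<le> C * h\<^sup>2 / \<bar>h\<bar>" using main by (intro divide_right_mono) auto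
      also have "\<dots> = C * \<bar>h\<bar>" using \<open>h \<noteq> 0\<close> by (simp add: power2_eq_square field_simps flip: abs_mult)
      finally show "norm ((J (y + h) - J y) / h - J') \<le> C * \<bar>h\<bar>" .
    qed
    show "(\<lambda>h. C * \<bar>h\<bar>) \<midarrow>0\<rightarrow> 0"
      by (rule tendsto_eq_intros refl)+ simp
  qed
  then have "(\<lambda>h. (J (y + h) - J y) / h) \<midarrow>0\<rightarrow> J'" by (simp add: LIM_zero_iff)
  then show ?thesis unfolding DERIV_def J_def J'_def .
qed

lemma convolution_continuous:
  fixes f :: "real \<times> real \<Rightarrow> real" and k1 k2 :: "real \<Rightarrow> real"
  assumes f: "integrable lborel f"
    and k: "continuous_on UNIV k1" "continuous_on UNIV k2"
    and K: "\<And>x. \<bar>k1 x\<bar> \<le> K1" "\<And>x. \<bar>k2 x\<bar> \<le> K2"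
  shows "continuous_on S (\<lambda>w. \<integral>z. f z * (k1 (fst z - fst w) * k2 (snd z - snd w)) \<partial>lborel)"
proof -
  have [measurable]: "f \<in> borel_measurable borel" "k1 \<in> borel_measurable borel" "k2 \<in> borel_measurable borel"
    using f k by (auto intro: borel_measurable_continuous_onI)
  have K0: "0 \<le> K1" "0 \<le> K2" using K(1)[of 0] K(2)[of 0] by linarith+
  have "isCont (\<lambda>w. \<integral>z. f z * (k1 (fst z - fst w) * k2 (snd z - snd w)) \<partial>lborel) w" for w
    unfolding continuous_at_sequentially o_def
  proof (intro allI impI)
    fix X assume X: "X \<longlonglongrightarrow> w"
    show "(\<lambda>n. \<integral>z. f z * (k1 (fst z - fst (X n)) * k2 (snd z - snd (X n))) \<partial>lborel)
         \<longlonglongrightarrow> (\<integral>z. f z * (k1 (fst z - fst w) * k2 (snd z - snd w)) \<partial>lborel)"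
    proof (rule integral_dominated_convergence[where w = "\<lambda>z. K1 * K2 * \<bar>f z\<bar>"])
      show "AE z in lborel. (\<lambda>n. f z * (k1 (fst z - fst (X n)) * k2 (snd z - snd (X n))))
          \<longlonglongrightarrow> f z * (k1 (fst z - fst w) * k2 (snd z - snd w))"
        using k X by (intro AE_I2 tendsto_intros isCont_tendsto_compose[of _ k1] isCont_tendsto_compose[of _ k2])
          (auto simp: continuous_on_eq_continuous_at intro: tendsto_intros)
      show "AE z in lborel. norm (f z * (k1 (fst z - fst (X n)) * k2 (snd z - snd (X n)))) \<le> K1 * K2 * \<bar>f z\<bar>" for n
      proof (intro AE_I2)
        fix z
        have "\<bar>f z\<bar> * (\<bar>k1 (fst z - fst (X n))\<bar> * \<bar>k2 (snd z - snd (X n))\<bar>) \<le> \<bar>f z\<bar> * (K1 * K2)"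
          using K K0 by (intro mult_left_mono mult_mono) auto
        then show "norm (f z * (k1 (fst z - fst (X n)) * k2 (snd z - snd (X n)))) \<le> K1 * K2 * \<bar>f z\<bar>"
          by (simp add: abs_mult algebra_simps)
      qed
    qed (use f in auto)
  qed
  then show ?thesis by (simp add: continuous_at_imp_continuous_on)
qed

section \<open>Averages with the normalized product kernel\<close>

definition kmass :: "real \<Rightarrow> real" where
  "kmass r = (\<integral>z. kern r (fst z) * kern r (snd z) \<partial>(lborel :: (real \<times> real) measure))"

definition kk :: "real \<Rightarrow> real \<times> real \<Rightarrow> real \<times> real \<Rightarrow> real" where
  "kk r w z = kern r (fst z - fst w) * kern r (snd z - snd w) / kmass r"

definition square :: "real \<Rightarrow> real \<times> real \<Rightarrow> (real \<times> real) set" where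
  "square r w = {z. \<bar>fst z - fst w\<bar> \<le> r \<and> \<bar>snd z - snd w\<bar> \<le> r}"

definition moll :: "real \<Rightarrow> (real \<times> real \<Rightarrow> real) \<Rightarrow> real \<times> real \<Rightarrow> real" where
  "moll r f w = (\<integral>z. f z * kk r w z \<partial>lborel)"

definition mollifiable :: "real \<Rightarrow> (real \<times> real \<Rightarrow> real) \<Rightarrow> real \<times> real \<Rightarrow> bool" where
  "mollifiable r f w \<longleftrightarrow> integrable lborel (\<lambda>z. f z * kk r w z)"

lemma square_eq_cbox: "square r w = cbox (fst w - r, snd w - r) (fst w + r, snd w + r)"
  by (cases w) (auto simp: square_def cbox_Pair_eq abs_le_iff)

lemma kern_kern_integrable:
  assumes "0 < r"
  shows "integrable lborel (\<lambda>z. kern r (fst z - a) * kern r (snd z - b))"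
proof -
  have "integrable lborel (\<lambda>z. indicator (square r (a, b)) z *\<^sub>R (kern r (fst z - a) * kern r (snd z - b)))"
    by (intro borel_integrable_compact continuous_intros) (simp add: square_eq_cbox compact_cbox)
  also have "(\<lambda>z. indicator (square r (a, b)) z *\<^sub>R (kern r (fst z - a) * kern r (snd z - b))) =
      (\<lambda>z. kern r (fst z - a) * kern r (snd z - b))"
    using kern_outside[OF assms] by (force simp: fun_eq_iff indicator_def square_def not_le)
  finally show ?thesis .
qed

lemma lborel_integral_shift:
  fixes f :: "'a::euclidean_space \<Rightarrow> real"
  assumes [measurable]: "f \<in> borel_measurable borel"
  shows "(\<integral>z. f (z - c) \<partial>lborel) = (\<integral>z. f z \<partial>lborel)"
proof -
  have "(\<integral>z. f z \<partial>lborel) = (\<integral>z. f z \<partial>(distr lborel borel ((+) (- c))))" by (simp only: lborel_distr_plus)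
  also have "\<dots> = (\<integral>z. f (z - c) \<partial>lborel)" by (subst integral_distr) auto
  finally show ?thesis ..
qed

lemma kern_kern_integral: "(\<integral>z. kern r (fst z - fst w) * kern r (snd z - snd w) \<partial>lborel) = kmass r"
  using lborel_integral_shift[of "\<lambda>z. kern r (fst z) * kern r (snd z)" w] by (simp add: kmass_def)

text \<open>On the concentric square of half the radius, whose area is \<open>r * r\<close>, both
  factors are at least \<open>c\<close>, the value of \<open>kern r\<close> at distance
  \<open>r / 2\<close>.\<close>

lemma kmass_pos:
  assumes "0 < r" shows "0 < kmass r"
proof -
  define c where "c = (r\<^sup>2 - (r/2)\<^sup>2) ^ 3"
  have c: "0 < c" using assms by (simp add: c_def power2_eq_square)
  have ge: "c \<le> kern r x" if "\<bar>x\<bar> \<le> r / 2" for x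
  proof -
    have "x\<^sup>2 \<le> (r/2)\<^sup>2" using that assms abs_le_square_iff[of x "r/2"] by simp
    moreover have "(r/2)\<^sup>2 \<le> r\<^sup>2" using assms by (intro power_mono) auto
    ultimately show ?thesis unfolding c_def kern_def by (intro power_mono) auto
  qed
  have "0 < c * c * r * r" using c assms by simp
  also have "\<dots> = (\<integral>z. indicator (square (r/2) (0,0)) z *\<^sub>R (c * c) \<partial>lborel)"
    using assms by (simp add: square_eq_cbox content_Pair flip: cbox_Pair_eq)
  also have "\<dots> \<le> kmass r"
    unfolding kmass_def
  proof (rule integral_mono)
    show "integrable lborel (\<lambda>z. indicator (square (r/2) (0,0)) z *\<^sub>R (c * c) :: real)"
      by (intro borel_integrable_compact continuous_intros) (simp add: square_eq_cbox compact_cbox)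
    show "integrable lborel (\<lambda>z. kern r (fst z) * kern r (snd z))"
      using kern_kern_integrable[OF assms, of 0 0] by simp
    show "indicator (square (r/2) (0,0)) z *\<^sub>R (c * c) \<le> kern r (fst z) * kern r (snd z)" for z
      using ge c by (auto simp: indicator_def square_def intro!: mult_mono)
  qed
  finally show ?thesis .
qed

lemma kk_nonneg [simp]: "0 \<le> kk r w z"
  unfolding kk_def kmass_def by (intro divide_nonneg_nonneg mult_nonneg_nonneg integral_nonneg) auto

lemma kk_outside: "0 < r \<Longrightarrow> z \<notin> square r w \<Longrightarrow> kk r w z = 0"
  by (auto simp: kk_def square_def kern_outside not_le)

lemma kk_measurable [measurable]: "kk r w \<in> borel_measurable borel"
  unfolding kk_def[abs_def] by measurable

lemma kk_integrable: "0 < r \<Longrightarrow> integrable lborel (kk r w)"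
  unfolding kk_def[abs_def] using kern_kern_integrable by auto

lemma kk_integral: "0 < r \<Longrightarrow> (\<integral>z. kk r w z \<partial>lborel) = 1"
  unfolding kk_def[abs_def] using kmass_pos[of r] by (simp add: kern_kern_integral)

lemma kk_commute: "kk r w z = kk r z w"
  by (simp add: kk_def kern_minus[of r "fst z"] kern_minus[of r "snd z"])

lemma kk_bounded: "0 < r \<Longrightarrow> kk r w z \<le> ((r\<^sup>2) ^ 3 * (r\<^sup>2) ^ 3) / kmass r"
  unfolding kk_def
proof (intro divide_right_mono mult_mono)
  show "0 < r \<Longrightarrow> 0 \<le> kmass r" using kmass_pos[of r] by simp
  show "kern r (fst z - fst w) \<le> (r\<^sup>2) ^ 3" "kern r (snd z - snd w) \<le> (r\<^sup>2) ^ 3"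
    using kern_bounded[of r] by (simp_all add: abs_le_iff del: power_mult_numeral)
qed auto

lemma mollifiable_const: "0 < r \<Longrightarrow> mollifiable r (\<lambda>z. c) w"
  by (simp add: mollifiable_def kk_integrable)

lemma mollifiable_add: "mollifiable r f w \<Longrightarrow> mollifiable r g w \<Longrightarrow> mollifiable r (\<lambda>z. f z + g z) w"
  by (simp add: mollifiable_def distrib_right)

lemma mollifiable_cmult: "mollifiable r f w \<Longrightarrow> mollifiable r (\<lambda>z. c * f z) w"
  by (simp add: mollifiable_def mult.assoc)

lemma mollifiable_integrable:
  assumes f: "integrable lborel f" and r: "0 < r"
  shows "mollifiable r f w"
  unfolding mollifiable_def
proof (rule Bochner_Integration.integrable_bound)
  define K where "K = ((r\<^sup>2) ^ 3 * (r\<^sup>2) ^ 3) / kmass r"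
  show "integrable lborel (\<lambda>z. K * f z)" using f by simp
  show "AE z in lborel. norm (f z * kk r w z) \<le> norm (K * f z)"
  proof (intro AE_I2)
    fix z
    have "\<bar>f z\<bar> * \<bar>kk r w z\<bar> \<le> \<bar>f z\<bar> * \<bar>K\<bar>"
      using kk_bounded[OF r, of w z] kk_nonneg[of r w z] unfolding K_def by (intro mult_left_mono) linarith+
    then show "norm (f z * kk r w z) \<le> norm (K * f z)" by (simp add: abs_mult mult.commute)
  qed
qed (use f in auto)

lemma moll_const: "0 < r \<Longrightarrow> moll r (\<lambda>z. c) w = c"
  by (simp add: moll_def kk_integral kk_integrable)

lemma moll_add: "mollifiable r f w \<Longrightarrow> mollifiable r g w \<Longrightarrow> moll r (\<lambda>z. f z + g z) w = moll r f w + moll r g w"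
  by (simp add: mollifiable_def moll_def distrib_right)

lemma moll_cmult: "mollifiable r f w \<Longrightarrow> moll r (\<lambda>z. c * f z) w = c * moll r f w"
  by (simp add: mollifiable_def moll_def mult.assoc)

lemma moll_mono:
  assumes "0 < r" "mollifiable r f w" "mollifiable r g w" "\<And>z. z \<in> square r w \<Longrightarrow> f z \<le> g z"
  shows "moll r f w \<le> moll r g w"
  unfolding moll_def
proof (rule integral_mono)
  show "f z * kk r w z \<le> g z * kk r w z" for z
    using assms(1) assms(4)[of z] kk_nonneg[of r w z] by (cases "z \<in> square r w") (simp_all add: kk_outside mult_right_mono)
qed (use assms in \<open>auto simp: mollifiable_def\<close>)

lemma moll_close:
  assumes r: "0 < r" and f: "mollifiable r f w"
    and e: "\<And>z. z \<in> square r w \<Longrightarrow> \<bar>f z - c\<bar> \<le> e"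
  shows "\<bar>moll r f w - c\<bar> \<le> e"
proof -
  have "f z \<le> c + e \<and> c - e \<le> f z" if "z \<in> square r w" for z using e[OF that] by (auto simp: abs_le_iff)
  then have "moll r f w \<le> moll r (\<lambda>z. c + e) w" "moll r (\<lambda>z. c - e) w \<le> moll r f w"
    using r f by (auto intro!: moll_mono mollifiable_const)
  then show ?thesis using r by (auto simp: moll_const abs_le_iff)
qed

lemma moll_nonneg:
  assumes "\<And>z. 0 \<le> f z" shows "0 \<le> moll r f w"
  unfolding moll_def using assms by (intro Bochner_Integration.integral_nonneg) auto

text \<open>Symmetrization: \<open>2 M[X] M[Y]\<close> is the double average of
  \<open>X Y' + X' Y = X Y + X' Y' - (X - X') (Y - Y')\<close>, and \<open>X Y \<ge> 0\<close> because the flux is monotone.\<close>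

lemma moll_flux_product_ge:
  assumes p: "1 < p" "p < 2" and r: "0 < r"
    and g: "mollifiable r g w" and Ag: "mollifiable r (\<lambda>z. plap_flux p (g z)) w"
    and d: "mollifiable r (\<lambda>z. \<bar>g z - h z\<bar> powr p) w"
    and \<omega>: "\<And>z z'. z \<in> square r w \<Longrightarrow> z' \<in> square r w \<Longrightarrow> \<bar>h z - h z'\<bar> \<le> \<omega>"
  shows "(moll r g w - l) * (moll r (\<lambda>z. plap_flux p (g z)) w - plap_flux p l)
     \<ge> - (3 powr p) * (2 * moll r (\<lambda>z. \<bar>g z - h z\<bar> powr p) w + \<omega> powr p)"
proof -
  define X where "X z = g z + (- l)" for z
  define Y where "Y z = plap_flux p (g z) + (- plap_flux p l)" for z
  define D where "D z = \<bar>g z - h z\<bar> powr p" for z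
  have X: "mollifiable r X w" unfolding X_def[abs_def] using g r by (intro mollifiable_add mollifiable_const)
  have Y: "mollifiable r Y w" unfolding Y_def[abs_def] using Ag r by (intro mollifiable_add mollifiable_const)
  have D: "mollifiable r D w" unfolding D_def[abs_def] by (rule d)
  have mX: "moll r X w = moll r g w - l"
    unfolding X_def[abs_def] using g r by (subst moll_add) (simp_all add: moll_const mollifiable_const)
  have mY: "moll r Y w = moll r (\<lambda>z. plap_flux p (g z)) w - plap_flux p l"
    unfolding Y_def[abs_def] using Ag r by (subst moll_add) (simp_all add: moll_const mollifiable_const)
  \<comment> \<open>The sign is absorbed into the constant so that the lower bound is a sum of
    multiples, to which additivity and homogeneity of \<open>moll\<close> apply directly.\<close>
  define c where "c = - (2 * 3 powr p)"
  have pt: "c * D z + c * (D z' + \<omega> powr p) \<le> Y z' * X z + X z' * Y z"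
    if z: "z \<in> square r w" "z' \<in> square r w" for z z'
  proof -
    have "0 \<le> X z * Y z" "0 \<le> X z' * Y z'"
      using plap_flux_monotone[OF p(1), of _ l] by (auto simp: X_def Y_def)
    moreover have "(X z - X z') * (Y z - Y z') \<le> 2 * \<bar>g z - g z'\<bar> powr p"
      using plap_flux_diff_mult_le[OF p, of "g z" "g z'"] by (simp add: X_def Y_def)
    moreover have "\<bar>g z - g z'\<bar> powr p \<le> (\<bar>g z - h z\<bar> + \<omega> + \<bar>g z' - h z'\<bar>) powr p"
      using \<omega>[OF z] p by (intro powr_mono2) auto
    moreover have "\<dots> \<le> 3 powr p * (D z + \<omega> powr p + D z')"
      unfolding D_def using p \<omega>[OF z] by (intro powr_sum3_le) auto
    ultimately show ?thesis by (simp add: c_def algebra_simps)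
  qed
  \<comment> \<open>The double average is taken one variable at a time: \<open>z'\<close> is frozen
    here and averaged next, so monotonicity of \<open>moll\<close> is used twice and no measure on
    pairs of points appears.\<close>
  have i1: "c * moll r D w + c * (D z' + \<omega> powr p) \<le> Y z' * moll r X w + X z' * moll r Y w"
    if z': "z' \<in> square r w" for z'
  proof -
    have "moll r (\<lambda>z. c * D z + c * (D z' + \<omega> powr p)) w \<le> moll r (\<lambda>z. Y z' * X z + X z' * Y z) w"
      using r X Y D pt z' by (intro moll_mono mollifiable_add mollifiable_cmult mollifiable_const) auto
    then show ?thesis
      using r X Y D by (simp add: moll_add mollifiable_cmult mollifiable_const moll_cmult moll_const)
  qed
  have "moll r (\<lambda>z'. c * D z' + c * (moll r D w + \<omega> powr p)) w
      \<le> moll r (\<lambda>z'. moll r X w * Y z' + moll r Y w * X z') w"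
  proof (intro moll_mono mollifiable_add mollifiable_cmult mollifiable_const r X Y D)
    fix z' assume "z' \<in> square r w"
    from i1[OF this] show "c * D z' + c * (moll r D w + \<omega> powr p)
      \<le> moll r X w * Y z' + moll r Y w * X z'" by (simp add: algebra_simps)
  qed
  then have "c * moll r D w + c * (moll r D w + \<omega> powr p)
       \<le> moll r X w * moll r Y w + moll r Y w * moll r X w"
    using r X Y D by (simp add: moll_add mollifiable_cmult mollifiable_const moll_cmult moll_const)
  then have "- (3 powr p) * (2 * moll r D w + \<omega> powr p) \<le> moll r X w * moll r Y w"
    by (simp add: c_def algebra_simps)
  then show ?thesis unfolding mX mY D_def[abs_def] .
qed

text \<open>By Tonelli and the symmetry of \<open>kk\<close> in its two points, the kernel has
  integral 1 in \<open>w\<close> as well, so averaging preserves the integral of \<open>d\<close>.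
  The resulting bound does not depend on the radius, which allows \<open>d\<close> to be fixed
  before \<open>r\<close>.\<close>

lemma moll_integral_le:
  assumes d: "integrable lborel d" "\<And>z. 0 \<le> d z" and r: "0 < r" and S: "S \<in> sets borel"
  shows "integrable lborel (moll r d)" and "(\<integral>w. indicator S w *\<^sub>R moll r d w \<partial>lborel) \<le> (\<integral>z. d z \<partial>lborel)"
proof -
  have [measurable]: "d \<in> borel_measurable borel" using d by auto
  have [measurable]: "(\<lambda>(w, z). kk r w z) \<in> borel_measurable (lborel \<Otimes>\<^sub>M lborel)"
    unfolding lborel_prod kk_def using kmass_pos[OF r]
    by (auto intro!: borel_measurable_continuous_onI continuous_intros simp: split_beta)
  have nn: "0 \<le> d z * kk r w z" for z w using d by simp
  have mollI: "ennreal (moll r d w) = (\<integral>\<^sup>+z. ennreal (d z * kk r w z) \<partial>lborel)" for w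
    unfolding moll_def using mollifiable_integrable[OF d(1) r, of w] nn
    by (subst nn_integral_eq_integral) (auto simp: mollifiable_def)
  have kkI: "(\<integral>\<^sup>+w. ennreal (kk r w z) \<partial>lborel) = 1" for z
  proof -
    have "(\<integral>\<^sup>+w. ennreal (kk r w z) \<partial>lborel) = (\<integral>\<^sup>+w. ennreal (kk r z w) \<partial>lborel)"
      by (rule nn_integral_cong) (rule arg_cong[OF kk_commute])
    also have "\<dots> = 1"
      using nn_integral_eq_integral[OF kk_integrable[OF r], of z] kk_integral[OF r, of z] by simp
    finally show ?thesis .
  qed
  have "(\<integral>\<^sup>+w. ennreal (moll r d w) \<partial>lborel) = (\<integral>\<^sup>+w. \<integral>\<^sup>+z. ennreal (d z * kk r w z) \<partial>lborel \<partial>lborel)"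
    by (simp add: mollI)
  also have "\<dots> = (\<integral>\<^sup>+z. \<integral>\<^sup>+w. ennreal (d z * kk r w z) \<partial>lborel \<partial>lborel)"
    by (rule lborel_pair.Fubini'[symmetric]) measurable
  also have "\<dots> = (\<integral>\<^sup>+z. ennreal (d z) \<partial>lborel)"
    using d(2) by (simp add: ennreal_mult nn_integral_cmult kkI)
  also have "\<dots> = ennreal (\<integral>z. d z \<partial>lborel)" using d by (intro nn_integral_eq_integral) auto
  finally have eq: "(\<integral>\<^sup>+w. ennreal (moll r d w) \<partial>lborel) = ennreal (\<integral>z. d z \<partial>lborel)" .
  have [measurable]: "moll r d \<in> borel_measurable borel"
  proof -
    have "(\<lambda>w. \<integral>z. (case (w, z) of (w, z) \<Rightarrow> d z * kk r w z) \<partial>lborel) \<in> borel_measurable lborel"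
      by (rule lborel.borel_measurable_lebesgue_integral) measurable
    then show ?thesis by (simp add: moll_def[abs_def])
  qed
  have m0: "0 \<le> moll r d w" for w by (rule moll_nonneg) (rule d)
  show int: "integrable lborel (moll r d)"
    by (rule integrableI_nonneg) (use m0 eq in auto)
  have "(\<integral>w. moll r d w \<partial>lborel) = (\<integral>z. d z \<partial>lborel)"
    using eq nn_integral_eq_integral[OF int] m0 d(2) by (simp add: ennreal_inj integral_nonneg)
  moreover have "(\<integral>w. indicator S w *\<^sub>R moll r d w \<partial>lborel) \<le> (\<integral>w. moll r d w \<partial>lborel)"
    using m0 S int by (intro integral_mono integrable_mult_indicator) (auto simp: indicator_def)
  ultimately show "(\<integral>w. indicator S w *\<^sub>R moll r d w \<partial>lborel) \<le> (\<integral>z. d z \<partial>lborel)" by simp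
qed

section \<open>Energy inequality and approximation in \<open>L\<^sup>p\<close>\<close>

lemma continuous_on_slice1: "continuous_on (cbox (a, c) (b, d)) f \<Longrightarrow> t \<in> cbox c d \<Longrightarrow> continuous_on (cbox a b) (\<lambda>x. f (x, t))"
  by (rule continuous_on_compose2[where g = f and t = "cbox (a, c) (b, d)"])
    (auto intro!: continuous_intros simp: cbox_Pair_eq)

text \<open>Multiply the differential inequality by \<open>H1 (V)\<close>, where
  \<open>H v = max 0 (v - m) ^ 3 / 3\<close>. The cube makes \<open>H\<close> twice continuously
  differentiable, so both integrations by parts are classical. After the one in \<open>y\<close>,
  the product \<open>Vy * Q\<close> carries the weight \<open>H2 (V)\<close>, which lies between 0
  and \<open>2 * B\<close>; the lower bound \<open>- E\<close> for that product is therefore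
  enough.\<close>

lemma energy_inequality:
  fixes V Vs Vy Q Qy E :: "real \<times> real \<Rightarrow> real"
  assumes ord: "a \<le> c" "s0 \<le> s1"
    and cont: "continuous_on (cbox (a, s0) (c, s1)) V" "continuous_on (cbox (a, s0) (c, s1)) Vs"
      "continuous_on (cbox (a, s0) (c, s1)) Vy" "continuous_on (cbox (a, s0) (c, s1)) Q"
      "continuous_on (cbox (a, s0) (c, s1)) Qy" "continuous_on (cbox (a, s0) (c, s1)) E"
    and Vs: "\<And>y s. y \<in> {a..c} \<Longrightarrow> s \<in> {s0..s1} \<Longrightarrow> ((\<lambda>s. V (y, s)) has_real_derivative Vs (y, s)) (at s within {s0..s1})"
    and Vy: "\<And>y s. y \<in> {a..c} \<Longrightarrow> s \<in> {s0..s1} \<Longrightarrow> ((\<lambda>y. V (y, s)) has_real_derivative Vy (y, s)) (at y within {a..c})"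
    and Qy: "\<And>y s. y \<in> {a..c} \<Longrightarrow> s \<in> {s0..s1} \<Longrightarrow> ((\<lambda>y. Q (y, s)) has_real_derivative Qy (y, s)) (at y within {a..c})"
    and lateral: "\<And>s. s \<in> {s0..s1} \<Longrightarrow> V (a, s) \<le> m \<and> V (c, s) \<le> m"
    and init: "\<And>y. y \<in> {a..c} \<Longrightarrow> V (y, s0) \<le> m"
    and ineq: "\<And>y s. y \<in> {a..c} \<Longrightarrow> s \<in> {s0..s1} \<Longrightarrow> m < V (y, s) \<Longrightarrow> Vs (y, s) \<le> Qy (y, s) + \<eta>"
    and flux: "\<And>y s. y \<in> {a..c} \<Longrightarrow> s \<in> {s0..s1} \<Longrightarrow> - E (y, s) \<le> Vy (y, s) * Q (y, s)"
    and bound: "\<And>y s. y \<in> {a..c} \<Longrightarrow> s \<in> {s0..s1} \<Longrightarrow> V (y, s) \<le> m + B"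
    and nonneg: "\<And>y s. y \<in> {a..c} \<Longrightarrow> s \<in> {s0..s1} \<Longrightarrow> 0 \<le> E (y, s)" "0 \<le> \<eta>" "0 \<le> B"
  shows "integral {a..c} (\<lambda>y. max 0 (V (y, s1) - m) ^ 3 / 3)
      \<le> 2 * B * integral (cbox (a, s0) (c, s1)) E + B\<^sup>2 * \<eta> * ((c - a) * (s1 - s0))"
proof -
  let ?R = "cbox (a, s0) (c, s1)"
  define H where "H v = max 0 (v - m) ^ 3 / 3" for v :: real
  define H1 where "H1 v = max 0 (v - m) ^ 2" for v :: real
  define H2 where "H2 v = 2 * max 0 (v - m)" for v :: real
  have dH: "((\<lambda>x. H (f x)) has_real_derivative H1 (f x) * D) (at x within S)"
    if "(f has_real_derivative D) (at x within S)" for f D x S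
    unfolding H_def H1_def using that by (auto intro!: derivative_eq_intros)
  have dH1: "((\<lambda>x. H1 (f x)) has_real_derivative H2 (f x) * D) (at x within S)"
    if "(f has_real_derivative D) (at x within S)" for f D x S
    unfolding H2_def H1_def by (rule derivative_eq_intros that refl)+ simp
  have cH: "continuous_on ?R (\<lambda>z. H1 (V z))" "continuous_on ?R (\<lambda>z. H2 (V z))"
    unfolding H1_def H2_def by (intro continuous_intros cont)+
  have c1: "continuous_on ?R (\<lambda>z. H1 (V z) * Vs z)" by (intro continuous_intros cont cH)
  have c2: "continuous_on ?R (\<lambda>z. H2 (V z) * Vy z * Q z + H1 (V z) * Qy z)" by (intro continuous_intros cont cH)
  have I1: "integral ?R (\<lambda>z. H1 (V z) * Vs z) = integral {a..c} (\<lambda>y. H (V (y, s1)))"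
  proof -
    have "integral ?R (\<lambda>z. H1 (V z) * Vs z) = integral {a..c} (\<lambda>y. integral {s0..s1} (\<lambda>s. H1 (V (y, s)) * Vs (y, s)))"
      using integral_prod_continuous[OF c1] by simp
    also have "\<dots> = integral {a..c} (\<lambda>y. H (V (y, s1)))"
    proof (rule integral_cong)
      fix y assume y: "y \<in> {a..c}"
      have "((\<lambda>s. H1 (V (y, s)) * Vs (y, s)) has_integral H (V (y, s1)) - H (V (y, s0))) {s0..s1}"
        using dH[OF Vs[OF y]] ord
        by (intro fundamental_theorem_of_calculus) (auto simp: has_real_derivative_iff_has_vector_derivative[symmetric])
      moreover have "H (V (y, s0)) = 0" using init[OF y] by (simp add: H_def)
      ultimately show "integral {s0..s1} (\<lambda>s. H1 (V (y, s)) * Vs (y, s)) = H (V (y, s1))"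
        by (simp add: integral_unique)
    qed
    finally show ?thesis .
  qed
  \<comment> \<open>The integrand is the y-derivative of \<open>H1 (V) * Q\<close>, which vanishes
    on the lateral sides because V \<le> m there.\<close>
  have I2: "integral ?R (\<lambda>z. H2 (V z) * Vy z * Q z + H1 (V z) * Qy z) = 0"
  proof -
    have "integral ?R (\<lambda>z. H2 (V z) * Vy z * Q z + H1 (V z) * Qy z)
        = integral {a..c} (\<lambda>y. integral {s0..s1} (\<lambda>s. H2 (V (y, s)) * Vy (y, s) * Q (y, s) + H1 (V (y, s)) * Qy (y, s)))"
      using integral_prod_continuous[OF c2] by simp
    also have "\<dots> = integral {s0..s1} (\<lambda>s. integral {a..c} (\<lambda>y. H2 (V (y, s)) * Vy (y, s) * Q (y, s) + H1 (V (y, s)) * Qy (y, s)))"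
      using integral_swap_continuous[of a s0 c s1 "\<lambda>y s. H2 (V (y, s)) * Vy (y, s) * Q (y, s) + H1 (V (y, s)) * Qy (y, s)"] c2
      by (simp add: split_beta)
    also have "\<dots> = integral {s0..s1} (\<lambda>s. 0)"
    proof (rule integral_cong)
      fix s assume s: "s \<in> {s0..s1}"
      have "((\<lambda>y. H2 (V (y, s)) * Vy (y, s) * Q (y, s) + H1 (V (y, s)) * Qy (y, s)) has_integral
          H1 (V (c, s)) * Q (c, s) - H1 (V (a, s)) * Q (a, s)) {a..c}"
        using dH1[OF Vy[OF _ s]] Qy[OF _ s] ord
        by (intro fundamental_theorem_of_calculus)
          (auto simp: has_real_derivative_iff_has_vector_derivative[symmetric] intro!: derivative_eq_intros)
      moreover have "H1 (V (c, s)) = 0" "H1 (V (a, s)) = 0" using lateral[OF s] by (auto simp: H1_def)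
      ultimately show "integral {a..c} (\<lambda>y. H2 (V (y, s)) * Vy (y, s) * Q (y, s) + H1 (V (y, s)) * Qy (y, s)) = 0"
        by (simp add: integral_unique)
    qed
    finally show ?thesis by simp
  qed
  have c3: "continuous_on ?R (\<lambda>z. 2 * B * E z + B\<^sup>2 * \<eta>)" by (intro continuous_intros cont)
  have "integral ?R (\<lambda>z. H1 (V z) * Vs z)
      \<le> integral ?R (\<lambda>z. (H2 (V z) * Vy z * Q z + H1 (V z) * Qy z) + (2 * B * E z + B\<^sup>2 * \<eta>))"
  proof (rule integral_le)
    fix z assume "z \<in> ?R"
    then obtain y s where z: "z = (y, s)" and ys: "y \<in> {a..c}" "s \<in> {s0..s1}"
      by (cases z) (auto simp: cbox_Pair_eq)
    \<comment> \<open>The differential inequality is available only where V exceeds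
      \<open>m\<close>; elsewhere both weights \<open>H1\<close> and \<open>H2\<close>
      vanish.\<close>
    show "H1 (V z) * Vs z \<le> H2 (V z) * Vy z * Q z + H1 (V z) * Qy z + (2 * B * E z + B\<^sup>2 * \<eta>)"
    proof (cases "m < V (y, s)")
      case True
      have le: "V (y, s) - m \<le> B" using bound[OF ys] by simp
      have H1: "0 \<le> H1 (V z)" "H1 (V z) \<le> B\<^sup>2" using True le by (auto simp: H1_def z max_def intro!: power_mono)
      have H2: "0 \<le> H2 (V z)" "H2 (V z) \<le> 2 * B" using True le by (auto simp: H2_def z max_def)
      have "H1 (V z) * Vs z \<le> H1 (V z) * (Qy z + \<eta>)"
        using ineq[OF ys True] H1 by (intro mult_left_mono) (auto simp: z)
      moreover have "H1 (V z) * \<eta> \<le> B\<^sup>2 * \<eta>" using H1 nonneg(2) by (intro mult_right_mono) auto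
      moreover have "H2 (V z) * (- E z) \<le> H2 (V z) * (Vy z * Q z)"
        using flux[OF ys] H2 by (intro mult_left_mono) (auto simp: z)
      moreover have "H2 (V z) * E z \<le> 2 * B * E z" using H2 nonneg(1)[OF ys] by (intro mult_right_mono) (auto simp: z)
      ultimately show ?thesis by (simp add: algebra_simps)
    next
      case False
      then have "H1 (V z) = 0" "H2 (V z) = 0" by (auto simp: H1_def H2_def z)
      then show ?thesis using nonneg(1)[OF ys] nonneg(2,3) by (simp add: z)
    qed
  qed (intro integrable_continuous c1 c2 continuous_intros c3 cont)+
  also have "\<dots> = integral ?R (\<lambda>z. H2 (V z) * Vy z * Q z + H1 (V z) * Qy z) + (integral ?R (\<lambda>z. 2 * B * E z) + integral ?R (\<lambda>z. B\<^sup>2 * \<eta>))"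
    using Henstock_Kurzweil_Integration.integral_add[OF integrable_continuous[OF c2] integrable_continuous[OF c3]]
      Henstock_Kurzweil_Integration.integral_add[of "\<lambda>z. 2 * B * E z" ?R "\<lambda>z. B\<^sup>2 * \<eta>"]
      integrable_continuous[OF continuous_on_mult_left[OF cont(6), of "2 * B"]]  integrable_continuous[OF continuous_on_const[of ?R "B\<^sup>2 * \<eta>"]] by simp
  also have "integral ?R (\<lambda>z. 2 * B * E z) = 2 * B * integral ?R E" by simp
  also have "integral ?R (\<lambda>z. B\<^sup>2 * \<eta>) = B\<^sup>2 * \<eta> * ((c - a) * (s1 - s0))" using ord by (simp add: content_Pair)
  finally show ?thesis unfolding I1 I2 H_def by simp
qed

text \<open>Truncating \<open>g\<close> at a high level costs little by dominated convergence. The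
  bounded truncation is an almost everywhere limit of continuous functions, and on a box bounded
  convergence turns this into convergence in L^p. The constant \<open>e'\<close> makes the two
  errors together at most \<open>e\<close> after \<open>powr_sum3_le\<close>.\<close>

lemma Lp_approx_continuous:
  fixes g :: "'a::euclidean_space \<Rightarrow> real"
  assumes p: "0 < p" and [measurable]: "g \<in> borel_measurable borel" and g: "integrable lborel (\<lambda>z. \<bar>g z\<bar> powr p)"
    and e: "0 < e"
  shows "\<exists>h. continuous_on UNIV h \<and> integrable lborel (\<lambda>z. indicator (cbox a b) z * \<bar>g z - h z\<bar> powr p)
     \<and> (\<integral>z. indicator (cbox a b) z * \<bar>g z - h z\<bar> powr p \<partial>lborel) < e"
proof -
  define R where "R = cbox a b"
  have [measurable]: "R \<in> sets borel" by (simp add: R_def)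
  have finR: "integrable lborel (\<lambda>z. indicator R z * k :: real)" for k
    unfolding R_def using emeasure_lborel_cbox_finite[of a b]
    by (auto intro!: integrable_mult_left integrable_real_indicator simp: less_top[symmetric])
  define cl where "cl n x = max (- n) (min n x)" for n x :: real
  define G where "G n z = cl (real n) (g z)" for n z
  have clb: "\<bar>cl n x\<bar> \<le> n" if "0 \<le> n" for n x using that by (auto simp: cl_def)
  have [measurable]: "G n \<in> borel_measurable borel" for n unfolding G_def cl_def by measurable
  define e' where "e' = e / (2 * 3 powr p)"
  have e': "0 < e'" using e by (simp add: e'_def)
  have "(\<lambda>n. \<integral>z. indicator R z * \<bar>g z - G n z\<bar> powr p \<partial>lborel) \<longlonglongrightarrow> (\<integral>z. 0 \<partial>(lborel::'a measure))"
  proof (rule integral_dominated_convergence[where w = "\<lambda>z. \<bar>g z\<bar> powr p"])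
    show "AE z in lborel. norm (indicator R z * \<bar>g z - G n z\<bar> powr p) \<le> \<bar>g z\<bar> powr p" for n
      using p by (intro AE_I2) (auto simp: indicator_def G_def cl_def intro!: powr_mono2)
    show "AE z in lborel. (\<lambda>n. indicator R z * \<bar>g z - G n z\<bar> powr p) \<longlonglongrightarrow> 0"
    proof (intro AE_I2 tendsto_eventually)
      fix z
      obtain N where "\<bar>g z\<bar> \<le> real N" using real_arch_simple by blast
      then show "\<forall>\<^sub>F n in sequentially. indicator R z * \<bar>g z - G n z\<bar> powr p = 0"
        using p by (intro eventually_sequentiallyI[of N]) (auto simp: G_def cl_def max_def min_def)
    qed
  qed (use g in auto)
  then have "\<forall>\<^sub>F n in sequentially. (\<integral>z. indicator R z * \<bar>g z - G n z\<bar> powr p \<partial>lborel) < e'"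
    using e' by (intro order_tendstoD) auto
  then obtain N where N: "(\<integral>z. indicator R z * \<bar>g z - G N z\<bar> powr p \<partial>lborel) < e'"
    by (auto simp: eventually_sequentially)
  have iN: "integrable lborel (\<lambda>z. indicator R z * \<bar>g z - G N z\<bar> powr p)"
    by (rule Bochner_Integration.integrable_bound[OF g])
      (use p in \<open>auto simp: indicator_def G_def cl_def intro!: powr_mono2\<close>)
  \<comment> \<open>Gauge measurability supplies continuous functions that converge to
    \<open>G N\<close> off a negligible set.\<close>
  have "G N measurable_on R"
    by (subst measurable_on_iff_borel_measurable)
      (auto simp: R_def intro!: measurable_restrict_space1 measurable_completion)
  then obtain Z k where Z: "negligible Z" and k: "\<And>n. continuous_on UNIV (k n)"
      and lim: "\<And>x. x \<notin> Z \<Longrightarrow> (\<lambda>n. k n x) \<longlonglongrightarrow> (if x \<in> R then G N x else 0)"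
    unfolding measurable_on_def by blast
  \<comment> \<open>Clamping keeps the approximants continuous and provides the dominating constant
    \<open>(2 * real N) powr p\<close>; the limit is unchanged since \<open>G N\<close> already
    takes values in [-N, N].\<close>
  define h where "h n z = cl (real N) (k n z)" for n z
  have ch: "continuous_on UNIV (h n)" for n unfolding h_def cl_def by (intro continuous_intros k)
  have [measurable]: "h n \<in> borel_measurable borel" for n using ch by (rule borel_measurable_continuous_onI)
  have dom: "norm (indicator R z * \<bar>G N z - h n z\<bar> powr p) \<le> indicator R z * (2 * real N) powr p" for z n
  proof -
    have "\<bar>G N z - h n z\<bar> \<le> 2 * real N" using clb[of "real N" "g z"] clb[of "real N" "k n z"]
      unfolding G_def h_def by linarith
    then have "\<bar>G N z - h n z\<bar> powr p \<le> (2 * real N) powr p" using p by (intro powr_mono2) auto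
    then show ?thesis by (auto simp: indicator_def)
  qed
  have "(\<lambda>n. \<integral>z. indicator R z * \<bar>G N z - h n z\<bar> powr p \<partial>lborel) \<longlonglongrightarrow> (\<integral>z. 0 \<partial>(lborel::'a measure))"
  proof (rule integral_dominated_convergence[where w = "\<lambda>z. indicator R z * (2 * real N) powr p"])
    show "AE z in lborel. norm (indicator R z * \<bar>G N z - h n z\<bar> powr p) \<le> indicator R z * (2 * real N) powr p" for n
      by (intro AE_I2 dom)
    have "AE z in lebesgue. z \<notin> Z" using Z by (simp add: negligible_iff_null_sets AE_not_in)
    then have "AE z in lborel. z \<notin> Z" by (simp add: AE_completion_iff)
    then show "AE z in lborel. (\<lambda>n. indicator R z * \<bar>G N z - h n z\<bar> powr p) \<longlonglongrightarrow> 0"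
    proof eventually_elim
      case (elim z)
      show ?case
      proof (cases "z \<in> R")
        case True
        have "(\<lambda>n. h n z) \<longlonglongrightarrow> cl (real N) (G N z)"
          unfolding h_def cl_def using lim[OF elim] True by (intro tendsto_intros) auto
        also have "cl (real N) (G N z) = G N z" by (auto simp: G_def cl_def)
        finally have "(\<lambda>n. \<bar>G N z - h n z\<bar>) \<longlonglongrightarrow> \<bar>G N z - G N z\<bar>" by (intro tendsto_intros)
        then have "(\<lambda>n. \<bar>G N z - h n z\<bar> powr p) \<longlonglongrightarrow> 0 powr p"
          using p by (intro tendsto_powr2) auto
        then show ?thesis using True by simp
      qed simp
    qed
  qed (use finR in auto)
  then have "\<forall>\<^sub>F n in sequentially. (\<integral>z. indicator R z * \<bar>G N z - h n z\<bar> powr p \<partial>lborel) < e'"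
    using e' by (intro order_tendstoD) auto
  then obtain n where n: "(\<integral>z. indicator R z * \<bar>G N z - h n z\<bar> powr p \<partial>lborel) < e'"
    by (auto simp: eventually_sequentially)
  have i_n: "integrable lborel (\<lambda>z. indicator R z * \<bar>G N z - h n z\<bar> powr p)"
    by (rule Bochner_Integration.integrable_bound[OF finR[of "(2 * real N) powr p"]])
      (use dom in \<open>auto simp: abs_mult\<close>)
  have le: "indicator R z * \<bar>g z - h n z\<bar> powr p
      \<le> 3 powr p * (indicator R z * \<bar>g z - G N z\<bar> powr p + indicator R z * \<bar>G N z - h n z\<bar> powr p)" for z
  proof -
    have "\<bar>g z - h n z\<bar> powr p \<le> (\<bar>g z - G N z\<bar> + 0 + \<bar>G N z - h n z\<bar>) powr p" using p by (intro powr_mono2) auto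
    also have "\<dots> \<le> 3 powr p * (\<bar>g z - G N z\<bar> powr p + 0 powr p + \<bar>G N z - h n z\<bar> powr p)"
      using p by (intro powr_sum3_le) auto
    finally show ?thesis by (auto simp: indicator_def)
  qed
  have int: "integrable lborel (\<lambda>z. indicator R z * \<bar>g z - h n z\<bar> powr p)"
    by (rule Bochner_Integration.integrable_bound[OF integrable_mult_right[OF Bochner_Integration.integrable_add[OF iN i_n], of "3 powr p"]])
      (use le in \<open>auto simp: abs_mult\<close>)
  have "(\<integral>z. indicator R z * \<bar>g z - h n z\<bar> powr p \<partial>lborel)
     \<le> (\<integral>z. 3 powr p * (indicator R z * \<bar>g z - G N z\<bar> powr p + indicator R z * \<bar>G N z - h n z\<bar> powr p) \<partial>lborel)"
    by (intro integral_mono int le integrable_mult_right Bochner_Integration.integrable_add iN i_n)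
  also have "\<dots> = 3 powr p * ((\<integral>z. indicator R z * \<bar>g z - G N z\<bar> powr p \<partial>lborel) + (\<integral>z. indicator R z * \<bar>G N z - h n z\<bar> powr p \<partial>lborel))"
    using iN i_n by simp
  also have "\<dots> < 3 powr p * (e' + e')" using N n by (intro mult_strict_left_mono) auto
  also have "\<dots> = e" by (simp add: e'_def)
  finally show ?thesis using ch int unfolding R_def by blast
qed

section \<open>Comparison principle\<close>

lemma plap_flux_continuous [continuous_intros]:
  assumes p: "1 < p" "p < 2" and f: "continuous_on S f"
  shows "continuous_on S (\<lambda>x. plap_flux p (f x))"
proof -
  have "isCont (plap_flux p) a" for a
    unfolding isCont_def
  proof (rule LIM_zero_cancel, rule Lim_null_comparison)
    show "\<forall>\<^sub>F x in at a. norm (plap_flux p x - plap_flux p a) \<le> 2 * \<bar>x - a\<bar> powr (p - 1)"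
      using plap_flux_holder[OF p] by simp
    have "((\<lambda>x. 2 * \<bar>x - a\<bar> powr (p - 1)) \<longlongrightarrow> 2 * \<bar>a - a\<bar> powr (p - 1)) (at a)"
      using p by (intro tendsto_intros) auto
    then show "((\<lambda>x. 2 * \<bar>x - a\<bar> powr (p - 1)) \<longlongrightarrow> 0) (at a)" by simp
  qed
  then show ?thesis
    using continuous_on_compose2[OF continuous_at_imp_continuous_on f, of UNIV] by auto
qed

text \<open>\<open>moll1\<close> and \<open>moll2\<close> are the two partial derivatives of
  \<open>moll r f\<close> with respect to the centre; the sign comes from differentiating the kernel
  at \<open>z - w\<close> in \<open>w\<close>. All derivatives fall on the kernel, so
  \<open>f\<close> may be merely integrable.\<close>

definition moll1 :: "real \<Rightarrow> (real \<times> real \<Rightarrow> real) \<Rightarrow> real \<times> real \<Rightarrow> real" where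
  "moll1 r f w = - (\<integral>z. f z * (kern' r (fst z - fst w) * kern r (snd z - snd w)) \<partial>lborel) / kmass r"

definition moll2 :: "real \<Rightarrow> (real \<times> real \<Rightarrow> real) \<Rightarrow> real \<times> real \<Rightarrow> real" where
  "moll2 r f w = - (\<integral>z. f z * (kern r (fst z - fst w) * kern' r (snd z - snd w)) \<partial>lborel) / kmass r"

lemma moll_eq: "moll r f w = (\<integral>z. f z * (kern r (fst z - fst w) * kern r (snd z - snd w)) \<partial>lborel) / kmass r"
  unfolding moll_def kk_def by (simp only: times_divide_eq_right integral_divide_zero)

lemma kern_common_bound:
  assumes "0 < r"
  shows "\<exists>K. \<forall>x. \<bar>kern r x\<bar> \<le> K \<and> \<bar>kern' r x\<bar> \<le> K"
proof -
  obtain K where "\<And>x. \<bar>kern' r x\<bar> \<le> K" using kern'_bounded[OF assms] by blast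
  with kern_bounded[of r] show ?thesis
    by (intro exI[of _ "max K ((r\<^sup>2) ^ 3)"]) (auto simp: le_max_iff_disj simp del: power_mult_numeral)
qed

lemma
  assumes f: "integrable lborel f" and r: "0 < r"
  shows moll_deriv1: "((\<lambda>y. moll r f (y, s)) has_real_derivative moll1 r f (y, s)) (at y within S)"
    and moll_deriv2: "((\<lambda>s. moll r f (y, s)) has_real_derivative moll2 r f (y, s)) (at s within S)"
    and moll_continuous: "continuous_on A (moll r f)"
    and moll1_continuous: "continuous_on A (moll1 r f)"
    and moll2_continuous: "continuous_on A (moll2 r f)"
proof -
  obtain K where K: "\<And>x. \<bar>kern r x\<bar> \<le> K" "\<And>x. \<bar>kern' r x\<bar> \<le> K" using kern_common_bound[OF r] by blast
  obtain L where L: "L \<ge> 0" "\<And>x y. \<bar>kern' r x - kern' r y\<bar> \<le> L * \<bar>x - y\<bar>" using kern'_lipschitz by metis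
  have kc: "continuous_on UNIV (kern r)" "continuous_on UNIV (kern' r)" by (intro continuous_intros)+
  have N: "kmass r \<noteq> 0" using kmass_pos[OF r] by simp
  have "((\<lambda>y. \<integral>z. f z * (kern r (fst z - y) * kern r (snd z - s)) \<partial>lborel) has_real_derivative
            - (\<integral>z. f z * (kern' r (fst z - y) * kern r (snd z - s)) \<partial>lborel)) (at y)"
    by (rule convolution_deriv[OF f _ _ K(1) kern_deriv L K]) auto
  then show "((\<lambda>y. moll r f (y, s)) has_real_derivative moll1 r f (y, s)) (at y within S)"
    unfolding moll_eq moll1_def fst_conv snd_conv by (rule has_field_derivative_at_within[OF DERIV_cdivide])
  have "((\<lambda>s. \<integral>z. f z * (kern r (snd z - s) * kern r (fst z - y)) \<partial>lborel) has_real_derivative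
            - (\<integral>z. f z * (kern' r (snd z - s) * kern r (fst z - y)) \<partial>lborel)) (at s)"
    by (rule convolution_deriv[OF f _ _ K(1) kern_deriv L K]) auto
  note d2 = this[unfolded mult.commute[of "kern r (snd _ - _)"] mult.commute[of "kern' r (snd _ - _)"]]
  show "((\<lambda>s. moll r f (y, s)) has_real_derivative moll2 r f (y, s)) (at s within S)"
    unfolding moll_eq moll2_def fst_conv snd_conv by (rule has_field_derivative_at_within[OF DERIV_cdivide[OF d2]])
  show "continuous_on A (moll r f)" "continuous_on A (moll1 r f)" "continuous_on A (moll2 r f)"
    unfolding moll_eq[abs_def] moll1_def[abs_def] moll2_def[abs_def]
    using convolution_continuous[OF f kc(1) kc(1) K(1) K(1), of A] convolution_continuous[OF f kc(2) kc(1) K(2) K(1), of A]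
      convolution_continuous[OF f kc(1) kc(2) K(1) K(2), of A] N
    by (auto intro!: continuous_intros)
qed

text \<open>\<open>v\<^sub>t = (plap_flux p v\<^sub>x)\<^sub>x - q\<close> on a rectangle, tested only against the mollification kernels;
  \<open>g\<close> plays the role of \<open>v\<^sub>x\<close>. All functions are cut off to the rectangle.\<close>

definition mollified_solution ::
  "real \<Rightarrow> real \<Rightarrow> real \<Rightarrow> real \<Rightarrow> real \<Rightarrow> (real \<times> real \<Rightarrow> real) \<Rightarrow> (real \<times> real \<Rightarrow> real) \<Rightarrow>
   (real \<times> real \<Rightarrow> real) \<Rightarrow> bool" where
  "mollified_solution p X Y t0 t1 v g q \<longleftrightarrow>
     integrable lborel v \<and> integrable lborel q \<and> integrable lborel g \<and>
     integrable lborel (\<lambda>z. plap_flux p (g z)) \<and> integrable lborel (\<lambda>z. \<bar>g z\<bar> powr p) \<and>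
     (\<forall>w r. 0 < r \<and> square r w \<subseteq> {X..Y} \<times> {t0..t1} \<longrightarrow>
        moll2 r v w = moll1 r (\<lambda>z. plap_flux p (g z)) w - moll r q w \<and> moll1 r v w = moll r g w)"

text \<open>Uniform continuity with the two coordinates measured separately, the form that fits
  \<open>square\<close>. A third of the usual distance in each coordinate keeps the sum of the
  coordinate differences below that distance.\<close>

lemma uniform_modulus:
  fixes f :: "real \<times> real \<Rightarrow> real"
  assumes "continuous_on S f" "compact S" "0 < e"
  obtains r where "0 < r"
    "\<And>z z'. z \<in> S \<Longrightarrow> z' \<in> S \<Longrightarrow> \<bar>fst z - fst z'\<bar> \<le> r \<Longrightarrow> \<bar>snd z - snd z'\<bar> \<le> r \<Longrightarrow> \<bar>f z - f z'\<bar> \<le> e"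
proof -
  obtain d where d: "0 < d" "\<And>z z'. z \<in> S \<Longrightarrow> z' \<in> S \<Longrightarrow> dist z' z < d \<Longrightarrow> dist (f z') (f z) < e"
    using compact_uniformly_continuous[OF assms(1,2)] assms(3) unfolding uniformly_continuous_on_def by metis
  have "\<bar>f z - f z'\<bar> \<le> e" if "z \<in> S" "z' \<in> S" "\<bar>fst z - fst z'\<bar> \<le> d / 3" "\<bar>snd z - snd z'\<bar> \<le> d / 3" for z z'
  proof -
    have "dist z' z = norm (z' - z)" by (simp add: dist_norm)
    also have "\<dots> \<le> norm (fst (z' - z)) + norm (snd (z' - z))"
      using norm_Pair_le[of "fst (z' - z)" "snd (z' - z)"] by (simp only: prod.collapse)
    also have "\<dots> < d" using that(3,4) d(1) by (simp add: abs_minus_commute[of "_ z'"])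
    finally show ?thesis using d(2)[OF that(1,2)] by (simp add: dist_real_def)
  qed
  then show ?thesis using d(1) that[of "d / 3"] by simp
qed

text \<open>If \<open>v\<close> exceeds \<open>W\<close> somewhere, then by continuity the mollified
  difference exceeds a positive level by a fixed amount on an interval whose length does not depend
  on the mollification. The energy inequality bounds the same quantity by \<open>C * \<eta>\<close>
  with \<open>\<eta>\<close> at disposal. Monotonicity of the absorption enters only through
  \<open>less\<close>; stating it with free functions \<open>q\<close> and \<open>d\<close> lets the
  theorem serve also for \<open>- u\<close> and subsolutions.\<close>

theorem comparison:
  fixes v q W Wx Wt Fx d :: "real \<times> real \<Rightarrow> real"
  assumes p: "1 < p" "p < 2" and ord: "X < a" "a < c" "c < Y" "0 < \<tau>" "\<tau> < T'"
    and cv: "continuous_on ({X..Y} \<times> {0..T'}) v" and cq: "continuous_on ({X..Y} \<times> {0..T'}) q"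
    and sol: "\<And>t0. 0 < t0 \<Longrightarrow> t0 < T' \<Longrightarrow>
       \<exists>g. mollified_solution p X Y t0 T' (\<lambda>z. indicator ({X..Y} \<times> {t0..T'}) z * v z) g
             (\<lambda>z. indicator ({X..Y} \<times> {t0..T'}) z * q z)"
    and cW: "continuous_on ({a..c} \<times> {0..\<tau>}) W"
    and cont: "continuous_on ({a..c} \<times> {0<..\<tau>}) Wx" "continuous_on ({a..c} \<times> {0<..\<tau>}) Wt"
      "continuous_on ({a..c} \<times> {0<..\<tau>}) Fx"
    and Wx: "\<And>y s. y \<in> {a..c} \<Longrightarrow> s \<in> {0<..\<tau>} \<Longrightarrow> ((\<lambda>y. W (y, s)) has_real_derivative Wx (y, s)) (at y within {a..c})"
    and Wt: "\<And>y s. y \<in> {a..c} \<Longrightarrow> s \<in> {0<..\<tau>} \<Longrightarrow> ((\<lambda>s. W (y, s)) has_real_derivative Wt (y, s)) (at s within {0<..\<tau>})"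
    and Fx: "\<And>y s. y \<in> {a..c} \<Longrightarrow> s \<in> {0<..\<tau>} \<Longrightarrow> ((\<lambda>y. plap_flux p (Wx (y, s))) has_real_derivative Fx (y, s)) (at y within {a..c})"
    and super: "\<And>z. z \<in> {a..c} \<times> {0<..\<tau>} \<Longrightarrow> Fx z - d z \<le> Wt z"
    and less: "\<And>z. z \<in> {a..c} \<times> {0<..\<tau>} \<Longrightarrow> W z < v z \<Longrightarrow> d z \<le> q z"
    and init: "\<And>y. y \<in> {a..c} \<Longrightarrow> v (y, 0) \<le> W (y, 0)"
    and lateral: "\<And>s. s \<in> {0..\<tau>} \<Longrightarrow> v (a, s) \<le> W (a, s) \<and> v (c, s) \<le> W (c, s)"
    and z0: "z0 \<in> {a..c} \<times> {0..\<tau>}"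
  shows "v z0 \<le> W z0"
proof (rule ccontr)
  assume neg: "\<not> v z0 \<le> W z0"
  define x1 s1 where "x1 = fst z0" and "s1 = snd z0"
  have z0_eq: "z0 = (x1, s1)" by (simp add: x1_def s1_def)
  define D where "D z = v z - W z" for z
  \<comment> \<open>The excess is spent in fifths: up to time \<open>t0\<close> the difference may
    rise to \<open>m\<close>, mollification adds at most \<open>m\<close>, so the cut is at
    \<open>2 * m\<close>. At time \<open>s1\<close> one \<open>m\<close> is lost by moving away from
    \<open>x1\<close> and one by mollification, which leaves at least \<open>3 * m\<close>.\<close>
  define m where "m = D (x1, s1) / 5"
  have m: "0 < m" using neg by (simp add: m_def D_def z0_eq)
  have x1: "x1 \<in> {a..c}" and s1': "s1 \<in> {0..\<tau>}" using z0 by (auto simp: z0_eq)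
  have s1: "0 < s1" using init[OF x1] neg s1' by (cases "s1 = 0") (auto simp: z0_eq)
  have x1a: "a < x1" "x1 < c" using lateral[OF s1'] neg x1 by (auto simp: z0_eq less_le)
  let ?K = "{a..c} \<times> {0..\<tau>}"
  have cD: "continuous_on ?K D"
    unfolding D_def using ord by (intro continuous_intros cW continuous_on_subset[OF cv]) auto
  have compK: "compact ?K" by (intro compact_Times compact_Icc)
  obtain d0 where d0: "0 < d0" "\<And>z z'. z \<in> ?K \<Longrightarrow> z' \<in> ?K \<Longrightarrow> \<bar>fst z - fst z'\<bar> \<le> d0 \<Longrightarrow> \<bar>snd z - snd z'\<bar> \<le> d0 \<Longrightarrow> \<bar>D z - D z'\<bar> \<le> m"
    by (rule uniform_modulus[OF cD compK m]) blast
  \<comment> \<open>The integral identity holds only on intervals that start at a positive time, so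
    the initial inequality is carried from 0 to \<open>t0\<close> by the modulus of continuity of
    \<open>D\<close>.\<close>
  define t0 where "t0 = min d0 (s1 / 2)"
  have t0: "0 < t0" "t0 < s1" using d0(1) s1 by (auto simp: t0_def)
  have s1\<tau>: "s1 \<le> \<tau>" using s1' by auto
  have Dt0: "D (y, t0) \<le> m" if "y \<in> {a..c}" for y
  proof -
    have "\<bar>D (y, t0) - D (y, 0)\<bar> \<le> m" using that t0 s1\<tau> by (intro d0(2)) (auto simp: t0_def)
    then show ?thesis using init[OF that] by (auto simp: D_def)
  qed
  obtain B where B: "0 \<le> B" "\<And>z. z \<in> ?K \<Longrightarrow> D z \<le> B"
  proof -
    have "bounded (D ` ?K)" by (intro compact_imp_bounded compact_continuous_image cD compK)
    then obtain B where "\<And>z. z \<in> ?K \<Longrightarrow> norm (D z) \<le> B" unfolding bounded_iff by blast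
    then show ?thesis by (intro that[of "max 0 B"]) (auto simp: le_max_iff_disj abs_le_iff)
  qed
  define \<rho> where "\<rho> = min d0 (c - x1)"
  have \<rho>: "0 < \<rho>" "x1 + \<rho> \<le> c" using d0(1) x1a by (auto simp: \<rho>_def)
  define Ar where "Ar = (c - a) * (s1 - t0)"
  have Ar: "0 \<le> Ar" using ord t0 by (auto simp: Ar_def)
  define C where "C = 2 * B * (3 powr p * (2 + Ar)) + B\<^sup>2 * Ar"
  have C: "0 \<le> C" using B Ar by (auto simp: C_def intro!: add_nonneg_nonneg mult_nonneg_nonneg)
  \<comment> \<open>\<open>C * \<eta>\<close> is the bound from the energy inequality and
    \<open>\<rho> * (m ^ 3 / 3)\<close> the lower bound to be contradicted; this choice makes the
    former at most half of the latter.\<close>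
  define \<eta> where "\<eta> = min m (\<rho> * (m ^ 3 / 3) / (2 * (C + 1)))"
  have \<eta>: "0 < \<eta>" "\<eta> \<le> m" using m \<rho> C by (auto simp: \<eta>_def)
  \<comment> \<open>The rectangle begins before \<open>t0\<close> and is wider than [a, c], which
    leaves room for squares centred anywhere in the comparison region.\<close>
  let ?R = "{X..Y} \<times> {t0/2..T'}"
  have R_cbox: "?R = cbox (X, t0/2) (Y, T')" by (auto simp: cbox_Pair_eq)
  define vv where "vv z = indicator ?R z * v z" for z
  define qq where "qq z = indicator ?R z * q z" for z
  obtain g where g: "mollified_solution p X Y (t0/2) T' vv g qq"
    using sol[of "t0/2"] t0 s1\<tau> ord unfolding vv_def qq_def by force
  have gi: "integrable lborel vv" "integrable lborel qq" "integrable lborel g"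
      "integrable lborel (\<lambda>z. plap_flux p (g z))" "integrable lborel (\<lambda>z. \<bar>g z\<bar> powr p)"
    using g by (auto simp: mollified_solution_def)
  have [measurable]: "g \<in> borel_measurable borel" using gi(3) by auto
  \<comment> \<open>The gradient has no modulus of continuity; \<open>h\<close> has one. It is fixed
    before the radius, which can then be chosen so small that \<open>h\<close> oscillates by at most
    \<open>\<omega>\<close> on each square, where \<open>\<omega> powr p = \<eta>\<close>.\<close>
  obtain h where h: "continuous_on UNIV h" "integrable lborel (\<lambda>z. indicator ?R z * \<bar>g z - h z\<bar> powr p)"
     "(\<integral>z. indicator ?R z * \<bar>g z - h z\<bar> powr p \<partial>lborel) < \<eta>"
    using Lp_approx_continuous[of p g \<eta> "(X, t0/2)" "(Y, T')"] p gi(5) \<eta>(1) unfolding R_cbox by auto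
  define d1 where "d1 z = indicator ?R z * \<bar>g z - h z\<bar> powr p" for z
  have d1i: "integrable lborel d1" and d1s: "(\<integral>z. d1 z \<partial>lborel) < \<eta>" and d10: "\<And>z. 0 \<le> d1 z"
    using h unfolding d1_def[abs_def] by auto
  define \<omega> where "\<omega> = \<eta> powr (1 / p)"
  have \<omega>: "0 < \<omega>" "\<omega> powr p = \<eta>" using \<eta> p by (auto simp: \<omega>_def powr_powr)
  have compR: "compact ?R" by (intro compact_Times compact_Icc)
  have subR: "?R \<subseteq> {X..Y} \<times> {0..T'}" using t0 by auto
  obtain r1 where r1: "0 < r1" "\<And>z z'. z \<in> ?R \<Longrightarrow> z' \<in> ?R \<Longrightarrow> \<bar>fst z - fst z'\<bar> \<le> r1 \<Longrightarrow> \<bar>snd z - snd z'\<bar> \<le> r1 \<Longrightarrow> \<bar>v z - v z'\<bar> \<le> \<eta>"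
    by (rule uniform_modulus[OF continuous_on_subset[OF cv subR] compR \<eta>(1)]) blast
  obtain r2 where r2: "0 < r2" "\<And>z z'. z \<in> ?R \<Longrightarrow> z' \<in> ?R \<Longrightarrow> \<bar>fst z - fst z'\<bar> \<le> r2 \<Longrightarrow> \<bar>snd z - snd z'\<bar> \<le> r2 \<Longrightarrow> \<bar>q z - q z'\<bar> \<le> \<eta>"
    by (rule uniform_modulus[OF continuous_on_subset[OF cq subR] compR \<eta>(1)]) blast
  obtain r3 where r3: "0 < r3" "\<And>z z'. z \<in> ?R \<Longrightarrow> z' \<in> ?R \<Longrightarrow> \<bar>fst z - fst z'\<bar> \<le> r3 \<Longrightarrow> \<bar>snd z - snd z'\<bar> \<le> r3 \<Longrightarrow> \<bar>h z - h z'\<bar> \<le> \<omega>"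
    by (rule uniform_modulus[OF continuous_on_subset[OF h(1) subset_UNIV] compR \<omega>(1)]) blast
  \<comment> \<open>\<open>v\<close> and \<open>q\<close> are compared with their values at the
    centre, \<open>h\<close> at two arbitrary points of a square, which may be \<open>2 * r\<close>
    apart; hence \<open>r3 / 2\<close>. The last four entries keep the squares inside
    \<open>?R\<close>.\<close>
  define r where "r = Min {r1, r2, r3 / 2, a - X, Y - c, t0 / 2, T' - \<tau>}"
  have rle: "r \<le> x" if "x \<in> {r1, r2, r3 / 2, a - X, Y - c, t0 / 2, T' - \<tau>}" for x
    unfolding r_def using that by (intro Min_le) auto
  have "0 < r" unfolding r_def
    by (subst Min_gr_iff) (use r1(1) r2(1) r3(1) ord t0(1) in auto)
  then have r: "0 < r" "r \<le> r1" "r \<le> r2" "r \<le> r3 / 2" "r \<le> a - X" "r \<le> Y - c" "r \<le> t0 / 2" "r \<le> T' - \<tau>"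
    by - (assumption, (rule rle, simp)+)
  let ?Q = "cbox (a, t0) (c, s1)"
  have Q_eq: "?Q = {a..c} \<times> {t0..s1}" by (auto simp: cbox_Pair_eq)
  have QS: "?Q \<subseteq> {a..c} \<times> {0<..\<tau>}" using t0 s1\<tau> by (auto simp: Q_eq)
  have sq: "square r w \<subseteq> ?R" "w \<in> ?R" if "w \<in> ?Q" for w
    using that r ord t0 s1\<tau> by (auto simp: Q_eq square_def abs_le_iff)
  have near: "\<bar>fst z - fst w\<bar> \<le> r" "\<bar>snd z - snd w\<bar> \<le> r" if "z \<in> square r w" for z w
    using that by (auto simp: square_def)
  have U: "\<bar>moll r vv w - v w\<bar> \<le> \<eta>" if w: "w \<in> ?Q" for w
  proof (rule moll_close[OF r(1) mollifiable_integrable[OF gi(1) r(1)]])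
    fix z assume z: "z \<in> square r w"
    then have "z \<in> ?R" using sq(1)[OF w] by blast
    then have "\<bar>v z - v w\<bar> \<le> \<eta>" using near[OF z] r sq(2)[OF w] by (intro r1(2)) auto
    then show "\<bar>vv z - v w\<bar> \<le> \<eta>" using \<open>z \<in> ?R\<close> by (simp add: vv_def)
  qed
  have Mq: "\<bar>moll r qq w - q w\<bar> \<le> \<eta>" if w: "w \<in> ?Q" for w
  proof (rule moll_close[OF r(1) mollifiable_integrable[OF gi(2) r(1)]])
    fix z assume z: "z \<in> square r w"
    then have "z \<in> ?R" using sq(1)[OF w] by blast
    then have "\<bar>q z - q w\<bar> \<le> \<eta>" using near[OF z] r sq(2)[OF w] by (intro r2(2)) auto
    then show "\<bar>qq z - q w\<bar> \<le> \<eta>" using \<open>z \<in> ?R\<close> by (simp add: qq_def)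
  qed
  have eqs: "moll2 r vv w = moll1 r (\<lambda>z. plap_flux p (g z)) w - moll r qq w" "moll1 r vv w = moll r g w"
    if "w \<in> ?Q" for w
    using g sq(1)[OF that] r(1) unfolding mollified_solution_def by blast+
  define V where "V z = moll r vv z - W z" for z
  define Vs where "Vs z = moll2 r vv z - Wt z" for z
  define Vy where "Vy z = moll1 r vv z - Wx z" for z
  define Q where "Q z = moll r (\<lambda>z. plap_flux p (g z)) z - plap_flux p (Wx z)" for z
  define Qy where "Qy z = moll1 r (\<lambda>z. plap_flux p (g z)) z - Fx z" for z
  define E where "E z = 3 powr p * (2 * moll r d1 z + \<eta>)" for z
  have VD: "\<bar>V w - D w\<bar> \<le> \<eta>" if "w \<in> ?Q" for w using U[OF that] by (simp add: V_def D_def)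
  have QK: "w \<in> ?K" if "w \<in> ?Q" for w using that t0 s1\<tau> by (auto simp: Q_eq)
  note mc = moll_continuous moll1_continuous moll2_continuous
  have main: "integral {a..c} (\<lambda>y. max 0 (V (y, s1) - 2 * m) ^ 3 / 3)
      \<le> 2 * B * integral ?Q E + B\<^sup>2 * \<eta> * ((c - a) * (s1 - t0))"
  proof (rule energy_inequality)
    show "a \<le> c" "t0 \<le> s1" using ord t0 by auto
    show "continuous_on ?Q V" unfolding V_def
      by (intro continuous_intros mc gi r continuous_on_subset[OF cW]) (use QK in blast)
    show "continuous_on ?Q Vs" "continuous_on ?Q Vy" "continuous_on ?Q Q" "continuous_on ?Q Qy" "continuous_on ?Q E"
      unfolding Vs_def Vy_def Q_def Qy_def E_def
      by (intro continuous_intros mc gi r d1i p cont[THEN continuous_on_subset] QS)+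
    fix y s assume y: "y \<in> {a..c}" and s: "s \<in> {t0..s1}"
    then have ys: "(y, s) \<in> ?Q" and s': "s \<in> {0<..\<tau>}" using t0 s1\<tau> by (auto simp: Q_eq)
    show "((\<lambda>s. V (y, s)) has_real_derivative Vs (y, s)) (at s within {t0..s1})"
      unfolding V_def Vs_def
      by (intro DERIV_diff moll_deriv2 gi r DERIV_subset[OF Wt[OF y s']]) (use t0 s1\<tau> in auto)
    show "((\<lambda>y. V (y, s)) has_real_derivative Vy (y, s)) (at y within {a..c})"
      unfolding V_def Vy_def by (intro DERIV_diff moll_deriv1 gi r Wx y s')
    show "((\<lambda>y. Q (y, s)) has_real_derivative Qy (y, s)) (at y within {a..c})"
      unfolding Q_def Qy_def by (intro DERIV_diff moll_deriv1 gi r Fx y s')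
    show "V (y, s) \<le> 2 * m + B" using VD[OF ys] B(2)[OF QK[OF ys]] \<eta> m by linarith
    show "0 \<le> E (y, s)" using \<eta> d10 by (auto simp: E_def intro!: mult_nonneg_nonneg add_nonneg_nonneg moll_nonneg)
    \<comment> \<open>The mollified difference being above \<open>2 * m\<close> forces W < v at the
      point itself, since the error is at most \<open>m\<close>; so \<open>less\<close> applies
      there, and replacing the averaged \<open>q\<close> by its value costs
      \<open>\<eta>\<close>.\<close>
    show "Vs (y, s) \<le> Qy (y, s) + \<eta>" if "2 * m < V (y, s)"
    proof -
      have "W (y, s) < v (y, s)" using that VD[OF ys] \<eta> m by (simp add: D_def abs_le_iff)
      then have "d (y, s) \<le> q (y, s)" using y s' by (intro less) auto
      moreover have "Fx (y, s) - d (y, s) \<le> Wt (y, s)" using y s' by (intro super) auto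
      ultimately show ?thesis
        using Mq[OF ys] eqs(1)[OF ys] unfolding Vs_def Qy_def by (simp add: abs_le_iff)
    qed
    show "- E (y, s) \<le> Vy (y, s) * Q (y, s)"
    proof -
      have eqd: "(\<lambda>z. \<bar>g z - h z\<bar> powr p * kk r (y, s) z) = (\<lambda>z. d1 z * kk r (y, s) z)"
      proof
        fix z show "\<bar>g z - h z\<bar> powr p * kk r (y, s) z = d1 z * kk r (y, s) z"
          using sq(1)[OF ys] kk_outside[OF r(1), of z "(y, s)"] by (cases "z \<in> square r (y, s)") (auto simp: d1_def)
      qed
      have md: "mollifiable r (\<lambda>z. \<bar>g z - h z\<bar> powr p) (y, s)"
        using mollifiable_integrable[OF d1i r(1), of "(y, s)"] unfolding mollifiable_def eqd .
      have mde: "moll r (\<lambda>z. \<bar>g z - h z\<bar> powr p) (y, s) = moll r d1 (y, s)"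
        unfolding moll_def eqd ..
      have "- (3 powr p) * (2 * moll r (\<lambda>z. \<bar>g z - h z\<bar> powr p) (y, s) + \<omega> powr p) \<le>
        (moll r g (y, s) - Wx (y, s)) * (moll r (\<lambda>z. plap_flux p (g z)) (y, s) - plap_flux p (Wx (y, s)))"
      proof (rule moll_flux_product_ge[OF p r(1)])
        fix z z' assume z: "z \<in> square r (y, s)" "z' \<in> square r (y, s)"
        then have "z \<in> ?R" "z' \<in> ?R" using sq(1)[OF ys] by auto
        then show "\<bar>h z - h z'\<bar> \<le> \<omega>"
          using near[OF z(1)] near[OF z(2)] r(4) by (intro r3(2)) auto
      qed (intro mollifiable_integrable gi r md)+
      then show ?thesis unfolding Vy_def Q_def E_def eqs(2)[OF ys] mde \<omega>(2) by simp
    qed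
  next
    fix s assume s: "s \<in> {t0..s1}"
    have "(a, s) \<in> ?Q" "(c, s) \<in> ?Q" "s \<in> {0..\<tau>}" using s t0 s1\<tau> ord by (auto simp: Q_eq)
    then show "V (a, s) \<le> 2 * m \<and> V (c, s) \<le> 2 * m"
      using VD[of "(a, s)"] VD[of "(c, s)"] lateral[of s] \<eta> m by (auto simp: D_def abs_le_iff)
  next
    fix y assume y: "y \<in> {a..c}"
    then have "(y, t0) \<in> ?Q" using t0 by (auto simp: Q_eq)
    then show "V (y, t0) \<le> 2 * m" using VD[of "(y, t0)"] Dt0[OF y] \<eta> by (auto simp: abs_le_iff)
  qed (use \<eta> B in auto)
  have cm: "continuous_on ?Q (moll r d1)" by (intro mc d1i r)
  have intE: "integral ?Q E \<le> 3 powr p * (2 + Ar) * \<eta>"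
  proof -
    have si: "set_integrable lborel ?Q (moll r d1)"
      unfolding set_integrable_def using moll_integral_le(1)[OF d1i d10 r(1), of ?Q] by (intro integrable_mult_indicator) auto
    have "integral ?Q (moll r d1) = (\<integral>w. indicator ?Q w *\<^sub>R moll r d1 w \<partial>lborel)"
      using set_borel_integral_eq_integral(2)[OF si] by (simp add: set_lebesgue_integral_def)
    also have "\<dots> \<le> \<eta>" using moll_integral_le(2)[OF d1i d10 r(1), of ?Q] d1s by simp
    finally have 1: "integral ?Q (moll r d1) \<le> \<eta>" .
    have "integral ?Q E = integral ?Q (\<lambda>z. (3 powr p * 2) * moll r d1 z + 3 powr p * \<eta>)"
      by (rule integral_cong) (simp add: E_def algebra_simps)
    also have "\<dots> = integral ?Q (\<lambda>z. (3 powr p * 2) * moll r d1 z) + integral ?Q (\<lambda>z. 3 powr p * \<eta>)"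
      by (intro Henstock_Kurzweil_Integration.integral_add integrable_continuous continuous_intros cm)
    also have "\<dots> = 3 powr p * (2 * integral ?Q (moll r d1) + \<eta> * Ar)"
      using ord t0 by (simp add: content_Pair Ar_def algebra_simps)
    also have "\<dots> \<le> 3 powr p * (2 * \<eta> + \<eta> * Ar)" using 1 by (intro mult_left_mono) auto
    finally show ?thesis by (simp add: algebra_simps)
  qed
  \<comment> \<open>On the interval of length \<open>\<rho>\<close> to the right of
    \<open>x1\<close> the truncated difference is at least \<open>m\<close>.\<close>
  have low: "\<rho> * (m ^ 3 / 3) \<le> integral {a..c} (\<lambda>y. max 0 (V (y, s1) - 2 * m) ^ 3 / 3)"
  proof -
    have cV: "continuous_on {a..c} (\<lambda>y. max 0 (V (y, s1) - 2 * m) ^ 3 / 3)"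
    proof -
      have "continuous_on ?Q V" unfolding V_def
        by (intro continuous_intros mc gi r continuous_on_subset[OF cW]) (use QK in blast)
      from continuous_on_slice1[OF this, of s1] show ?thesis using t0 by (intro continuous_intros) auto
    qed
    have "\<rho> * (m ^ 3 / 3) = integral {x1..x1 + \<rho>} (\<lambda>y. m ^ 3 / 3)" using \<rho> by simp
    also have "\<dots> \<le> integral {x1..x1 + \<rho>} (\<lambda>y. max 0 (V (y, s1) - 2 * m) ^ 3 / 3)"
    proof (rule integral_le)
      show "(\<lambda>y. max 0 (V (y, s1) - 2 * m) ^ 3 / 3) integrable_on {x1..x1 + \<rho>}"
        by (rule integrable_continuous_interval, rule continuous_on_subset[OF cV]) (use \<rho> x1 in auto)
      fix y assume y: "y \<in> {x1..x1 + \<rho>}"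
      then have ys: "(y, s1) \<in> ?Q" using \<rho> x1 t0 by (auto simp: Q_eq)
      have "\<bar>D (y, s1) - D (x1, s1)\<bar> \<le> m"
        using y x1 s1' \<rho> by (intro d0(2)) (auto simp: \<rho>_def)
      moreover have "D (x1, s1) = 5 * m" by (simp add: m_def)
      ultimately have "3 * m \<le> V (y, s1)" using VD[OF ys] \<eta> by linarith
      then have "m ^ 3 \<le> max 0 (V (y, s1) - 2 * m) ^ 3" using m by (intro power_mono) auto
      then show "m ^ 3 / 3 \<le> max 0 (V (y, s1) - 2 * m) ^ 3 / 3" by simp
    qed auto
    also have "\<dots> \<le> integral {a..c} (\<lambda>y. max 0 (V (y, s1) - 2 * m) ^ 3 / 3)"
      using \<rho> x1 by (intro integral_subset_le integrable_continuous_interval cV continuous_on_subset[OF cV]) auto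
    finally show ?thesis .
  qed
  have "\<rho> * (m ^ 3 / 3) \<le> 2 * B * (3 powr p * (2 + Ar) * \<eta>) + B\<^sup>2 * \<eta> * Ar"
    using low main mult_left_mono[OF intE, of "2 * B"] B(1) unfolding Ar_def by linarith
  also have "\<dots> = C * \<eta>" by (simp add: C_def algebra_simps)
  also have "\<dots> \<le> (C + 1) * (\<rho> * (m ^ 3 / 3) / (2 * (C + 1)))"
    using C \<eta> by (intro mult_mono) (auto simp: \<eta>_def)
  also have "\<dots> = \<rho> * (m ^ 3 / 3) / 2" using C by (simp add: field_simps)
  finally show False using \<rho> m by (simp add: mult_le_0_iff)
qed

section \<open>Weak solutions satisfy the mollified equation\<close>

lemma moll_uminus: "moll r (\<lambda>z. - f z) w = - moll r f w" "moll1 r (\<lambda>z. - f z) w = - moll1 r f w"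
    "moll2 r (\<lambda>z. - f z) w = - moll2 r f w"
  by (simp_all add: moll_eq moll1_def moll2_def)

lemma mollified_solution_uminus:
  assumes "mollified_solution p X Y t0 t1 v g q"
  shows "mollified_solution p X Y t0 t1 (\<lambda>z. - v z) (\<lambda>z. - g z) (\<lambda>z. - q z)"
  using assms unfolding mollified_solution_def moll_uminus plap_flux_minus by simp

lemma lborel_imp_lebesgue_integral:
  fixes f :: "'a::euclidean_space \<Rightarrow> real"
  shows "f \<in> borel_measurable borel \<Longrightarrow> (\<integral>z. f z \<partial>lebesgue) = (\<integral>z. f z \<partial>lborel)"
  by (rule integral_completion) simp

lemma closed_time_dom: "closed (time_dom T)"
proof -
  have "closed {t. ereal t \<le> T}"
    by (intro closed_Collect_le continuous_intros)
  then have "closed ({0..} \<inter> {t. ereal t \<le> T})" by (intro closed_Int) auto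
  moreover have "time_dom T = {0..} \<inter> {t. ereal t \<le> T}" by (auto simp: time_dom_def)
  ultimately show ?thesis by simp
qed

lemma time_domI: "0 \<le> t \<Longrightarrow> t \<le> t1 \<Longrightarrow> ereal t1 \<le> T \<Longrightarrow> t \<in> time_dom T"
  unfolding time_dom_def using order_trans[of "ereal t" "ereal t1" T] by auto

text \<open>Replaces the weak gradient, which is only Lebesgue measurable, by a Borel representative
  cut off to the rectangle, so that Fubini and Tonelli can be used with Borel measures. Since the
  rectangle is bounded, integrability of the p-th power gives that of the gradient and of its
  flux.\<close>

lemma weak_solution_gradient:
  fixes ux :: "real \<Rightarrow> real \<Rightarrow> real" and X Y t0 t1 :: real
  defines "R \<equiv> {X..Y} \<times> {t0..t1}"
  assumes p: "1 < p" and ux: "Lp_loc_W1p_loc p \<beta> T u ux" and t: "0 < t0" "t0 < t1" "ereal t1 \<le> T"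
  obtains g where "g \<in> borel_measurable borel"
    "AE z in lborel. g z = indicator R z * ux (fst z) (snd z)"
    "integrable lborel (\<lambda>z. \<bar>g z\<bar> powr p)" "integrable lborel (\<lambda>z. plap_flux p (g z))" "integrable lborel g"
    "\<And>z. z \<notin> R \<Longrightarrow> g z = 0"
    "(\<lambda>z. indicator R z * ux (fst z) (snd z)) \<in> borel_measurable lebesgue"
proof -
  let ?R = "{X..Y} \<times> {t0..t1}"
  have R_cbox: "?R = cbox (X, t0) (Y, t1)" by (auto simp: cbox_Pair_eq)
  have [measurable]: "?R \<in> sets borel" by (simp add: R_cbox)
  define G where "G z = indicator ?R z * ux (fst z) (snd z)" for z
  have "(\<lambda>z. ux (fst z) (snd z)) \<in> borel_measurable (lebesgue_on (UNIV \<times> time_dom T))"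
    using ux by (simp add: Lp_loc_W1p_loc_def case_prod_beta')
  moreover have "(UNIV :: real set) \<times> time_dom T \<in> sets lebesgue"
    using closed_Times[OF closed_UNIV[where 'a = real] closed_time_dom, of T] by (intro sets_completionI_sets) (simp add: borel_closed)
  ultimately have "(\<lambda>z. if z \<in> UNIV \<times> time_dom T then ux (fst z) (snd z) else 0) \<in> borel_measurable lebesgue"
    by (simp add: borel_measurable_if)
  then have "(\<lambda>z. indicator ?R z * (if z \<in> UNIV \<times> time_dom T then ux (fst z) (snd z) else 0)) \<in> borel_measurable lebesgue"
    by (intro borel_measurable_times borel_measurable_indicator) (auto simp: R_cbox)
  also have "(\<lambda>z. indicator ?R z * (if z \<in> UNIV \<times> time_dom T then ux (fst z) (snd z) else 0)) = G"
    using t time_domI[of _ t1 T] by (auto simp: fun_eq_iff G_def indicator_def)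
  finally have Gm: "G \<in> borel_measurable lebesgue" .
  then obtain g' where g'[measurable]: "g' \<in> borel_measurable lborel" and ae: "AE z in lborel. G z = g' z"
    using completion_ex_borel_measurable_real by blast
  define g where "g z = indicator ?R z * g' z" for z
  have gm[measurable]: "g \<in> borel_measurable borel" unfolding g_def using g' by auto
  have gG: "AE z in lborel. g z = G z"
    using ae
  proof eventually_elim
    case (elim z)
    then show ?case by (cases "z \<in> ?R") (simp_all add: g_def G_def)
  qed
  have "set_integrable lebesgue ?R (\<lambda>(x, t). \<bar>ux x t\<bar> powr p)"
    using ux t by (auto simp: Lp_loc_W1p_loc_def)
  moreover have "(\<lambda>z. indicator ?R z *\<^sub>R (case z of (x, t) \<Rightarrow> \<bar>ux x t\<bar> powr p)) = (\<lambda>z. \<bar>G z\<bar> powr p)"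
    using p by (auto simp: fun_eq_iff G_def indicator_def)
  ultimately have "integrable lebesgue (\<lambda>z. \<bar>G z\<bar> powr p)" by (simp add: set_integrable_def)
  then have "integrable lebesgue (\<lambda>z. \<bar>g z\<bar> powr p)"
    by (rule integrable_cong_AE_imp) (use gG in \<open>auto simp: AE_completion_iff intro!: measurable_completion elim!: eventually_mono\<close>)
  then have gp: "integrable lborel (\<lambda>z. \<bar>g z\<bar> powr p)"
    by (simp add: integrable_completion)
  have iR: "integrable lborel (indicator ?R :: real \<times> real \<Rightarrow> real)"
    unfolding R_cbox using emeasure_lborel_cbox_finite[of "(X, t0)" "(Y, t1)"]
    by (intro integrable_real_indicator) (auto simp: less_top[symmetric])
  \<comment> \<open>Used with k = 1 for the gradient and k = p - 1 for the flux. The condition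
    \<open>g z \<noteq> 0\<close> places \<open>z\<close> in the rectangle, where the indicator is
    1.\<close>
  have bnd: "\<bar>g z\<bar> powr k \<le> indicator ?R z + \<bar>g z\<bar> powr p" if "0 \<le> k" "k \<le> p" "g z \<noteq> 0" for z k
  proof (cases "\<bar>g z\<bar> \<le> 1")
    case True
    then have "\<bar>g z\<bar> powr k \<le> 1 powr k" using that by (intro powr_mono2) auto
    then show ?thesis using that by (auto simp: g_def indicator_def split: if_splits intro: order_trans)
  next
    case False
    then have "\<bar>g z\<bar> powr k \<le> \<bar>g z\<bar> powr p" using that by (intro powr_mono) auto
    then show ?thesis by (auto simp: indicator_def)
  qed
  have "integrable lborel g"
  proof (rule Bochner_Integration.integrable_bound[OF Bochner_Integration.integrable_add[OF iR gp]])
    show "AE z in lborel. norm (g z) \<le> norm (indicator ?R z + \<bar>g z\<bar> powr p)"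
    proof (rule AE_I2)
      fix z show "norm (g z) \<le> norm (indicator ?R z + \<bar>g z\<bar> powr p)"
        using bnd[of 1 z] p by (cases "g z = 0") auto
    qed
  qed simp
  moreover have "integrable lborel (\<lambda>z. plap_flux p (g z))"
  proof (rule Bochner_Integration.integrable_bound[OF Bochner_Integration.integrable_add[OF iR gp]])
    show "AE z in lborel. norm (plap_flux p (g z)) \<le> norm (indicator ?R z + \<bar>g z\<bar> powr p)"
    proof (rule AE_I2)
      fix z show "norm (plap_flux p (g z)) \<le> norm (indicator ?R z + \<bar>g z\<bar> powr p)"
        using bnd[of "p - 1" z] p by (cases "g z = 0") (auto simp: abs_plap_flux)
    qed
  qed simp
  moreover have "g z = 0" if "z \<notin> ?R" for z using that by (simp add: g_def)
  ultimately show ?thesis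
    using that[of g] gm gG gp Gm unfolding R_def G_def[abs_def] by blast
qed

text \<open>The test function is the untruncated polynomial on the closed square around (y, s), with
  constant lateral curves. It vanishes on all four sides, and its extension by zero is the product
  of the truncated kernels, so the identity can be written as an integral over the whole
  plane.\<close>

lemma integral_identity_kernel:
  assumes id: "integral_identity p b \<beta> T u ux"
    and w: "0 < r" "0 < s - r" "ereal (s + r) \<le> T"
  shows "(\<integral>z. - (u (fst z) (snd z) * (kern r (fst z - y) * kern' r (snd z - s)))
      + plap_flux p (ux (fst z) (snd z)) * (kern' r (fst z - y) * kern r (snd z - s))
      + b * u (fst z) (snd z) powr \<beta> * (kern r (fst z - y) * kern r (snd z - s)) \<partial>lebesgue) = 0"
proof -
  define \<psi> where "\<psi> x t = (r\<^sup>2 - (x - y)\<^sup>2) ^ 3 * (r\<^sup>2 - (t - s)\<^sup>2) ^ 3" for x t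
  define \<psi>x where "\<psi>x x t = (- 6 * (x - y) * (r\<^sup>2 - (x - y)\<^sup>2) ^ 2) * (r\<^sup>2 - (t - s)\<^sup>2) ^ 3" for x t
  define \<psi>xx where "\<psi>xx x t = (- 6 * (r\<^sup>2 - (x - y)\<^sup>2) ^ 2 + 24 * (x - y)\<^sup>2 * (r\<^sup>2 - (x - y)\<^sup>2)) * (r\<^sup>2 - (t - s)\<^sup>2) ^ 3" for x t
  define \<psi>t where "\<psi>t x t = (r\<^sup>2 - (x - y)\<^sup>2) ^ 3 * (- 6 * (t - s) * (r\<^sup>2 - (t - s)\<^sup>2) ^ 2)" for x t
  let ?D = "curve_dom (\<lambda>_. y - r) (\<lambda>_. y + r) (s - r) (s + r)"
  have C21: "C21_closure ?D \<psi> \<psi>x \<psi>xx \<psi>t"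
    unfolding C21_closure_def
  proof (intro conjI ballI)
    fix f assume "f \<in> {\<psi>, \<psi>x, \<psi>xx, \<psi>t}"
    then show "continuous_on (closure ?D) (\<lambda>(x, t). f x t)"
      unfolding \<psi>_def[abs_def] \<psi>x_def[abs_def] \<psi>xx_def[abs_def] \<psi>t_def[abs_def] split_beta
      by (auto intro!: continuous_intros)
  next
    fix z assume "z \<in> ?D"
    obtain x t where z: "z = (x, t)" by (cases z)
    have "((\<lambda>y. \<psi> y t) has_real_derivative \<psi>x x t) (at x)"
      unfolding \<psi>_def \<psi>x_def by (auto intro!: derivative_eq_intros)
    moreover have "((\<lambda>y. \<psi>x y t) has_real_derivative \<psi>xx x t) (at x)"
      unfolding \<psi>xx_def \<psi>x_def by (auto intro!: derivative_eq_intros simp: power2_eq_square algebra_simps)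
    moreover have "((\<lambda>s. \<psi> x s) has_real_derivative \<psi>t x t) (at t)"
      unfolding \<psi>_def \<psi>t_def by (auto intro!: derivative_eq_intros)
    ultimately show "case z of (x, t) \<Rightarrow> ((\<lambda>y. \<psi> y t) has_real_derivative \<psi>x x t) (at x) \<and>
        ((\<lambda>y. \<psi>x y t) has_real_derivative \<psi>xx x t) (at x) \<and> ((\<lambda>s. \<psi> x s) has_real_derivative \<psi>t x t) (at t)"
      by (simp add: z)
  qed
  have C1: "C1_on (s - r) (s + r) (\<lambda>_. k)" for k
    unfolding C1_on_def by (intro exI[of _ "\<lambda>_. 0"]) auto
  have "(LINT x:{y - r..y + r}|lebesgue. u x (s + r) * \<psi> x (s + r)) -
        (LINT x:{y - r..y + r}|lebesgue. u x (s - r) * \<psi> x (s - r)) +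
        (LINT z:?D|lebesgue. (case z of (x, t) \<Rightarrow>
              - u x t * \<psi>t x t + plap_flux p (ux x t) * \<psi>x x t + b * u x t powr \<beta> * \<psi> x t)) = 0"
    using id[unfolded integral_identity_def, rule_format, of "s - r" "s + r" "\<lambda>_. y - r" "\<lambda>_. y + r" \<psi> \<psi>x \<psi>xx \<psi>t]
      w C21 C1 by (simp add: \<psi>_def)
  \<comment> \<open>Both time slices drop out because the factor in \<open>t\<close> is zero at
    \<open>s - r\<close> and \<open>s + r\<close>.\<close>
  then have "(LINT z:?D|lebesgue. (case z of (x, t) \<Rightarrow>
              - u x t * \<psi>t x t + plap_flux p (ux x t) * \<psi>x x t + b * u x t powr \<beta> * \<psi> x t)) = 0"
    by (simp add: \<psi>_def set_lebesgue_integral_def)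
  moreover have "indicator ?D z *\<^sub>R (case z of (x, t) \<Rightarrow>
              - u x t * \<psi>t x t + plap_flux p (ux x t) * \<psi>x x t + b * u x t powr \<beta> * \<psi> x t) =
      - (u (fst z) (snd z) * (kern r (fst z - y) * kern' r (snd z - s)))
      + plap_flux p (ux (fst z) (snd z)) * (kern' r (fst z - y) * kern r (snd z - s))
      + b * u (fst z) (snd z) powr \<beta> * (kern r (fst z - y) * kern r (snd z - s))" for z
  proof (cases "\<bar>fst z - y\<bar> < r \<and> \<bar>snd z - s\<bar> < r")
    case True
    then have "z \<in> ?D" by (auto simp: curve_dom_def split_beta abs_less_iff)
    then show ?thesis using True
      by (simp add: split_beta \<psi>_def \<psi>x_def \<psi>t_def kern_inside kern'_inside)
  next
    case False
    then have nD: "z \<notin> ?D" by (auto simp: curve_dom_def split_beta abs_less_iff)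
    have zero: "kern r (fst z - y) * kern' r (snd z - s) = 0" "kern' r (fst z - y) * kern r (snd z - s) = 0"
      "kern r (fst z - y) * kern r (snd z - s) = 0"
      using False kern_outside[OF w(1)] kern'_outside[OF w(1)] by (auto simp: not_less)
    show ?thesis using nD by (simp add: zero del: mult_eq_0_iff)
  qed
  ultimately show ?thesis unfolding set_lebesgue_integral_def by simp
qed

text \<open>The weak derivative is given separately for almost every time. On such a slice the
  spatial kernel is an admissible test function; multiplying by the temporal kernel and integrating
  in time gives the planar identity by Fubini.\<close>

lemma weak_derivative_kernel:
  fixes ux :: "real \<Rightarrow> real \<Rightarrow> real" and g v :: "real \<times> real \<Rightarrow> real" and X Y t0 t1 :: real
  defines "R \<equiv> {X..Y} \<times> {t0..t1}"
  assumes wd: "AE t in lebesgue. t \<in> time_dom T \<longrightarrow> has_weak_deriv (\<lambda>x. u x t) (\<lambda>x. ux x t)"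
    and g: "g \<in> borel_measurable borel" "AE z in lborel. g z = indicator R z * ux (fst z) (snd z)"
      "\<And>z. z \<notin> R \<Longrightarrow> g z = 0" "integrable lborel g"
    and v: "v = (\<lambda>z. indicator R z * u (fst z) (snd z))" "integrable lborel v"
    and t: "0 < t0" "ereal t1 \<le> T" and sq: "0 < r" "square r (y, s) \<subseteq> R"
  shows "(\<integral>z. v z * (kern' r (fst z - y) * kern r (snd z - s)) \<partial>lborel) =
     - (\<integral>z. g z * (kern r (fst z - y) * kern r (snd z - s)) \<partial>lborel)"
proof -
  have vm[measurable]: "v \<in> borel_measurable borel" using v(2) by auto
  note gm[measurable] = g(1)
  obtain K where K: "\<And>x. \<bar>kern r x\<bar> \<le> K" "\<And>x. \<bar>kern' r x\<bar> \<le> K" using kern_common_bound[OF sq(1)] by blast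
  have K0: "0 \<le> K" using K(1)[of 0] by linarith
  have bint: "integrable lborel (\<lambda>z. f z * (k1 (fst z - y) * k2 (snd z - s)))"
    if f: "integrable lborel f" and k: "\<And>x. \<bar>k1 x\<bar> \<le> K" "\<And>x. \<bar>k2 x\<bar> \<le> K"
      and [measurable]: "k1 \<in> borel_measurable borel" "k2 \<in> borel_measurable borel"
    for f :: "real \<times> real \<Rightarrow> real" and k1 k2
  proof (rule Bochner_Integration.integrable_bound[of lborel "\<lambda>z. (K * K) * f z"])
    show "AE z in lborel. norm (f z * (k1 (fst z - y) * k2 (snd z - s))) \<le> norm (K * K * f z)"
    proof (intro AE_I2)
      fix z
      have "\<bar>f z\<bar> * (\<bar>k1 (fst z - y)\<bar> * \<bar>k2 (snd z - s)\<bar>) \<le> \<bar>f z\<bar> * (K * K)"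
        using k K0 by (intro mult_left_mono mult_mono) auto
      then show "norm (f z * (k1 (fst z - y) * k2 (snd z - s))) \<le> norm (K * K * f z)"
        using K0 by (simp add: abs_mult mult_ac)
    qed
  qed (use f in auto)
  have iter: "(\<integral>z. f z * (k1 (fst z - y) * k2 (snd z - s)) \<partial>lborel) =
      (\<integral>t. (\<integral>x. f (x, t) * k1 (x - y) \<partial>lborel) * k2 (t - s) \<partial>lborel)"
    if f: "integrable lborel f" and k: "\<And>x. \<bar>k1 x\<bar> \<le> K" "\<And>x. \<bar>k2 x\<bar> \<le> K"
      and [measurable]: "k1 \<in> borel_measurable borel" "k2 \<in> borel_measurable borel"
    for f :: "real \<times> real \<Rightarrow> real" and k1 k2
  proof -
    have "integrable (lborel \<Otimes>\<^sub>M lborel) (case_prod (\<lambda>x t. f (x, t) * (k1 (x - y) * k2 (t - s))))"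
      using bint[OF that] by (simp add: lborel_prod split_beta')
    from lborel_pair.integral_snd[OF this]
    have "(\<integral>t. \<integral>x. f (x, t) * (k1 (x - y) * k2 (t - s)) \<partial>lborel \<partial>lborel) = (\<integral>z. f z * (k1 (fst z - y) * k2 (snd z - s)) \<partial>lborel)"
      by (simp add: lborel_prod split_beta')
    then show ?thesis by (simp flip: mult.assoc)
  qed
  \<comment> \<open>\<open>g\<close> agrees with the gradient off a planar null set, whereas the
    slices need agreement for almost every \<open>x\<close> at almost every \<open>t\<close>. A
    measurable null set makes the order of the two quantifiers exchangeable.\<close>
  obtain N where N: "N \<in> null_sets lborel" "\<And>z. z \<notin> N \<Longrightarrow> g z = indicator R z * ux (fst z) (snd z)"
    using g(2) by (elim AE_E3) auto
  have "AE z in lborel \<Otimes>\<^sub>M lborel. z \<notin> N" unfolding lborel_prod by (rule AE_not_in[OF N(1)])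
  then have "AE x in lborel. AE t in lborel. (x, t) \<notin> N" by (rule lborel_pair.AE_pair)
  moreover have "{z \<in> space (lborel \<Otimes>\<^sub>M lborel). (fst z, snd z) \<notin> N} \<in> sets (lborel \<Otimes>\<^sub>M lborel)"
    unfolding lborel_prod using N(1) by (auto simp: null_sets_def Collect_neg_eq[symmetric] Compl_eq[symmetric] intro: borel_comp)
  ultimately have AEN: "AE t in lborel. AE x in lborel. (x, t) \<notin> N"
    using lborel_pair.AE_commute[of "\<lambda>x t. (x, t) \<notin> N"] by auto
  have inner: "(\<integral>x. v (x, t) * kern' r (x - y) \<partial>lborel) * kern r (t - s) = - ((\<integral>x. g (x, t) * kern r (x - y) \<partial>lborel) * kern r (t - s))"
    if wt: "t \<in> time_dom T \<longrightarrow> has_weak_deriv (\<lambda>x. u x t) (\<lambda>x. ux x t)" and Nt: "AE x in lborel. (x, t) \<notin> N" for t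
  proof (cases "\<bar>t - s\<bar> < r")
    case False
    then show ?thesis using sq(1) by (simp add: kern_outside)
  next
    case True
    have xR: "(x, t) \<in> R" if "\<bar>x - y\<bar> \<le> r" for x
      using sq(2) True that by (auto simp: square_def)
    have tT: "t \<in> time_dom T" using xR[of y] sq(1) t time_domI[of t t1 T] by (auto simp: R_def)
    have wd': "has_weak_deriv (\<lambda>x. u x t) (\<lambda>x. ux x t)" using wt tT by blast
    have dk: "((\<lambda>x. kern r (x - y)) has_real_derivative kern' r (x - y)) (at x)" for x
    proof -
      have "((\<lambda>x. x - y) has_real_derivative 1) (at x)" by (auto intro!: derivative_eq_intros)
      from DERIV_chain2[OF kern_deriv this] show ?thesis by simp
    qed
    have "{x. kern r (x - y) \<noteq> 0} \<subseteq> {y - r..y + r}"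
      using kern_outside[OF sq(1)] by (force simp: not_le abs_le_iff)
    then have "bounded {x. kern r (x - y) \<noteq> 0}" by (rule bounded_subset[rotated]) simp
    then have "(LINT x|lebesgue. u x t * kern' r (x - y)) = - (LINT x|lebesgue. ux x t * kern r (x - y))"
      using wd'[unfolded has_weak_deriv_def, THEN conjunct2, rule_format, of "\<lambda>x. kern r (x - y)" "\<lambda>x. kern' r (x - y)"] dk
      by (simp add: continuous_intros)
    moreover have "(\<integral>x. v (x, t) * kern' r (x - y) \<partial>lborel) = (LINT x|lebesgue. u x t * kern' r (x - y))"
    proof -
      have "(\<lambda>x. u x t * kern' r (x - y)) = (\<lambda>x. v (x, t) * kern' r (x - y))"
      proof
        fix x show "u x t * kern' r (x - y) = v (x, t) * kern' r (x - y)"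
          using xR[of x] kern'_outside[OF sq(1), of "x - y"] by (cases "\<bar>x - y\<bar> \<le> r") (auto simp: v(1))
      qed
      then show ?thesis by (simp add: lborel_imp_lebesgue_integral)
    qed
    moreover have "(\<integral>x. g (x, t) * kern r (x - y) \<partial>lborel) = (LINT x|lebesgue. ux x t * kern r (x - y))"
    proof -
      have "(\<integral>x. g (x, t) * kern r (x - y) \<partial>lborel) = (LINT x|lebesgue. g (x, t) * kern r (x - y))"
        by (simp add: lborel_imp_lebesgue_integral)
      also have "\<dots> = (LINT x|lebesgue. ux x t * kern r (x - y))"
      proof (rule integral_cong_AE)
        show "(\<lambda>x. g (x, t) * kern r (x - y)) \<in> borel_measurable lebesgue"
          by (rule measurable_completion) measurable
        \<comment> \<open>Measurability of the slice of \<open>ux\<close> is taken from its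
          integrability on bounded intervals; the indicator of the support of the kernel can be
          inserted for free.\<close>
        have "set_integrable lebesgue {y - r..y + r} (\<lambda>x. ux x t)" using wd' by (simp add: has_weak_deriv_def)
        then have "(\<lambda>x. indicator {y - r..y + r} x *\<^sub>R ux x t) \<in> borel_measurable lebesgue"
          by (auto simp: set_integrable_def)
        moreover have "(\<lambda>x. kern r (x - y)) \<in> borel_measurable lebesgue"
          by (rule measurable_completion) measurable
        ultimately have "(\<lambda>x. (indicator {y - r..y + r} x *\<^sub>R ux x t) * kern r (x - y)) \<in> borel_measurable lebesgue"
          by (rule borel_measurable_times)
        also have "(\<lambda>x. (indicator {y - r..y + r} x *\<^sub>R ux x t) * kern r (x - y)) = (\<lambda>x. ux x t * kern r (x - y))"
        proof
          fix x show "(indicator {y - r..y + r} x *\<^sub>R ux x t) * kern r (x - y) = ux x t * kern r (x - y)"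
            using kern_outside[OF sq(1), of "x - y"]
            by (cases "r \<le> \<bar>x - y\<bar>") (auto simp: indicator_def not_le abs_less_iff)
        qed
        finally show "(\<lambda>x. ux x t * kern r (x - y)) \<in> borel_measurable lebesgue" .
        have "AE x in lebesgue. (x, t) \<notin> N" using Nt by (rule AE_completion)
        then show "AE x in lebesgue. g (x, t) * kern r (x - y) = ux x t * kern r (x - y)"
        proof eventually_elim
          case (elim x)
          show ?case
            using N(2)[OF elim] xR[of x] kern_outside[OF sq(1), of "x - y"] by (cases "\<bar>x - y\<bar> \<le> r") auto
        qed
      qed
      finally show ?thesis .
    qed
    ultimately show ?thesis by simp
  qed
  have wd': "AE t in lborel. t \<in> time_dom T \<longrightarrow> has_weak_deriv (\<lambda>x. u x t) (\<lambda>x. ux x t)"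
    using wd by (simp add: AE_completion_iff)
  have "(\<integral>z. v z * (kern' r (fst z - y) * kern r (snd z - s)) \<partial>lborel) =
      (\<integral>t. (\<integral>x. v (x, t) * kern' r (x - y) \<partial>lborel) * kern r (t - s) \<partial>lborel)"
    by (rule iter[OF v(2) K(2) K(1)]) auto
  also have "\<dots> = (\<integral>t. - ((\<integral>x. g (x, t) * kern r (x - y) \<partial>lborel) * kern r (t - s)) \<partial>lborel)"
  proof (rule integral_cong_AE)
    have m: "(\<lambda>t. \<integral>x. (case (t, x) of (t, x) \<Rightarrow> f (x, t) * k (x - y)) \<partial>lborel) \<in> borel_measurable lborel"
      if [measurable]: "f \<in> borel_measurable borel" "k \<in> borel_measurable borel" for f :: "real \<times> real \<Rightarrow> real" and k
      by (rule lborel.borel_measurable_lebesgue_integral) measurable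
    show "(\<lambda>t. (\<integral>x. v (x, t) * kern' r (x - y) \<partial>lborel) * kern r (t - s)) \<in> borel_measurable lborel"
      using m[OF vm kern'_measurable] by simp
    show "(\<lambda>t. - ((\<integral>x. g (x, t) * kern r (x - y) \<partial>lborel) * kern r (t - s))) \<in> borel_measurable lborel"
      using m[OF gm kern_measurable] by simp
    show "AE t in lborel. (\<integral>x. v (x, t) * kern' r (x - y) \<partial>lborel) * kern r (t - s) =
        - ((\<integral>x. g (x, t) * kern r (x - y) \<partial>lborel) * kern r (t - s))"
      using wd' AEN by eventually_elim (rule inner)
  qed
  also have "\<dots> = - (\<integral>t. (\<integral>x. g (x, t) * kern r (x - y) \<partial>lborel) * kern r (t - s) \<partial>lborel)" by simp
  also have "(\<integral>t. (\<integral>x. g (x, t) * kern r (x - y) \<partial>lborel) * kern r (t - s) \<partial>lborel) =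
      (\<integral>z. g z * (kern r (fst z - y) * kern r (snd z - s)) \<partial>lborel)"
    by (rule iter[OF g(4) K(1) K(1), symmetric]) auto
  finally show ?thesis .
qed

text \<open>The two kernel identities, centred at \<open>w\<close> and divided by
  \<open>kmass r\<close>, are precisely the mollified equation and the relation between the
  mollified solution and its gradient. Continuity of \<open>u\<close> up to the boundary of the
  compact rectangle makes the solution and the absorption term integrable.\<close>

lemma continuous_weak_solution_mollified:
  assumes p: "1 < p" and b: "\<beta> = p - 1" and sol: "continuous_weak_solution p b \<beta> T u0 u"
    and t: "0 < t0" "t0 < t1" "ereal t1 \<le> T"
  shows "\<exists>g. mollified_solution p X Y t0 t1 (\<lambda>z. indicator ({X..Y} \<times> {t0..t1}) z * u (fst z) (snd z)) g
     (\<lambda>z. indicator ({X..Y} \<times> {t0..t1}) z * (b * u (fst z) (snd z) powr \<beta>))"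
proof -
  let ?R = "{X..Y} \<times> {t0..t1}"
  have R_cbox: "?R = cbox (X, t0) (Y, t1)" by (auto simp: cbox_Pair_eq)
  have b0: "0 < \<beta>" using p b by simp
  have sub: "?R \<subseteq> UNIV \<times> time_dom T" using t time_domI[of _ t1 T] by auto
  have u0: "0 \<le> u x t" if "t \<in> time_dom T" for x t
    using sol that by (auto simp: continuous_weak_solution_def weak_solution_def)
  have cu: "continuous_on ?R (\<lambda>z. u (fst z) (snd z))"
    using sol continuous_on_subset[OF _ sub] by (auto simp: continuous_weak_solution_def case_prod_beta')
  have cq: "continuous_on ?R (\<lambda>z. b * u (fst z) (snd z) powr \<beta>)"
    using u0 sub b0 by (intro continuous_intros cu continuous_on_powr') force+
  obtain ux where ux: "Lp_loc_W1p_loc p \<beta> T u ux" and id: "integral_identity p b \<beta> T u ux"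
    using sol by (auto simp: continuous_weak_solution_def weak_solution_def)
  define v where "v = (\<lambda>z. indicator ?R z * u (fst z) (snd z))"
  define q where "q = (\<lambda>z. indicator ?R z * (b * u (fst z) (snd z) powr \<beta>))"
  have vi: "integrable lborel v" "integrable lborel q"
    unfolding v_def q_def R_cbox using borel_integrable_compact[OF compact_cbox cu[unfolded R_cbox]]
      borel_integrable_compact[OF compact_cbox cq[unfolded R_cbox]] by simp_all
  obtain g where g: "g \<in> borel_measurable borel"
    "AE z in lborel. g z = indicator ?R z * ux (fst z) (snd z)"
    "integrable lborel (\<lambda>z. \<bar>g z\<bar> powr p)" "integrable lborel (\<lambda>z. plap_flux p (g z))" "integrable lborel g"
    "\<And>z. z \<notin> ?R \<Longrightarrow> g z = 0"
    "(\<lambda>z. indicator ?R z * ux (fst z) (snd z)) \<in> borel_measurable lebesgue"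
    by (rule weak_solution_gradient[OF p ux t, of X Y]) blast
  note [measurable] = g(1) borel_measurable_integrable[OF vi(1)] borel_measurable_integrable[OF vi(2)]
  have "mollified_solution p X Y t0 t1 v g q"
    unfolding mollified_solution_def
  proof (intro conjI allI impI vi g)
    fix w :: "real \<times> real" and r assume sq: "0 < r \<and> square r w \<subseteq> ?R"
    obtain y s where w: "w = (y, s)" by (cases w)
    have "(y, s - r) \<in> square r w" "(y, s + r) \<in> square r w" using sq by (auto simp: square_def w)
    then have st: "0 < s - r" "s + r \<le> t1" using sq t by auto
    then have "ereal (s + r) \<le> T" using t(3) order_trans[of "ereal (s + r)" "ereal t1" T] by simp
    note idk = integral_identity_kernel[OF id _ st(1) this, of y]
    define k11 where "k11 z = kern r (fst z - y) * kern r (snd z - s)" for z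
    define k01 where "k01 z = kern r (fst z - y) * kern' r (snd z - s)" for z
    define k10 where "k10 z = kern' r (fst z - y) * kern r (snd z - s)" for z
    have [measurable]: "k11 \<in> borel_measurable borel" "k01 \<in> borel_measurable borel" "k10 \<in> borel_measurable borel"
      unfolding k11_def[abs_def] k01_def[abs_def] k10_def[abs_def] by measurable
    have k0: "k11 z = 0 \<and> k01 z = 0 \<and> k10 z = 0" if "z \<notin> ?R" for z
    proof -
      have "z \<notin> square r w" using that sq by blast
      then show ?thesis
        using kern_outside[of r] kern'_outside[of r] sq by (auto simp: square_def w k11_def k01_def k10_def not_le)
    qed
    obtain K where K: "\<And>x. \<bar>kern r x\<bar> \<le> K" "\<And>x. \<bar>kern' r x\<bar> \<le> K" using kern_common_bound sq by blast
    have K0: "0 \<le> K" using K(1)[of 0] by linarith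
    have kb: "\<bar>k11 z\<bar> \<le> K * K" "\<bar>k01 z\<bar> \<le> K * K" "\<bar>k10 z\<bar> \<le> K * K" for z
      unfolding k11_def k01_def k10_def abs_mult using K K0 by (auto intro!: mult_mono)
    have bint: "integrable lborel (\<lambda>z. f z * k z)"
      if f: "integrable lborel f" and k: "\<And>z. \<bar>k z\<bar> \<le> K * K" and [measurable]: "k \<in> borel_measurable borel"
      for f k :: "real \<times> real \<Rightarrow> real"
    proof (rule Bochner_Integration.integrable_bound[of lborel "\<lambda>z. (K * K) * f z"])
      show "AE z in lborel. norm (f z * k z) \<le> norm (K * K * f z)"
      proof (intro AE_I2)
        fix z
        have "\<bar>f z\<bar> * \<bar>k z\<bar> \<le> \<bar>f z\<bar> * (K * K)" using k by (intro mult_left_mono) auto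
        then show "norm (f z * k z) \<le> norm (K * K * f z)" using K0 by (simp add: abs_mult mult_ac)
      qed
    qed (use f in auto)
    let ?u = "\<lambda>z. u (fst z) (snd z)" and ?ux = "\<lambda>z. ux (fst z) (snd z)"
    \<comment> \<open>All three kernels vanish outside the square, hence outside \<open>?R\<close>,
      so the cutoff changes nothing.\<close>
    have pt: "- (?u z * k01 z) + plap_flux p (?ux z) * k10 z + b * ?u z powr \<beta> * k11 z =
       - (v z * k01 z) + plap_flux p (indicator ?R z * ?ux z) * k10 z + q z * k11 z" for z
      using k0[of z] by (cases "z \<in> ?R") (auto simp: v_def q_def)
    have "(\<integral>z. - (v z * k01 z) + plap_flux p (indicator ?R z * ?ux z) * k10 z + q z * k11 z \<partial>lebesgue) = 0"
      using idk sq unfolding k01_def[symmetric] k10_def[symmetric] k11_def[symmetric] pt by simp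
    also have "(\<integral>z. - (v z * k01 z) + plap_flux p (indicator ?R z * ?ux z) * k10 z + q z * k11 z \<partial>lebesgue) =
        (\<integral>z. - (v z * k01 z) + plap_flux p (g z) * k10 z + q z * k11 z \<partial>lebesgue)"
    proof (rule integral_cong_AE)
      have m: "(\<lambda>z. f z * k z) \<in> borel_measurable lebesgue" if [measurable]: "f \<in> borel_measurable borel" "k \<in> borel_measurable borel"
        for f k :: "real \<times> real \<Rightarrow> real" by (rule measurable_completion) measurable
      show "(\<lambda>z. - (v z * k01 z) + plap_flux p (g z) * k10 z + q z * k11 z) \<in> borel_measurable lebesgue"
        by (rule measurable_completion) measurable
      have "(\<lambda>z. plap_flux p (indicator ?R z * ?ux z)) \<in> borel_measurable lebesgue"
        by (rule measurable_compose[OF g(7) plap_flux_measurable])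
      moreover have "k10 \<in> borel_measurable lebesgue" by (rule measurable_completion) simp
      ultimately show "(\<lambda>z. - (v z * k01 z) + plap_flux p (indicator ?R z * ?ux z) * k10 z + q z * k11 z) \<in> borel_measurable lebesgue"
        by (intro borel_measurable_add borel_measurable_uminus borel_measurable_times[of _ _ k10] m) auto
      show "AE z in lebesgue. - (v z * k01 z) + plap_flux p (indicator ?R z * ?ux z) * k10 z + q z * k11 z =
         - (v z * k01 z) + plap_flux p (g z) * k10 z + q z * k11 z"
        using AE_completion[OF g(2)] by eventually_elim simp
    qed
    also have "\<dots> = (\<integral>z. - (v z * k01 z) + plap_flux p (g z) * k10 z + q z * k11 z \<partial>lborel)"
      by (rule lborel_imp_lebesgue_integral) measurable
    also have "\<dots> = - (\<integral>z. v z * k01 z \<partial>lborel) + (\<integral>z. plap_flux p (g z) * k10 z \<partial>lborel) + (\<integral>z. q z * k11 z \<partial>lborel)"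
      using bint[OF vi(1) kb(2)] bint[OF g(4) kb(3)] bint[OF vi(2) kb(1)] by simp
    finally have "- (\<integral>z. v z * k01 z \<partial>lborel) = - (\<integral>z. plap_flux p (g z) * k10 z \<partial>lborel) - (\<integral>z. q z * k11 z \<partial>lborel)"
      by linarith
    then show "moll2 r v w = moll1 r (\<lambda>z. plap_flux p (g z)) w - moll r q w"
      unfolding moll2_def moll1_def moll_eq w fst_conv snd_conv k01_def k10_def k11_def
      by (simp add: diff_divide_distrib)
    have "(\<integral>z. v z * (kern' r (fst z - y) * kern r (snd z - s)) \<partial>lborel) =
       - (\<integral>z. g z * (kern r (fst z - y) * kern r (snd z - s)) \<partial>lborel)"
      by (rule weak_derivative_kernel[of T u ux g X Y t0 t1 v r y s])
        (use ux g vi t sq w in \<open>auto simp: Lp_loc_W1p_loc_def v_def\<close>)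
    then show "moll1 r v w = moll r g w"
      unfolding moll1_def moll_eq w fst_conv snd_conv by simp
  qed
  then show ?thesis unfolding v_def q_def by blast
qed

section \<open>The profile\<close>

text \<open>First integral of the profile equation: the decaying solutions satisfy \<open>\<phi>' = - N\<^bsup>1/p\<^esup>\<close> with
  \<open>N = B \<phi>\<^sup>p + k \<phi>\<^sup>2\<close>. Writing \<open>\<phi> = exp (- g)\<close>, the equation for \<open>g\<close> is autonomous and \<open>g\<close> is the inverse of a
  primitive of \<open>1 / K\<close>.\<close>

lemma profile_exists:
  fixes p b :: real
  assumes p: "1 < p" "p < 2" and b: "0 < b"
  shows "\<exists>r0>0. \<exists>\<phi> \<phi>'. (\<forall>x\<ge>-r0. 0 < \<phi> x \<and> \<phi>' x < 0 \<and> (\<phi> has_real_derivative \<phi>' x) (at x) \<and>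
        ((\<lambda>y. plap_flux p (\<phi>' y)) has_real_derivative 1 / (2 - p) * \<phi> x + b * \<phi> x powr (p - 1)) (at x)) \<and>
      continuous_on {-r0..} \<phi>' \<and> \<phi> 0 = 1 \<and> (\<phi> \<longlongrightarrow> 0) at_top \<and>
      ((\<lambda>x. ln (\<phi> x) / x) \<longlongrightarrow> - ((b / (p - 1)) powr (1 / p))) at_top"
proof -
  \<comment> \<open>Multiplying the profile equation by \<phi>' and integrating, with zero
    integration constant because of decay at infinity, gives \<bar>\<phi>'\<bar>^p = B \<phi>^p + k
    \<phi>^2 with these two constants; \<open>n v\<close> is the right-hand side at \<phi> =
    exp(-v).\<close>
  define B where "B = b / (p - 1)"
  define k where "k = p / (2 * (2 - p) * (p - 1))"
  define n where "n v = B * exp (- (p * v)) + k * exp (- (2 * v))" for v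
  \<comment> \<open>With \<phi> = exp(-g) the first-order equation becomes g' = K(g).\<close>
  define K where "K v = exp v * n v powr (1 / p)" for v
  have Bk: "0 < B" "0 < k" using p b by (auto simp: B_def k_def)
  have n0: "0 < n v" for v using Bk by (simp add: n_def add_pos_pos)
  have K0: "0 < K v" for v using n0[of v] by (simp add: K_def)
  \<comment> \<open>In this form \<open>K\<close> is visibly decreasing with limit
    \<open>B powr (1 / p)\<close>: the square is negligible against the p-th power as \<phi> tends
    to 0, because p < 2. This limit is the logarithmic rate in the claim.\<close>
  have K_eq: "K v = (B + k * exp (- ((2 - p) * v))) powr (1 / p)" for v
  proof -
    have "exp v = (exp (p * v)) powr (1 / p)" using p by (simp add: powr_def)
    then have "K v = (exp (p * v) * n v) powr (1 / p)" using n0[of v] by (simp add: K_def powr_mult)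
    also have "exp (p * v) * n v = B * (exp (p * v) * exp (- (p * v))) + k * (exp (p * v) * exp (- (2 * v)))"
      by (simp only: n_def distrib_left mult.left_commute)
    also have "exp (p * v) * exp (- (2 * v)) = exp (- ((2 - p) * v))"
      unfolding exp_add[symmetric] by (simp add: left_diff_distrib)
    also have "B * (exp (p * v) * exp (- (p * v))) + k * exp (- ((2 - p) * v)) = B + k * exp (- ((2 - p) * v))"
      unfolding exp_add[symmetric] by simp
    finally show ?thesis .
  qed
  have nc: "continuous_on S n" for S unfolding n_def by (intro continuous_intros)
  have Kc: "continuous_on S K" for S
    unfolding K_def using n0 by (intro continuous_intros nc) (auto simp: less_imp_neq[symmetric])
  have Kmono: "K w \<le> K v" if "v \<le> w" for v w
    unfolding K_eq using that p Bk by (intro powr_mono2 add_left_mono mult_left_mono) (auto simp: add_nonneg_nonneg)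
  have iK: "isCont (\<lambda>v. 1 / K v) v" for v
    using Kc[of UNIV] K0[of v] by (auto simp: continuous_on_eq_continuous_at intro!: continuous_intros)
  obtain F where F: "\<And>v. (F has_vector_derivative (1 / K v)) (at v)"
    using einterval_antiderivative[of "-\<infinity>" "\<infinity>" "\<lambda>v. 1 / K v", OF _ iK] by auto
  define \<Theta> where "\<Theta> v = F v - F 0" for v
  have d\<Theta>: "(\<Theta> has_real_derivative 1 / K v) (at v)" for v
    using F[of v] unfolding \<Theta>_def has_real_derivative_iff_has_vector_derivative[symmetric]
    by (auto intro!: derivative_eq_intros)
  have \<Theta>c: "continuous_on S \<Theta>" for S
    using d\<Theta> by (meson DERIV_isCont continuous_at_imp_continuous_on)
  have mono: "\<Theta> v < \<Theta> w" if "v < w" for v w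
  proof (rule DERIV_pos_imp_increasing[where f = \<Theta>, OF that])
    fix x show "\<exists>y. (\<Theta> has_real_derivative y) (at x) \<and> 0 < y"
      by (rule exI[of _ "1 / K x"]) (simp add: d\<Theta> K0)
  qed
  have mono_iff: "\<Theta> v < \<Theta> w \<longleftrightarrow> v < w" for v w
    using mono[of v w] mono[of w v] by (cases v w rule: linorder_cases) auto
  have \<Theta>0: "\<Theta> 0 = 0" by (simp add: \<Theta>_def)
  have inj: "inj \<Theta>" by (rule strict_mono_imp_inj_on[OF strict_monoI[OF mono]])
  \<comment> \<open>Since K \<le> K 0 on the half line, the primitive grows at least linearly, and
    its inverse is defined for all large arguments.\<close>
  have grow: "w / K 0 \<le> \<Theta> w" if "0 \<le> w" for w
  proof -
    have "\<Theta> 0 - 0 / K 0 \<le> \<Theta> w - w / K 0"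
    proof (rule DERIV_nonneg_imp_nondecreasing[OF that])
      fix x :: real assume x: "0 \<le> x"
      have "((\<lambda>x. \<Theta> x - x / K 0) has_real_derivative 1 / K x - 1 / K 0) (at x)"
        by (intro DERIV_diff d\<Theta> DERIV_cdivide DERIV_ident)
      moreover have "0 \<le> 1 / K x - 1 / K 0" using Kmono[OF x] K0[of x] by (simp add: frac_le)
      ultimately show "\<exists>y. ((\<lambda>x. \<Theta> x - x / K 0) has_real_derivative y) (at x) \<and> 0 \<le> y" by blast
    qed
    then show ?thesis by (simp add: \<Theta>0)
  qed
  \<comment> \<open>Any negative number could replace -1. The primitive has a finite limit at
    -\<infinity>, where \<open>K\<close> grows exponentially, so \<phi> blows up at a finite point
    on the left; \<open>-r0\<close> is a safe point, with value exp 1.\<close>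
  define r0 where "r0 = - \<Theta> (-1)"
  have r0: "0 < r0" using mono[of "-1" 0] by (simp add: r0_def \<Theta>0)
  define g where "g = inv \<Theta>"
  have g\<Theta>: "g (\<Theta> v) = v" for v unfolding g_def by (rule inv_f_f[OF inj])
  have surj: "\<exists>v\<ge>-1. \<Theta> v = x" if "-r0 \<le> x" for x
  proof -
    define w where "w = max 0 (x * K 0)"
    have "x \<le> w / K 0" using K0[of 0] by (simp add: w_def pos_le_divide_eq le_max_iff_disj)
    then have "x \<le> \<Theta> w" using grow[of w] by (simp add: w_def)
    moreover have "\<Theta> (-1) \<le> x" using that by (simp add: r0_def)
    moreover have "-1 \<le> w" by (simp add: w_def le_max_iff_disj)
    ultimately show ?thesis using IVT'[of \<Theta> "-1" x w, OF _ _ _ \<Theta>c] by blast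
  qed
  have \<Theta>g: "\<Theta> (g x) = x" if "-r0 \<le> x" for x using surj[OF that] g\<Theta> by metis
  have gc: "isCont g (\<Theta> v)" for v
    by (rule isCont_inverse_function2[of "v - 1" v "v + 1"]) (use g\<Theta> d\<Theta> in \<open>auto intro: DERIV_isCont\<close>)
  have dg: "(g has_real_derivative K (g x)) (at x)" if "-r0 \<le> x" for x
  proof -
    have x: "\<Theta> (g x) = x" by (rule \<Theta>g[OF that])
    have "(g has_real_derivative inverse (1 / K (g x))) (at x)"
    proof (rule DERIV_inverse_function)
      show "(\<Theta> has_real_derivative 1 / K (g x)) (at (g x))" by (rule d\<Theta>)
      show "1 / K (g x) \<noteq> 0" using K0[of "g x"] by simp
      show "\<Theta> (g x - 1) < x" using mono[of "g x - 1" "g x"] x by simp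
      show "x < \<Theta> (g x + 1)" using mono[of "g x" "g x + 1"] x by simp
      show "\<Theta> (g y) = y" if y: "\<Theta> (g x - 1) < y" "y < \<Theta> (g x + 1)" for y
        using IVT'[of \<Theta> "g x - 1" y "g x + 1"] y \<Theta>c g\<Theta> by force
      show "isCont g x" using gc[of "g x"] x by simp
    qed
    then show ?thesis by simp
  qed
  have gtop: "filterlim g at_top at_top"
    unfolding filterlim_at_top
  proof
    fix Z
    show "\<forall>\<^sub>F x in at_top. Z \<le> g x"
      using eventually_ge_at_top[of "max (-r0) (\<Theta> Z)"]
    proof eventually_elim
      case (elim x)
      then have "\<not> \<Theta> (g x) < \<Theta> Z" using \<Theta>g[of x] by auto
      then show ?case by (simp add: mono_iff)
    qed
  qed
  define \<phi> where "\<phi> x = exp (- g x)" for x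
  define \<phi>' where "\<phi>' x = - (n (g x) powr (1 / p))" for x
  have d1: "(\<phi> has_real_derivative \<phi>' x) (at x)" if "-r0 \<le> x" for x
    unfolding \<phi>_def \<phi>'_def
    by (rule derivative_eq_intros dg[OF that] refl)+ (simp add: K_def exp_minus field_simps)
  have flux: "plap_flux p (\<phi>' y) = - (n (g y) powr ((p - 1) / p))" for y
    using n0[of "g y"] by (simp add: \<phi>'_def plap_flux_eq powr_powr)
  have d2: "((\<lambda>y. plap_flux p (\<phi>' y)) has_real_derivative 1 / (2 - p) * \<phi> x + b * \<phi> x powr (p - 1)) (at x)"
    if "-r0 \<le> x" for x
  proof -
    define v where "v = g x"
    have dn: "(n has_real_derivative - (p * (B * exp (- (p * v))) + 2 * (k * exp (- (2 * v))))) (at v)"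
      unfolding n_def by (auto intro!: derivative_eq_intros)
    have dng: "((\<lambda>x. n (g x)) has_real_derivative - (p * (B * exp (- (p * v))) + 2 * (k * exp (- (2 * v)))) * K v) (at x)"
      using DERIV_chain2[OF dn[unfolded v_def] dg[OF that]] by (simp add: v_def)
    have "((\<lambda>y. - (n (g y) powr ((p - 1) / p))) has_real_derivative
        - ((p - 1) / p * n v powr ((p - 1) / p - 1) * (- (p * (B * exp (- (p * v))) + 2 * (k * exp (- (2 * v)))) * K v))) (at x)"
      using DERIV_minus[OF DERIV_fun_powr[OF dng n0, of "(p - 1) / p"]] by (simp add: v_def)
    moreover have "- ((p - 1) / p * n v powr ((p - 1) / p - 1) * (- (p * (B * exp (- (p * v))) + 2 * (k * exp (- (2 * v)))) * K v))
        = 1 / (2 - p) * \<phi> x + b * \<phi> x powr (p - 1)"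
    proof -
      have "n v powr ((p - 1) / p - 1) * n v powr (1 / p) = 1"
        using n0[of v] p by (simp add: powr_add[symmetric] diff_divide_distrib)
      then have NK: "n v powr ((p - 1) / p - 1) * K v = exp v" by (simp add: K_def mult.left_commute)
      have alg: "- (c * N * (- S * L)) = c * S * (N * L)" for c N S L :: real by simp
      have "- ((p - 1) / p * n v powr ((p - 1) / p - 1) * (- (p * (B * exp (- (p * v))) + 2 * (k * exp (- (2 * v)))) * K v))
        = (p - 1) / p * (p * (B * exp (- (p * v))) + 2 * (k * exp (- (2 * v)))) * exp v"
        unfolding alg NK ..
      also have "\<dots> = (p - 1) * B * (exp (- (p * v)) * exp v) + 2 * k * (p - 1) / p * (exp (- (2 * v)) * exp v)"
        using p by (simp add: field_simps)
      also have "exp (- (p * v)) * exp v = \<phi> x powr (p - 1)"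
        unfolding exp_add[symmetric] by (simp add: \<phi>_def v_def powr_def left_diff_distrib)
      also have "exp (- (2 * v)) * exp v = \<phi> x" unfolding exp_add[symmetric] by (simp add: \<phi>_def v_def)
      also have "(p - 1) * B = b" using p by (simp add: B_def)
      also have "2 * k * (p - 1) / p = 1 / (2 - p)"
      proof -
        have "2 * (p / (2 * c * d)) * d / p = 1 / c" if "d \<noteq> 0" for c d using that p by simp
        from this[of "p - 1" "2 - p"] show ?thesis using p by (simp add: k_def)
      qed
      finally show ?thesis by simp
    qed
    ultimately show ?thesis unfolding flux by simp
  qed
  have gcont: "continuous_on {-r0..} g"
    using dg by (intro continuous_at_imp_continuous_on) (auto intro: DERIV_isCont)
  have c\<phi>': "continuous_on {-r0..} \<phi>'"
    unfolding \<phi>'_def using n0 by (intro continuous_intros continuous_on_compose2[OF nc gcont, of UNIV]) (auto simp: less_imp_neq[symmetric])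
  have "g 0 = 0" using g\<Theta>[of 0] \<Theta>0 by simp
  then have \<phi>0: "\<phi> 0 = 1" by (simp add: \<phi>_def)
  have lim0: "(\<phi> \<longlongrightarrow> 0) at_top"
  proof -
    have "filterlim (\<lambda>x. - g x) at_bot at_top" using gtop by (simp add: filterlim_uminus_at_top)
    from filterlim_compose[OF exp_at_bot this] show ?thesis by (simp add: \<phi>_def[abs_def])
  qed
  have "((\<lambda>x. K (g x) / 1) \<longlongrightarrow> B powr (1 / p)) at_top"
  proof -
    have "filterlim (\<lambda>v. (2 - p) * v) at_top at_top"
      using p filterlim_tendsto_pos_mult_at_top[OF tendsto_const _ filterlim_ident, of "2 - p"] by simp
    then have "filterlim (\<lambda>v. - ((2 - p) * v)) at_bot at_top" by (simp add: filterlim_uminus_at_top)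
    from filterlim_compose[OF exp_at_bot this]
    have "((\<lambda>v. exp (- ((2 - p) * v))) \<longlongrightarrow> 0) at_top" .
    then have "((\<lambda>v. (B + k * exp (- ((2 - p) * v))) powr (1 / p)) \<longlongrightarrow> (B + k * 0) powr (1 / p)) at_top"
      using Bk by (intro tendsto_intros) auto
    then have "(K \<longlongrightarrow> B powr (1 / p)) at_top" unfolding K_eq[abs_def] by simp
    from filterlim_compose[OF this gtop] show ?thesis by simp
  qed
  \<comment> \<open>By l'Hospital's rule it suffices that g' = K(g) converges, which follows from g
    tending to infinity.\<close>
  then have "((\<lambda>x. g x / x) \<longlongrightarrow> B powr (1 / p)) at_top"
  proof (rule lhospital_at_top_at_top[rotated 4])
    show "\<forall>\<^sub>F x in at_top. (g has_real_derivative K (g x)) (at x)"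
      using eventually_ge_at_top[of "-r0"] by eventually_elim (rule dg)
  qed (auto intro: filterlim_ident)
  then have "((\<lambda>x. - (g x / x)) \<longlongrightarrow> - (B powr (1 / p))) at_top" by (rule tendsto_minus)
  then have lnlim: "((\<lambda>x. ln (\<phi> x) / x) \<longlongrightarrow> - ((b / (p - 1)) powr (1 / p))) at_top"
    by (simp add: \<phi>_def B_def)
  have "\<phi>' x < 0" for x using n0[of "g x"] by (simp add: \<phi>'_def)
  moreover have "0 < \<phi> x" for x by (simp add: \<phi>_def)
  ultimately show ?thesis using r0 d1 d2 c\<phi>' \<phi>0 lim0 lnlim
    by (intro exI[of _ r0] conjI exI[of _ \<phi>] exI[of _ \<phi>']) auto
qed

text \<open>A maximum principle without second derivatives. At an interior positive maximum of the
  difference the slopes agree, while the difference of the fluxes has positive derivative since the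
  right-hand side of the equation is strictly increasing in the solution. Just to the right the
  flux, hence the slope, of \<open>\<psi>\<close> is larger, and the difference would still
  grow.\<close>

lemma profile_solution_le:
  assumes p: "1 < p" "p < 2" and b: "0 < b"
    and sol: "profile_solution p b \<psi>" "profile_solution p b \<phi>" and x: "0 \<le> x"
  shows "\<psi> x \<le> \<phi> x"
proof (rule ccontr)
  assume neg: "\<not> \<psi> x \<le> \<phi> x"
  define d where "d y = \<psi> y - \<phi> y" for y
  obtain \<psi>' \<phi>' where
    \<psi>: "\<And>x. x > 0 \<Longrightarrow> (\<psi> has_real_derivative \<psi>' x) (at x)"
      "\<And>x. x > 0 \<Longrightarrow> ((\<lambda>y. plap_flux p (\<psi>' y)) has_real_derivative 1 / (2 - p) * \<psi> x + b * \<psi> x powr (p - 1)) (at x)" and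
    \<phi>: "\<And>x. x > 0 \<Longrightarrow> (\<phi> has_real_derivative \<phi>' x) (at x)"
      "\<And>x. x > 0 \<Longrightarrow> ((\<lambda>y. plap_flux p (\<phi>' y)) has_real_derivative 1 / (2 - p) * \<phi> x + b * \<phi> x powr (p - 1)) (at x)"
    using sol unfolding profile_solution_def by blast
  have \<phi>0: "\<And>x. x \<ge> 0 \<Longrightarrow> 0 \<le> \<phi> x" and d0: "d 0 = 0" and cd: "continuous_on {0..} d" and lim: "(d \<longlongrightarrow> 0) at_top"
    using sol tendsto_diff[of \<psi> 0 at_top \<phi> 0] unfolding profile_solution_def d_def by (auto intro: continuous_intros)
  have dx: "0 < d x" using neg by (simp add: d_def)
  \<comment> \<open>Decay at infinity keeps the maximum over [0, X] away from the right end, and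
    d(0) = 0 keeps it away from the left end.\<close>
  obtain Y where Y: "\<And>y. Y \<le> y \<Longrightarrow> d y < d x"
    using order_tendstoD(2)[OF lim dx] by (auto simp: eventually_at_top_linorder)
  define X where "X = max x Y"
  have X: "0 \<le> X" using x by (simp add: X_def le_max_iff_disj)
  have "continuous_on {0..X} d" by (rule continuous_on_subset[OF cd]) auto
  then obtain x0 where x0: "x0 \<in> {0..X}" and max: "\<And>y. y \<in> {0..X} \<Longrightarrow> d y \<le> d x0"
    using continuous_attains_sup[of "{0..X}" d] X by auto
  have dx0: "d x \<le> d x0" using max[of x] x by (simp add: X_def)
  have x0': "0 < x0" "x0 < X"
    using x0 dx0 dx d0 Y[of X] by (auto simp: less_le X_def)
  have "\<psi>' x0 - \<phi>' x0 = 0"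
  proof (rule DERIV_local_max[of d _ x0 "min x0 (X - x0)"])
    show "(d has_real_derivative \<psi>' x0 - \<phi>' x0) (at x0)" unfolding d_def by (intro DERIV_diff \<psi> \<phi> x0')
    show "\<forall>y. \<bar>x0 - y\<bar> < min x0 (X - x0) \<longrightarrow> d y \<le> d x0" by (intro allI impI max) auto
  qed (use x0' in auto)
  then have eq: "\<psi>' x0 = \<phi>' x0" by simp
  define E where "E y = plap_flux p (\<psi>' y) - plap_flux p (\<phi>' y)" for y
  define D where "D = (1 / (2 - p) * \<psi> x0 + b * \<psi> x0 powr (p - 1)) - (1 / (2 - p) * \<phi> x0 + b * \<phi> x0 powr (p - 1))"
  have "(E has_real_derivative D) (at x0)" unfolding E_def D_def by (intro DERIV_diff \<psi> \<phi> x0')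
  moreover have "0 < D"
  proof -
    have lt: "\<phi> x0 < \<psi> x0" using dx dx0 by (simp add: d_def)
    then have "\<phi> x0 powr (p - 1) < \<psi> x0 powr (p - 1)" using p \<phi>0 x0' by (intro powr_less_mono2) auto
    then have "b * \<phi> x0 powr (p - 1) < b * \<psi> x0 powr (p - 1)" using b by simp
    moreover have "1 / (2 - p) * \<phi> x0 < 1 / (2 - p) * \<psi> x0" using lt p by (intro mult_strict_left_mono) auto
    ultimately show ?thesis by (simp add: D_def)
  qed
  ultimately obtain e where e: "0 < e" "\<And>h. 0 < h \<Longrightarrow> h < e \<Longrightarrow> E x0 < E (x0 + h)"
    using DERIV_pos_inc_right by blast
  have inc: "\<phi>' y < \<psi>' y" if "x0 < y" "y < x0 + e" for y
  proof -
    have "E x0 < E y" using e(2)[of "y - x0"] that by simp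
    then have "plap_flux p (\<phi>' y) < plap_flux p (\<psi>' y)" by (simp add: E_def eq)
    then show ?thesis using plap_flux_mono[OF p(1), of "\<psi>' y" "\<phi>' y"] by (cases "\<phi>' y" "\<psi>' y" rule: linorder_cases) auto
  qed
  define h where "h = min (e / 2) (X - x0)"
  have h: "0 < h" "x0 + h \<le> X" "h < e" using e x0' by (auto simp: h_def)
  have "d x0 < d (x0 + h)"
  proof (rule DERIV_pos_imp_increasing_open[where f = d and a = x0 and b = "x0 + h"])
    show "x0 < x0 + h" using h by simp
    show "continuous_on {x0..x0 + h} d" by (rule continuous_on_subset[OF cd]) (use x0' in auto)
    show "\<exists>y. (d has_real_derivative y) (at x) \<and> 0 < y" if "x0 < x" "x < x0 + h" for x
      using that inc[of x] h x0' by (intro exI[of _ "\<psi>' x - \<phi>' x"]) (auto simp: d_def[abs_def] intro!: DERIV_diff \<psi> \<phi>)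
  qed
  moreover have "d (x0 + h) \<le> d x0" using h x0' by (intro max) auto
  ultimately show False by simp
qed

section \<open>Separable barriers\<close>

lemma plap_flux_mult: "0 < c \<Longrightarrow> plap_flux p (c * s) = c powr (p - 1) * plap_flux p s"
  by (simp add: plap_flux_eq abs_mult powr_mult sgn_mult)

lemma continuous_weak_solution_continuous:
  assumes "continuous_weak_solution p b \<beta> T u0 u" "ereal T' \<le> T"
  shows "continuous_on (S \<times> {0..T'}) (\<lambda>z. u (fst z) (snd z))"
proof -
  have "continuous_on (UNIV \<times> time_dom T) (\<lambda>z. u (fst z) (snd z))"
    using assms by (simp add: continuous_weak_solution_def case_prod_beta')
  then show ?thesis by (rule continuous_on_subset) (use assms(2) time_domI[of _ T' T] in auto)
qed

lemma continuous_weak_solution_nonneg: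
  assumes "continuous_weak_solution p b \<beta> T u0 u" "ereal T' \<le> T" "t \<in> {0..T'}"
  shows "0 \<le> u x t"
  using assms time_domI[of t T' T] by (auto simp: continuous_weak_solution_def weak_solution_def)

text \<open>The constant \<open>M\<close> is invisible to the time derivative and to the flux and
  enters only through the absorption. The solution is considered on an interval longer by 1 at each
  end, which is the room the mollification requires.\<close>

lemma separable_upper_comparison:
  assumes p: "1 < p" "p < 2" and b: "0 < b" and sol: "continuous_weak_solution p b (p - 1) T u0 u"
    and ord: "a < c" "0 < \<tau>" "\<tau> < T'" "ereal T' \<le> T"
    and f: "\<And>x. x \<in> {a..c} \<Longrightarrow> (f has_real_derivative f' x) (at x within {a..c})"
    and F: "\<And>x. x \<in> {a..c} \<Longrightarrow> ((\<lambda>y. plap_flux p (f' y)) has_real_derivative F x) (at x within {a..c})"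
    and cf: "continuous_on {a..c} f'" "continuous_on {a..c} F"
    and G: "\<And>t. t \<in> {0<..\<tau>} \<Longrightarrow> (G has_real_derivative G' t) (at t within {0<..\<tau>})" "\<And>t. t \<in> {0<..\<tau>} \<Longrightarrow> 0 < G t"
    and cG: "continuous_on {0..\<tau>} G" "continuous_on {0<..\<tau>} G'"
    and nonneg: "\<And>x t. x \<in> {a..c} \<Longrightarrow> t \<in> {0<..\<tau>} \<Longrightarrow> 0 \<le> M + G t * f x"
    and super: "\<And>x t. x \<in> {a..c} \<Longrightarrow> t \<in> {0<..\<tau>} \<Longrightarrow>
        G t powr (p - 1) * F x \<le> G' t * f x + b * (M + G t * f x) powr (p - 1)"
    and init: "\<And>x. x \<in> {a..c} \<Longrightarrow> u x 0 \<le> M + G 0 * f x"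
    and lateral: "\<And>t. t \<in> {0..\<tau>} \<Longrightarrow> u a t \<le> M + G t * f a \<and> u c t \<le> M + G t * f c"
    and xt: "x \<in> {a..c}" "t \<in> {0..\<tau>}"
  shows "u x t \<le> M + G t * f x"
proof -
  have cu: "continuous_on ({a - 1..c + 1} \<times> {0..T'}) (\<lambda>z. u (fst z) (snd z))"
    by (rule continuous_weak_solution_continuous[OF sol ord(4)])
  have u0: "0 \<le> u x t" if "t \<in> {0..T'}" for x t by (rule continuous_weak_solution_nonneg[OF sol ord(4) that])
  have cc: "continuous_on (A \<times> B) (\<lambda>z. h (fst z))" if "continuous_on A h" for A B and h :: "real \<Rightarrow> real"
    by (rule continuous_on_compose2[OF that]) (auto intro: continuous_intros)
  have cc': "continuous_on (A \<times> B) (\<lambda>z. h (snd z))" if "continuous_on B h" for A B and h :: "real \<Rightarrow> real"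
    by (rule continuous_on_compose2[OF that]) (auto intro: continuous_intros)
  have fc: "continuous_on {a..c} f" using f by (meson DERIV_continuous continuous_on_eq_continuous_within)
  have cGs: "continuous_on {0<..\<tau>} G" by (rule continuous_on_subset[OF cG(1)]) auto
  have "(\<lambda>z. u (fst z) (snd z)) (x, t) \<le> (\<lambda>z. M + G (snd z) * f (fst z)) (x, t)"
  proof (rule comparison[OF p, where X = "a - 1" and Y = "c + 1" and a = a and c = c and \<tau> = \<tau> and T' = T'
        and q = "\<lambda>z. b * u (fst z) (snd z) powr (p - 1)" and d = "\<lambda>z. b * (M + G (snd z) * f (fst z)) powr (p - 1)"
        and Wx = "\<lambda>z. G (snd z) * f' (fst z)" and Wt = "\<lambda>z. G' (snd z) * f (fst z)"
        and Fx = "\<lambda>z. G (snd z) powr (p - 1) * F (fst z)"])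
    show "continuous_on ({a - 1..c + 1} \<times> {0..T'}) (\<lambda>z. b * u (fst z) (snd z) powr (p - 1))"
      using u0 p by (intro continuous_intros cu continuous_on_powr') auto
    show "\<exists>g. mollified_solution p (a - 1) (c + 1) t0 T' (\<lambda>z. indicator ({a - 1..c + 1} \<times> {t0..T'}) z * u (fst z) (snd z)) g
          (\<lambda>z. indicator ({a - 1..c + 1} \<times> {t0..T'}) z * (b * u (fst z) (snd z) powr (p - 1)))"
      if "0 < t0" "t0 < T'" for t0
      using continuous_weak_solution_mollified[OF p(1) refl sol that ord(4)] .
    show "continuous_on ({a..c} \<times> {0..\<tau>}) (\<lambda>z. M + G (snd z) * f (fst z))"
      by (intro continuous_intros cc[OF fc] cc'[OF cG(1)])
    show "continuous_on ({a..c} \<times> {0<..\<tau>}) (\<lambda>z. G (snd z) * f' (fst z))"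
      by (intro continuous_intros cc[OF cf(1)] cc'[OF cGs])
    show "continuous_on ({a..c} \<times> {0<..\<tau>}) (\<lambda>z. G' (snd z) * f (fst z))"
      by (intro continuous_intros cc[OF fc] cc'[OF cG(2)])
    show "continuous_on ({a..c} \<times> {0<..\<tau>}) (\<lambda>z. G (snd z) powr (p - 1) * F (fst z))"
      using G(2) by (intro continuous_intros cc[OF cf(2)] cc'[OF cGs]) (auto simp: less_imp_neq[symmetric])
    fix y s assume y: "y \<in> {a..c}" and s: "s \<in> {0<..\<tau>}"
    show "((\<lambda>y. M + G (snd (y, s)) * f (fst (y, s))) has_real_derivative G (snd (y, s)) * f' (fst (y, s))) (at y within {a..c})"
      using f[OF y] by (auto intro!: derivative_eq_intros)
    show "((\<lambda>s. M + G (snd (y, s)) * f (fst (y, s))) has_real_derivative G' (snd (y, s)) * f (fst (y, s))) (at s within {0<..\<tau>})"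
      using G(1)[OF s] by (auto intro!: derivative_eq_intros)
    show "((\<lambda>y. plap_flux p (G (snd (y, s)) * f' (fst (y, s)))) has_real_derivative
        G (snd (y, s)) powr (p - 1) * F (fst (y, s))) (at y within {a..c})"
      using DERIV_cmult[OF F[OF y], of "G s powr (p - 1)"] by (simp add: plap_flux_mult[OF G(2)[OF s]])
  next
    fix z assume z: "z \<in> {a..c} \<times> {0<..\<tau>}"
    show "G (snd z) powr (p - 1) * F (fst z) - b * (M + G (snd z) * f (fst z)) powr (p - 1) \<le> G' (snd z) * f (fst z)"
      using super[of "fst z" "snd z"] z by auto
    show "b * (M + G (snd z) * f (fst z)) powr (p - 1) \<le> b * u (fst z) (snd z) powr (p - 1)"
      if "M + G (snd z) * f (fst z) < u (fst z) (snd z)"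
      using that nonneg[of "fst z" "snd z"] z b p by (intro mult_left_mono powr_mono2) auto
  qed (use ord cu init lateral xt in auto)
  then show ?thesis by simp
qed

text \<open>The flux is odd, so \<open>- u\<close> solves an equation of the same form with
  absorption of the opposite sign, and the comparison theorem applies to the negatives.\<close>

lemma separable_lower_comparison:
  assumes p: "1 < p" "p < 2" and b: "0 < b" and sol: "continuous_weak_solution p b (p - 1) T u0 u"
    and ord: "a < c" "0 < \<tau>" "\<tau> < T'" "ereal T' \<le> T"
    and f: "\<And>x. x \<in> {a..c} \<Longrightarrow> (f has_real_derivative f' x) (at x within {a..c})"
    and F: "\<And>x. x \<in> {a..c} \<Longrightarrow> ((\<lambda>y. plap_flux p (f' y)) has_real_derivative F x) (at x within {a..c})"
    and cf: "continuous_on {a..c} f'" "continuous_on {a..c} F"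
    and G: "\<And>t. t \<in> {0<..\<tau>} \<Longrightarrow> (G has_real_derivative G' t) (at t within {0<..\<tau>})" "\<And>t. t \<in> {0<..\<tau>} \<Longrightarrow> 0 < G t"
    and cG: "continuous_on {0..\<tau>} G" "continuous_on {0<..\<tau>} G'"
    and sub: "\<And>x t. x \<in> {a..c} \<Longrightarrow> t \<in> {0<..\<tau>} \<Longrightarrow>
        G' t * f x + b * (G t * f x) powr (p - 1) \<le> G t powr (p - 1) * F x"
    and init: "\<And>x. x \<in> {a..c} \<Longrightarrow> G 0 * f x \<le> u x 0"
    and lateral: "\<And>t. t \<in> {0..\<tau>} \<Longrightarrow> G t * f a \<le> u a t \<and> G t * f c \<le> u c t"
    and xt: "x \<in> {a..c}" "t \<in> {0..\<tau>}"
  shows "G t * f x \<le> u x t"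
proof -
  have cu: "continuous_on ({a - 1..c + 1} \<times> {0..T'}) (\<lambda>z. u (fst z) (snd z))"
    by (rule continuous_weak_solution_continuous[OF sol ord(4)])
  have u0: "0 \<le> u x t" if "t \<in> {0..T'}" for x t by (rule continuous_weak_solution_nonneg[OF sol ord(4) that])
  have cc: "continuous_on (A \<times> B) (\<lambda>z. h (fst z))" if "continuous_on A h" for A B and h :: "real \<Rightarrow> real"
    by (rule continuous_on_compose2[OF that]) (auto intro: continuous_intros)
  have cc': "continuous_on (A \<times> B) (\<lambda>z. h (snd z))" if "continuous_on B h" for A B and h :: "real \<Rightarrow> real"
    by (rule continuous_on_compose2[OF that]) (auto intro: continuous_intros)
  have fc: "continuous_on {a..c} f" using f by (meson DERIV_continuous continuous_on_eq_continuous_within)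
  have cGs: "continuous_on {0<..\<tau>} G" by (rule continuous_on_subset[OF cG(1)]) auto
  have "(\<lambda>z. - u (fst z) (snd z)) (x, t) \<le> (\<lambda>z. - (G (snd z) * f (fst z))) (x, t)"
  proof (rule comparison[OF p, where X = "a - 1" and Y = "c + 1" and a = a and c = c and \<tau> = \<tau> and T' = T'
        and q = "\<lambda>z. - (b * u (fst z) (snd z) powr (p - 1))" and d = "\<lambda>z. - (b * (G (snd z) * f (fst z)) powr (p - 1))"
        and Wx = "\<lambda>z. - (G (snd z) * f' (fst z))" and Wt = "\<lambda>z. - (G' (snd z) * f (fst z))"
        and Fx = "\<lambda>z. - (G (snd z) powr (p - 1) * F (fst z))"])
    show "continuous_on ({a - 1..c + 1} \<times> {0..T'}) (\<lambda>z. - u (fst z) (snd z))" by (intro continuous_intros cu)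
    show "continuous_on ({a - 1..c + 1} \<times> {0..T'}) (\<lambda>z. - (b * u (fst z) (snd z) powr (p - 1)))"
      using u0 p by (intro continuous_intros cu continuous_on_powr') auto
    show "\<exists>g. mollified_solution p (a - 1) (c + 1) t0 T' (\<lambda>z. indicator ({a - 1..c + 1} \<times> {t0..T'}) z * (- u (fst z) (snd z))) g
          (\<lambda>z. indicator ({a - 1..c + 1} \<times> {t0..T'}) z * (- (b * u (fst z) (snd z) powr (p - 1))))"
      if "0 < t0" "t0 < T'" for t0
      using continuous_weak_solution_mollified[OF p(1) refl sol that ord(4), of "a - 1" "c + 1"]
      unfolding mult_minus_right by (blast dest: mollified_solution_uminus)
    show "continuous_on ({a..c} \<times> {0..\<tau>}) (\<lambda>z. - (G (snd z) * f (fst z)))"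
      by (intro continuous_intros cc[OF fc] cc'[OF cG(1)])
    show "continuous_on ({a..c} \<times> {0<..\<tau>}) (\<lambda>z. - (G (snd z) * f' (fst z)))"
      by (intro continuous_intros cc[OF cf(1)] cc'[OF cGs])
    show "continuous_on ({a..c} \<times> {0<..\<tau>}) (\<lambda>z. - (G' (snd z) * f (fst z)))"
      by (intro continuous_intros cc[OF fc] cc'[OF cG(2)])
    show "continuous_on ({a..c} \<times> {0<..\<tau>}) (\<lambda>z. - (G (snd z) powr (p - 1) * F (fst z)))"
      using G(2) by (intro continuous_intros cc[OF cf(2)] cc'[OF cGs]) (auto simp: less_imp_neq[symmetric])
    fix y s assume y: "y \<in> {a..c}" and s: "s \<in> {0<..\<tau>}"
    show "((\<lambda>y. - (G (snd (y, s)) * f (fst (y, s)))) has_real_derivative - (G (snd (y, s)) * f' (fst (y, s)))) (at y within {a..c})"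
      using f[OF y] by (auto intro!: derivative_eq_intros)
    show "((\<lambda>s. - (G (snd (y, s)) * f (fst (y, s)))) has_real_derivative - (G' (snd (y, s)) * f (fst (y, s)))) (at s within {0<..\<tau>})"
      using G(1)[OF s] by (auto intro!: derivative_eq_intros)
    show "((\<lambda>y. plap_flux p (- (G (snd (y, s)) * f' (fst (y, s))))) has_real_derivative
        - (G (snd (y, s)) powr (p - 1) * F (fst (y, s)))) (at y within {a..c})"
      using DERIV_minus[OF DERIV_cmult[OF F[OF y], of "G s powr (p - 1)"]] by (simp add: plap_flux_mult[OF G(2)[OF s]])
  next
    fix z assume z: "z \<in> {a..c} \<times> {0<..\<tau>}"
    show "- (G (snd z) powr (p - 1) * F (fst z)) - - (b * (G (snd z) * f (fst z)) powr (p - 1)) \<le> - (G' (snd z) * f (fst z))"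
      using sub[of "fst z" "snd z"] z by auto
    \<comment> \<open>Where the barrier exceeds \<open>u\<close> it is positive along with being
      larger, since u \<ge> 0; so the power is compared at nonnegative arguments only.\<close>
    show "- (b * (G (snd z) * f (fst z)) powr (p - 1)) \<le> - (b * u (fst z) (snd z) powr (p - 1))"
      if "- (G (snd z) * f (fst z)) < - u (fst z) (snd z)"
      using that u0[of "snd z" "fst z"] z ord b p by (auto intro!: mult_left_mono powr_mono2)
  qed (use ord init lateral xt in auto)
  then show ?thesis by simp
qed

lemma abs_powr_deriv:
  fixes x q :: real
  assumes q: "1 < q"
  shows "((\<lambda>x. \<bar>x\<bar> powr q) has_real_derivative q * (sgn x * \<bar>x\<bar> powr (q - 1))) (at x)"
proof -
  consider "x > 0" | "x < 0" | "x = 0" by linarith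
  then show ?thesis
  proof cases
    case 1
    have "((\<lambda>x. x powr q) has_real_derivative q * x powr (q - 1)) (at x)"
      using 1 by (rule has_real_derivative_powr)
    moreover have "\<forall>\<^sub>F y in nhds x. y powr q = \<bar>y\<bar> powr q"
      using eventually_nhds_in_open[of "{0<..}" x] 1 by (auto elim!: eventually_mono)
    ultimately show ?thesis
      using 1 by (subst DERIV_cong_ev[OF refl _ refl, symmetric]) auto
  next
    case 2
    have "((\<lambda>x. (- x) powr q) has_real_derivative q * (- x) powr (q - 1) * (-1)) (at x)"
      by (rule DERIV_chain2[OF has_real_derivative_powr]) (use 2 in \<open>auto intro!: derivative_eq_intros\<close>)
    moreover have "\<forall>\<^sub>F y in nhds x. (- y) powr q = \<bar>y\<bar> powr q"
      using eventually_nhds_in_open[of "{..<0}" x] 2 by (auto elim!: eventually_mono)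
    ultimately show ?thesis
      using 2 by (subst DERIV_cong_ev[OF refl _ refl, symmetric]) auto
  next
    case 3
    have "((\<lambda>h. \<bar>h\<bar> powr (q - 1)) \<longlongrightarrow> \<bar>0\<bar> powr (q - 1)) (at (0::real))"
      using q by (intro tendsto_intros) auto
    then have lim: "((\<lambda>h. \<bar>h\<bar> powr (q - 1)) \<longlongrightarrow> 0) (at (0::real))" by simp
    have "(\<lambda>h. \<bar>h\<bar> powr q / h) \<midarrow>0\<rightarrow> (0::real)"
    proof (rule Lim_null_comparison[OF _ lim])
      show "\<forall>\<^sub>F h in at 0. norm (\<bar>h\<bar> powr q / h) \<le> \<bar>h\<bar> powr (q - 1)"
        unfolding eventually_at_filter
        by (intro always_eventually allI impI) (simp add: abs_divide powr_diff)
    qed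
    then show ?thesis unfolding 3 DERIV_def using q by simp
  qed
qed

section \<open>Bounds on the half line\<close>

text \<open>The exponent \<theta> = 1 / (2 - p) satisfies \<theta> - 1 = \<theta> (p - 1), so the
  derivative of the time factor is a multiple of its own power p - 1, the degree of homogeneity of
  the flux.\<close>

lemma time_factor_deriv:
  fixes e t :: real
  assumes p: "1 < p" "p < 2" and "0 < t + e"
  shows "((\<lambda>t. (t + e) powr (1 / (2 - p))) has_real_derivative
      1 / (2 - p) * ((t + e) powr (1 / (2 - p))) powr (p - 1)) (at t within S)"
proof -
  have "((\<lambda>t. (t + e) powr (1 / (2 - p))) has_real_derivative
      1 / (2 - p) * (t + e) powr (1 / (2 - p) - real 1) * 1) (at t)"
    using DERIV_fun_powr[of "\<lambda>t. t + e" 1 t "1 / (2 - p)"] assms by (auto intro!: derivative_eq_intros)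
  moreover have "1 / (2 - p) - 1 = 1 / (2 - p) * (p - 1)" using p by (simp add: field_simps)
  ultimately show ?thesis by (simp add: powr_powr has_field_derivative_at_within)
qed

lemma time_factor_continuous:
  fixes e \<theta> :: real
  assumes "0 < \<theta>" "0 \<le> e"
  shows "continuous_on {0..\<tau>} (\<lambda>t. (t + e) powr \<theta>)"
  using assms by (intro continuous_on_powr' continuous_intros) auto

text \<open>Since \<open>p < 2\<close>, the exponent \<open>m = p / (2 - p)\<close> and the right constant give a solution of
  \<open>(plap_flux p f')' = f / (2 - p)\<close> that blows up at a finite point.\<close>

lemma blow_up_profile:
  fixes p :: real
  assumes p: "1 < p" "p < 2"
  shows "\<exists>A>0. \<exists>m>0. \<forall>k x. x < k \<longrightarrow>
    ((\<lambda>x. A * (k - x) powr (- m)) has_real_derivative A * m * (k - x) powr (- m - 1)) (at x) \<and>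
    ((\<lambda>x. plap_flux p (A * m * (k - x) powr (- m - 1))) has_real_derivative
        1 / (2 - p) * (A * (k - x) powr (- m))) (at x)"
proof -
  \<comment> \<open>The flux of A (k - x)^(-m) has exponent -(m + 1)(p - 1), and its derivative has
    exponent -m exactly for this \<open>m\<close>. Matching the coefficients gives A^(2-p) = (2 - p)
    S.\<close>
  define m where "m = p / (2 - p)"
  define S where "S = m powr (p - 1) * ((m + 1) * (p - 1))"
  define A where "A = ((2 - p) * S) powr (1 / (2 - p))"
  have m: "0 < m" using p by (simp add: m_def)
  have S: "0 < S" using m p by (simp add: S_def)
  have A: "0 < A" using S p by (simp add: A_def)
  have A2: "A powr (2 - p) = (2 - p) * S" using S p by (simp add: A_def powr_powr)
  have expo: "(- m - 1) * (p - 1) - 1 = - m" using p by (simp add: m_def field_simps)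
  have key: "(A * m) powr (p - 1) * ((m + 1) * (p - 1)) = 1 / (2 - p) * A"
  proof -
    have "(A * m) powr (p - 1) * ((m + 1) * (p - 1)) = A powr (p - 1) * S"
      using A m by (simp add: powr_mult S_def)
    also have "\<dots> = A powr (p - 1) * (A powr (2 - p) / (2 - p))" using p by (simp add: A2)
    also have "\<dots> = A powr (p - 1) * A powr (2 - p) / (2 - p)" by simp
    also have "A powr (p - 1) * A powr (2 - p) = A" using A by (simp flip: powr_add)
    finally show ?thesis by simp
  qed
  have dpow: "((\<lambda>x. (k - x) powr s) has_real_derivative - s * (k - x) powr (s - 1)) (at x)"
    if "x < k" for k x s :: real
    using DERIV_fun_powr[of "\<lambda>x. k - x" "-1" x s] that by (auto intro!: derivative_eq_intros)
  have d1: "((\<lambda>x. A * (k - x) powr (- m)) has_real_derivative A * m * (k - x) powr (- m - 1)) (at x)"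
    if "x < k" for k x
    using DERIV_cmult[OF dpow[OF that, of "- m"], of A] by (simp add: mult.assoc)
  have d2: "((\<lambda>x. plap_flux p (A * m * (k - x) powr (- m - 1))) has_real_derivative
        1 / (2 - p) * (A * (k - x) powr (- m))) (at x)" if x: "x < k" for k x
  proof -
    have ev: "\<forall>\<^sub>F y in nhds x. (A * m) powr (p - 1) * (k - y) powr ((- m - 1) * (p - 1)) = plap_flux p (A * m * (k - y) powr (- m - 1))"
    proof (rule eventually_mono[OF eventually_nhds_in_open[OF open_lessThan[of k] x[folded lessThan_iff]]])
      fix y assume "y \<in> {..<k}"
      then have "0 < A * m * (k - y) powr (- m - 1)" using A m by simp
      then have "plap_flux p (A * m * (k - y) powr (- m - 1)) = (A * m * (k - y) powr (- m - 1)) powr (p - 1)"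
        by (simp add: plap_flux_eq)
      also have "\<dots> = (A * m) powr (p - 1) * (k - y) powr ((- m - 1) * (p - 1))"
        using A m by (simp add: powr_mult powr_powr)
      finally show "(A * m) powr (p - 1) * (k - y) powr ((- m - 1) * (p - 1)) = plap_flux p (A * m * (k - y) powr (- m - 1))" ..
    qed
    have "((\<lambda>y. (A * m) powr (p - 1) * (k - y) powr ((- m - 1) * (p - 1))) has_real_derivative
        (A * m) powr (p - 1) * (- ((- m - 1) * (p - 1)) * (k - x) powr ((- m - 1) * (p - 1) - 1))) (at x)"
      by (rule DERIV_cmult[OF dpow[OF x]])
    also have "(A * m) powr (p - 1) * (- ((- m - 1) * (p - 1)) * (k - x) powr ((- m - 1) * (p - 1) - 1)) =
        ((A * m) powr (p - 1) * ((m + 1) * (p - 1))) * (k - x) powr (- m)"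
      unfolding expo by (simp add: algebra_simps)
    also have "\<dots> = 1 / (2 - p) * (A * (k - x) powr (- m))" unfolding key by simp
    finally show ?thesis
      using DERIV_cong_ev[OF refl ev refl] by blast
  qed
  show ?thesis using A m d1 d2 by blast
qed

text \<open>The barrier M + G(t) A (k - x)^(-m) becomes infinite at \<open>k\<close>, so at the
  right end it beats whatever bound \<open>u\<close> has on a compact rectangle. For fixed
  \<open>x\<close> and \<open>t\<close> its excess over \<open>M\<close> vanishes as
  \<open>k\<close> tends to infinity.\<close>

lemma half_line_bound:
  assumes p: "1 < p" "p < 2" and b: "0 < b" and sol: "continuous_weak_solution p b (p - 1) T u0 u"
    and ord: "0 < \<tau>" "\<tau> < T'" "ereal T' \<le> T"
    and init: "\<And>x. 0 \<le> x \<Longrightarrow> u x 0 = 0" and lateral: "\<And>t. t \<in> {0..\<tau>} \<Longrightarrow> u 0 t \<le> M" and M: "0 \<le> M"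
    and xt: "0 \<le> x" "t \<in> {0..\<tau>}"
  shows "u x t \<le> M"
proof -
  obtain A m :: real where Am: "0 < A" "0 < m"
    and d1: "\<And>k x. x < k \<Longrightarrow> ((\<lambda>x. A * (k - x) powr (- m)) has_real_derivative A * m * (k - x) powr (- m - 1)) (at x)"
    and d2: "\<And>k x. x < k \<Longrightarrow> ((\<lambda>x. plap_flux p (A * m * (k - x) powr (- m - 1))) has_real_derivative
        1 / (2 - p) * (A * (k - x) powr (- m))) (at x)"
    using blow_up_profile[OF p] by blast
  define \<theta> where "\<theta> = 1 / (2 - p)"
  have \<theta>: "0 < \<theta>" using p by (simp add: \<theta>_def)
  define G where "G t = (t + 1) powr \<theta>" for t :: real
  have bnd: "u x t \<le> M + G t * (A * (k - x) powr (- m))" if k: "x < k" for k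
  proof -
    have "continuous_on ({0..k} \<times> {0..T'}) (\<lambda>z. u (fst z) (snd z))"
      by (rule continuous_weak_solution_continuous[OF sol ord(3)])
    then have "bounded ((\<lambda>z. u (fst z) (snd z)) ` ({0..k} \<times> {0..T'}))"
      by (intro compact_imp_bounded compact_continuous_image compact_Times compact_Icc)
    then obtain B where "\<And>z. z \<in> {0..k} \<times> {0..T'} \<Longrightarrow> norm (u (fst z) (snd z)) \<le> B"
      unfolding bounded_iff by blast
    then have B: "u y s \<le> \<bar>B\<bar> + 1" if "y \<in> {0..k}" "s \<in> {0..T'}" for y s
      using that by (force simp: abs_le_iff)
    \<comment> \<open>The distance to \<open>k\<close> at which the spatial barrier equals
      \<bar>B\<bar> + 1, a bound for \<open>u\<close> on the rectangle. The comparison stops at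
      distance \<open>h\<close>, no larger than this and small enough to leave \<open>x\<close>
      inside.\<close>
    define c0 where "c0 = ((\<bar>B\<bar> + 1) / A) powr (- 1 / m)"
    have c0: "0 < c0" "A * c0 powr (- m) = \<bar>B\<bar> + 1"
      using Am by (auto simp: c0_def powr_powr)
    define h where "h = min c0 ((k - x) / 2)"
    have h: "0 < h" "h \<le> c0" "x < k - h" using c0 k by (auto simp: h_def min_def field_simps)
    have xk: "0 < k - h" using h xt by simp
    have G1: "1 \<le> G s" if "0 \<le> s" for s using that \<theta> by (simp add: G_def ge_one_powr_ge_zero)
    have "u x t \<le> M + G t * (A * (k - x) powr (- m))"
    proof (rule separable_upper_comparison[OF p b sol xk ord, where f = "\<lambda>x. A * (k - x) powr (- m)"
          and f' = "\<lambda>x. A * m * (k - x) powr (- m - 1)" and F = "\<lambda>x. \<theta> * (A * (k - x) powr (- m))"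
          and G = G and G' = "\<lambda>t. \<theta> * G t powr (p - 1)"])
      fix y assume y: "y \<in> {0..k - h}"
      then have yk: "y < k" using h by auto
      show "((\<lambda>x. A * (k - x) powr (- m)) has_real_derivative A * m * (k - y) powr (- m - 1)) (at y within {0..k - h})"
        by (rule has_field_derivative_at_within[OF d1[OF yk]])
      show "((\<lambda>y. plap_flux p (A * m * (k - y) powr (- m - 1))) has_real_derivative \<theta> * (A * (k - y) powr (- m))) (at y within {0..k - h})"
        using has_field_derivative_at_within[OF d2[OF yk]] by (simp add: \<theta>_def)
      show "u y 0 \<le> M + G 0 * (A * (k - y) powr (- m))"
        using init[of y] y M G1[of 0] Am by (simp add: add_nonneg_nonneg)
      fix s assume s: "s \<in> {0<..\<tau>}"
      show "0 \<le> M + G s * (A * (k - y) powr (- m))"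
        using M G1[of s] s Am by (simp add: add_nonneg_nonneg)
      \<comment> \<open>Time derivative and flux derivative cancel exactly; the absorption is the
        slack.\<close>
      show "G s powr (p - 1) * (\<theta> * (A * (k - y) powr (- m)))
         \<le> \<theta> * G s powr (p - 1) * (A * (k - y) powr (- m)) + b * (M + G s * (A * (k - y) powr (- m))) powr (p - 1)"
        using b by simp
    next
      fix s assume s: "s \<in> {0<..\<tau>}"
      show "(G has_real_derivative \<theta> * G s powr (p - 1)) (at s within {0<..\<tau>})"
        unfolding G_def[abs_def] \<theta>_def by (rule time_factor_deriv[OF p]) (use s in auto)
      show "0 < G s" using G1[of s] s by simp
    next
      fix s assume s: "s \<in> {0..\<tau>}"
      have "u 0 s \<le> M + G s * (A * (k - 0) powr (- m))"
        using lateral[OF s] G1[of s] s Am by (simp add: add_increasing2)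
      moreover have "u (k - h) s \<le> M + G s * (A * (k - (k - h)) powr (- m))"
      proof -
        have "\<bar>B\<bar> + 1 \<le> A * h powr (- m)"
          unfolding c0(2)[symmetric] using h Am by (intro mult_left_mono powr_mono2') auto
        also have "\<dots> \<le> G s * (A * h powr (- m))"
          using mult_right_mono[OF G1[of s], of "A * h powr (- m)"] s Am by simp
        finally show ?thesis using B[of "k - h" s] s ord h xk M by auto
      qed
      ultimately show "u 0 s \<le> M + G s * (A * (k - 0) powr (- m)) \<and> u (k - h) s \<le> M + G s * (A * (k - (k - h)) powr (- m))" ..
    next
      show "continuous_on {0..\<tau>} G" unfolding G_def[abs_def] by (rule time_factor_continuous) (use \<theta> in auto)
      then have "continuous_on {0<..\<tau>} G" by (rule continuous_on_subset) auto
      then show "continuous_on {0<..\<tau>} (\<lambda>t. \<theta> * G t powr (p - 1))"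
        by (intro continuous_intros) (auto simp: G_def)
      show "continuous_on {0..k - h} (\<lambda>x. A * m * (k - x) powr (- m - 1))"
        "continuous_on {0..k - h} (\<lambda>x. \<theta> * (A * (k - x) powr (- m)))"
        by (intro continuous_intros; use h in force)+
    qed (use xt h in auto)
    then show ?thesis .
  qed
  have "((\<lambda>k. M + G t * (A * (k - x) powr (- m))) \<longlongrightarrow> M + G t * (A * 0)) at_top"
  proof -
    have "filterlim (\<lambda>k. k - x) at_top at_top"
      using filterlim_tendsto_add_at_top[OF tendsto_const filterlim_ident, of "- x"] by simp
    from tendsto_neg_powr[OF _ this, of "- m"] have "((\<lambda>k. (k - x) powr (- m)) \<longlongrightarrow> 0) at_top" using Am by simp
    then show ?thesis by (intro tendsto_intros)
  qed
  then show ?thesis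
    using bnd by (intro tendsto_lowerbound[of _ M at_top "u x t"]) (auto intro: eventually_mono[OF eventually_gt_at_top[of x]])
qed

text \<open>The stationary barrier \<open>\<eta> + A |x - x0|\<^sup>q\<close>, \<open>q = p / (p - 1)\<close>, has constant flux derivative, which the
  absorption term at level \<open>\<eta>\<close> dominates.\<close>

lemma uniform_decay:
  assumes p: "1 < p" "p < 2" and b: "0 < b" and sol: "continuous_weak_solution p b (p - 1) T u0 u"
    and ord: "0 < \<tau>" "\<tau> < T'" "ereal T' \<le> T"
    and init: "\<And>x. 0 \<le> x \<Longrightarrow> u x 0 = 0" and bound: "\<And>x t. 0 \<le> x \<Longrightarrow> t \<in> {0..\<tau>} \<Longrightarrow> u x t \<le> M"
    and M: "0 < M" and \<eta>: "0 < \<eta>"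
  shows "\<exists>R>0. \<forall>x\<ge>R. \<forall>t\<in>{0..\<tau>}. u x t \<le> \<eta>"
proof -
  define q where "q = p / (p - 1)"
  have q: "1 < q" "(q - 1) * (p - 1) = 1" using p by (auto simp: q_def field_simps)
  \<comment> \<open>Chosen so that the constant flux derivative of the barrier,
    \<open>(A * q) powr (p - 1)\<close>, equals the absorption at level
    \<open>\<eta>\<close>.\<close>
  define A where "A = b powr (1 / (p - 1)) * \<eta> / q"
  have A: "0 < A" using b \<eta> q by (simp add: A_def)
  have Aq: "(A * q) powr (p - 1) = b * \<eta> powr (p - 1)"
    using b \<eta> q p by (simp add: A_def powr_mult powr_powr)
  \<comment> \<open>At distance \<open>R\<close> from its centre the barrier has risen by
    \<open>M\<close>, the known bound for \<open>u\<close>. Every point beyond \<open>R\<close> is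
    the centre of such an interval inside the half line, and at the centre the barrier is just
    \<open>\<eta>\<close>.\<close>
  define R where "R = (M / A) powr (1 / q)"
  have R: "0 < R" "A * R powr q = M" using M A q by (auto simp: R_def powr_powr)
  have "u x t \<le> \<eta>" if x: "R \<le> x" and t: "t \<in> {0..\<tau>}" for x t
  proof -
    define f where "f y = \<eta> + A * \<bar>y - x\<bar> powr q" for y
    define f' where "f' y = A * (q * (sgn (y - x) * \<bar>y - x\<bar> powr (q - 1)))" for y
    have f0: "\<eta> \<le> f y" for y using A by (simp add: f_def)
    have flux: "plap_flux p (f' y) = b * \<eta> powr (p - 1) * (y - x)" for y
    proof -
      have "f' y = (A * q) * (sgn (y - x) * \<bar>y - x\<bar> powr (q - 1))" by (simp add: f'_def)
      also have "plap_flux p \<dots> = b * \<eta> powr (p - 1) * plap_flux p (sgn (y - x) * \<bar>y - x\<bar> powr (q - 1))"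
        using A q by (subst plap_flux_mult) (simp_all add: Aq)
      also have "plap_flux p (sgn (y - x) * \<bar>y - x\<bar> powr (q - 1)) = y - x"
        by (cases "y = x") (auto simp: plap_flux_eq sgn_mult abs_mult powr_powr q sgn_mult_abs powr_mult)
      finally show ?thesis .
    qed
    have "u x t \<le> 0 + 1 * f x"
    proof (rule separable_upper_comparison[OF p b sol _ ord, where f = f and f' = f' and F = "\<lambda>_. b * \<eta> powr (p - 1)"
          and G = "\<lambda>_. 1" and G' = "\<lambda>_. 0" and a = "x - R" and c = "x + R"])
      fix y assume y: "y \<in> {x - R..x + R}"
      have "((\<lambda>y. y - x) has_real_derivative 1) (at y)" by (auto intro!: derivative_eq_intros)
      from DERIV_chain2[OF abs_powr_deriv[OF q(1)] this]
      have "((\<lambda>y. \<bar>y - x\<bar> powr q) has_real_derivative q * (sgn (y - x) * \<bar>y - x\<bar> powr (q - 1))) (at y)" by simp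
      from DERIV_add[OF DERIV_const DERIV_cmult[OF this, of A], of \<eta>]
      show "(f has_real_derivative f' y) (at y within {x - R..x + R})"
        unfolding f_def[abs_def] f'_def by (simp add: has_field_derivative_at_within)
      show "((\<lambda>y. plap_flux p (f' y)) has_real_derivative b * \<eta> powr (p - 1)) (at y within {x - R..x + R})"
        unfolding flux by (auto intro!: derivative_eq_intros)
      show "u y 0 \<le> 0 + 1 * f y" using init[of y] y x f0[of y] \<eta> by simp
      fix s assume "s \<in> {0<..\<tau>}"
      show "0 \<le> 0 + 1 * f y" using f0[of y] \<eta> by simp
      have "\<eta> powr (p - 1) \<le> f y powr (p - 1)" using f0[of y] \<eta> p by (intro powr_mono2) auto
      then show "1 powr (p - 1) * (b * \<eta> powr (p - 1)) \<le> 0 * f y + b * (0 + 1 * f y) powr (p - 1)"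
        using b by simp
    next
      fix s assume s: "s \<in> {0..\<tau>}"
      show "u (x - R) s \<le> 0 + 1 * f (x - R) \<and> u (x + R) s \<le> 0 + 1 * f (x + R)"
        using bound[OF _ s, of "x - R"] bound[OF _ s, of "x + R"] x R \<eta> by (simp add: f_def)
    next
      have "continuous_on {x - R..x + R} (\<lambda>y. sgn (y - x) * \<bar>y - x\<bar> powr (q - 1))"
      proof -
        have eq: "sgn (y - x) * \<bar>y - x\<bar> powr (q - 1) = plap_flux q (y - x)" for y by (simp add: plap_flux_eq)
        \<comment> \<open>Here q = p / (p - 1) exceeds 2, outside the range of the earlier
          continuity lemma for fluxes; the decomposition into positive and negative parts covers
          it.\<close>
        have c: "isCont (plap_flux q) a" for a
        proof -
          have "continuous_on UNIV (\<lambda>z. max 0 z powr (q - 1) - max 0 (- z) powr (q - 1))"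
            using q by (intro continuous_intros continuous_on_powr') auto
          also have "(\<lambda>z. max 0 z powr (q - 1) - max 0 (- z) powr (q - 1)) = plap_flux q"
            by (auto simp: fun_eq_iff plap_flux_eq sgn_if max_def)
          finally show ?thesis by (simp add: continuous_on_eq_continuous_at)
        qed
        show ?thesis unfolding eq
          by (rule continuous_on_compose2[of UNIV "plap_flux q"]) (auto intro!: continuous_intros continuous_at_imp_continuous_on c)
      qed
      then show "continuous_on {x - R..x + R} f'" unfolding f'_def by (intro continuous_on_mult_left)
    qed (use R t x in \<open>auto intro!: continuous_intros\<close>)
    then show ?thesis using q by (simp add: f_def)
  qed
  then show ?thesis using R(1) by blast
qed

section \<open>The asymptotic estimate\<close>

theorem theorem4:
  fixes p b \<beta> C \<alpha> :: real and T :: ereal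
    and u0 :: "real \<Rightarrow> real" and u :: "real \<Rightarrow> real \<Rightarrow> real"
  assumes "1 < p" and "p < 2" and "b > 0" and "\<beta> = p - 1" and "C > 0" and "\<alpha> > 0" and "T > 0"
    and "\<forall>x. u0 x \<ge> 0" and "continuous_on UNIV u0"
    and "asymp_equiv u0 (at_left 0) (\<lambda>x. C * max (- x) 0 powr \<alpha>)"
    and "interface u0 = 0"
    and "unique_weak_solution p b \<beta> T u0 u"
  shows "(\<forall>\<^sub>F t in at_right 0. interface (\<lambda>x. u x t) = \<infinity>) \<and>
    (\<exists>\<phi>. profile_solution p b \<phi> \<and>
       (\<forall>\<psi>. profile_solution p b \<psi> \<longrightarrow> (\<forall>x\<ge>0. \<psi> x = \<phi> x)) \<and>
       (\<forall>\<epsilon>>0. \<exists>\<delta>>0. ereal \<delta> \<le> T \<and>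
          (\<forall>x t. 0 < x \<and> 0 \<le> t \<and> t \<le> \<delta> \<longrightarrow>
             t powr (1 / (2 - p)) * \<phi> x \<le> u x t \<and>
             u x t \<le> (t + \<epsilon>) powr (1 / (2 - p)) * \<phi> x))) \<and>
    (\<exists>\<delta>>0. ereal \<delta> \<le> T \<and>
       (\<forall>t. 0 < t \<and> t \<le> \<delta> \<longrightarrow>
          asymp_equiv (\<lambda>x. ln (u x t)) at_top (\<lambda>x. - ((b / (p - 1)) powr (1 / p)) * x)))"
proof -
  note p = assms(1,2) and b = assms(3)
  define \<theta> where "\<theta> = 1 / (2 - p)"
  have \<theta>: "0 < \<theta>" using p by (simp add: \<theta>_def)
  have sol: "continuous_weak_solution p b (p - 1) T u0 u"
    using assms(4,12) by (simp add: unique_weak_solution_def)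
  have u_init: "u x 0 = u0 x" and u_lim: "((\<lambda>t. u x t) \<longlongrightarrow> u0 x) (at_right 0)" for x
    using sol by (auto simp: continuous_weak_solution_def weak_solution_def)
  \<comment> \<open>\<open>T\<close> may be infinite; all comparisons take place within a finite
    time \<open>T'\<close>.\<close>
  obtain T' :: real where T': "0 < T'" "ereal T' \<le> T"
    using assms(7) by (cases T) (auto intro: that[of 1] that)
  have nonneg: "0 \<le> u x t" if "t \<in> {0..T'}" for x t by (rule continuous_weak_solution_nonneg[OF sol T'(2) that])

  \<comment> \<open>Support of the initial datum\<close>
  have supp: "x \<le> 0" if "0 < u0 x" for x
  proof -
    have "ereal x \<le> interface u0" unfolding interface_def by (rule Sup_upper) (use that in auto)
    then show ?thesis using assms(11) by simp
  qed
  \<comment> \<open>Only x = 0 takes an argument: a positive value there would persist slightly to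
    the right by continuity.\<close>
  have u0_zero: "u0 x = 0" if "0 \<le> x" for x
  proof (rule ccontr)
    assume "u0 x \<noteq> 0"
    then have pos: "0 < u0 x" using assms(8) by (simp add: less_le)
    then have "\<forall>\<^sub>F y in at x. 0 < u0 y"
      using assms(9) by (intro order_tendstoD(1)) (auto simp: continuous_on_eq_continuous_at isCont_def)
    then have "\<forall>\<^sub>F y in at_right x. 0 < u0 y" by (rule filter_leD[OF at_le, rotated]) simp
    then obtain c where "x < c" "\<And>y. x < y \<Longrightarrow> y < c \<Longrightarrow> 0 < u0 y"
      unfolding eventually_at_right_field by blast
    then have "0 < u0 ((x + c) / 2)" by simp
    then show False using supp[of "(x + c) / 2"] that \<open>x < c\<close> by simp
  qed

  obtain r0 \<phi> \<phi>' where r0: "0 < r0"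
    and \<phi>: "\<And>x. -r0 \<le> x \<Longrightarrow> 0 < \<phi> x" "\<And>x. -r0 \<le> x \<Longrightarrow> \<phi>' x < 0"
      "\<And>x. -r0 \<le> x \<Longrightarrow> (\<phi> has_real_derivative \<phi>' x) (at x)"
      "\<And>x. -r0 \<le> x \<Longrightarrow> ((\<lambda>y. plap_flux p (\<phi>' y)) has_real_derivative \<theta> * \<phi> x + b * \<phi> x powr (p - 1)) (at x)"
    and c\<phi>': "continuous_on {-r0..} \<phi>'" and \<phi>0: "\<phi> 0 = 1" and \<phi>lim: "(\<phi> \<longlongrightarrow> 0) at_top"
    and \<phi>ln: "((\<lambda>x. ln (\<phi> x) / x) \<longlongrightarrow> - ((b / (p - 1)) powr (1 / p))) at_top"
    using profile_exists[OF p b] unfolding \<theta>_def by blast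
  have c\<phi>: "continuous_on {-r0..} \<phi>"
    using \<phi>(3) by (intro continuous_at_imp_continuous_on) (auto intro: DERIV_isCont)
  have \<phi>_anti: "\<phi> y \<le> \<phi> x" if "-r0 \<le> x" "x \<le> y" for x y
  proof (rule DERIV_nonpos_imp_nonincreasing[OF that(2)])
    fix z assume "x \<le> z"
    then show "\<exists>d. (\<phi> has_real_derivative d) (at z) \<and> d \<le> 0"
      using \<phi>(2,3)[of z] that(1) by (intro exI[of _ "\<phi>' z"]) auto
  qed
  have prof: "profile_solution p b \<phi>"
    unfolding profile_solution_def
  proof (intro conjI exI[of _ \<phi>'] allI impI)
    show "continuous_on {0..} \<phi>" by (rule continuous_on_subset[OF c\<phi>]) (use r0 in auto)
  qed (use r0 \<phi> \<phi>0 \<phi>lim in \<open>auto simp: \<theta>_def less_imp_le\<close>)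
  have uniq: "\<psi> x = \<phi> x" if "profile_solution p b \<psi>" "0 \<le> x" for \<psi> x
    using profile_solution_le[OF p b that(1) prof that(2)] profile_solution_le[OF p b prof that(1) that(2)] by simp

  have cF: "continuous_on {a..c} (\<lambda>x. \<theta> * \<phi> x + b * \<phi> x powr (p - 1))" if "-r0 \<le> a" for a c
    using that \<phi>(1) by (intro continuous_intros continuous_on_subset[OF c\<phi>]) (auto simp: less_imp_neq[symmetric] dest: \<phi>(1))
  have c\<phi>'_ac: "continuous_on {a..c} \<phi>'" if "-r0 \<le> a" for a c
    using that by (intro continuous_on_subset[OF c\<phi>']) auto
  have Gderiv: "((\<lambda>t. (t + e) powr \<theta>) has_real_derivative \<theta> * ((t + e) powr \<theta>) powr (p - 1)) (at t within S)"
    if "0 < t + e" for t e S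
    unfolding \<theta>_def by (rule time_factor_deriv[OF p that])
  have cG: "continuous_on {0..\<tau>} (\<lambda>t. (t + e) powr \<theta>)" if "0 \<le> e" for e \<tau>
    by (rule time_factor_continuous[OF \<theta> that])
  have cG': "continuous_on {0<..\<tau>} (\<lambda>t. \<theta> * ((t + e) powr \<theta>) powr (p - 1))" if "0 \<le> e" for e \<tau>
    using that by (intro continuous_intros continuous_on_subset[OF cG[OF that, of \<tau>]]) auto

  \<comment> \<open>The supremum of the positivity set being 0, positive values of \<open>u0\<close>
    occur arbitrarily close to 0 on the left, in particular where the profile still exists.\<close>
  obtain r where r: "0 < r" "r < r0" "0 < u0 (- r)"
  proof -
    have "ereal (- r0) < Sup (ereal ` {x. u0 x > 0})"
      using assms(11) r0 by (simp add: interface_def)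
    then obtain x where x: "0 < u0 x" "- r0 < x" unfolding less_Sup_iff by auto
    moreover have "x < 0" using x(1) u0_zero[of x] by (cases "0 \<le> x") auto
    ultimately show ?thesis using that[of "- x"] by simp
  qed

  \<comment> \<open>As t tends to 0 the barrier tends to 0 at \<open>-r\<close>, whereas
    \<open>u\<close> tends to u0(-r) > 0. This is the left boundary inequality, and it determines
    the time \<open>\<tau>1\<close>.\<close>
  have "\<forall>\<^sub>F t in at_right 0. t powr \<theta> * \<phi> (- r) < u (- r) t"
  proof -
    have "((\<lambda>t. (t + 0) powr \<theta> * \<phi> (- r)) \<longlongrightarrow> (0 + 0) powr \<theta> * \<phi> (- r)) (at_right 0)"
      using \<theta> by (intro tendsto_intros) (auto simp: eventually_at_right_less eventually_mono[OF eventually_at_right_less])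
    then have "((\<lambda>t. u (- r) t - t powr \<theta> * \<phi> (- r)) \<longlongrightarrow> u0 (- r) - 0) (at_right 0)"
      using \<theta> by (intro tendsto_diff u_lim) simp
    then have "\<forall>\<^sub>F t in at_right 0. 0 < u (- r) t - t powr \<theta> * \<phi> (- r)"
      using r(3) by (intro order_tendstoD(1)) auto
    then show ?thesis by (rule eventually_mono) simp
  qed
  then obtain d1 where d1: "0 < d1" "\<And>t. 0 < t \<Longrightarrow> t < d1 \<Longrightarrow> t powr \<theta> * \<phi> (- r) < u (- r) t"
    unfolding eventually_at_right_field by auto
  define \<tau>1 where "\<tau>1 = min (d1 / 2) (T' / 2)"
  have \<tau>1: "0 < \<tau>1" "\<tau>1 < d1" "\<tau>1 < T'" using d1(1) T' by (auto simp: \<tau>1_def)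

  \<comment> \<open>Lower bound\<close>
  have lower: "t powr \<theta> * \<phi> x \<le> u x t" if x: "0 \<le> x" and t: "t \<in> {0..\<tau>1}" for x t
  proof -
    have bnd: "t powr \<theta> * (\<phi> x - \<phi> k) \<le> u x t" if k: "x < k" for k
    proof -
      have "(t + 0) powr \<theta> * (\<phi> x - \<phi> k) \<le> u x t"
      proof (rule separable_lower_comparison[OF p b sol _ \<tau>1(1,3) T'(2), where f = "\<lambda>x. \<phi> x - \<phi> k" and f' = \<phi>'
            and F = "\<lambda>x. \<theta> * \<phi> x + b * \<phi> x powr (p - 1)" and a = "- r" and c = k
            and G = "\<lambda>t. (t + 0) powr \<theta>" and G' = "\<lambda>t. \<theta> * ((t + 0) powr \<theta>) powr (p - 1)"])
        fix y assume y: "y \<in> {- r..k}"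
        then have yr: "- r0 \<le> y" using r by auto
        show "((\<lambda>x. \<phi> x - \<phi> k) has_real_derivative \<phi>' y) (at y within {- r..k})"
          using DERIV_diff[OF \<phi>(3)[OF yr] DERIV_const] by (simp add: has_field_derivative_at_within)
        show "((\<lambda>y. plap_flux p (\<phi>' y)) has_real_derivative \<theta> * \<phi> y + b * \<phi> y powr (p - 1)) (at y within {- r..k})"
          by (rule has_field_derivative_at_within[OF \<phi>(4)[OF yr]])
        \<comment> \<open>The convention \<open>0 powr \<theta> = 0\<close> makes the barrier vanish
          initially. The summand 0 is kept so that the time factor is the case e = 0 of the family
          (t + e)^\<theta>.\<close>
        show "(0 + 0) powr \<theta> * (\<phi> y - \<phi> k) \<le> u y 0" using nonneg[of 0 y] T' by simp
        fix s assume s: "s \<in> {0<..\<tau>1}"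
        define P where "P = (s powr \<theta>) powr (p - 1)"
        have ge: "0 \<le> \<phi> y - \<phi> k" "0 < \<phi> k" using \<phi>_anti[OF yr, of k] y \<phi>(1)[of k] yr by auto
        have "(\<phi> y - \<phi> k) powr (p - 1) \<le> \<phi> y powr (p - 1)" using ge p by (intro powr_mono2) auto
        then have "\<theta> * (\<phi> y - \<phi> k) + b * (\<phi> y - \<phi> k) powr (p - 1) \<le> \<theta> * \<phi> y + b * \<phi> y powr (p - 1)"
          using ge b \<theta> by (intro add_mono mult_left_mono) auto
        then have "P * (\<theta> * (\<phi> y - \<phi> k) + b * (\<phi> y - \<phi> k) powr (p - 1)) \<le> P * (\<theta> * \<phi> y + b * \<phi> y powr (p - 1))"
          by (intro mult_left_mono) (auto simp: P_def)
        moreover have "((s + 0) powr \<theta> * (\<phi> y - \<phi> k)) powr (p - 1) = P * (\<phi> y - \<phi> k) powr (p - 1)"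
          using ge by (simp add: powr_mult P_def)
        ultimately show "\<theta> * ((s + 0) powr \<theta>) powr (p - 1) * (\<phi> y - \<phi> k) + b * ((s + 0) powr \<theta> * (\<phi> y - \<phi> k)) powr (p - 1)
            \<le> ((s + 0) powr \<theta>) powr (p - 1) * (\<theta> * \<phi> y + b * \<phi> y powr (p - 1))"
          by (simp add: P_def[symmetric] distrib_left mult_ac)
      next
        fix s assume s: "s \<in> {0..\<tau>1}"
        have "(s + 0) powr \<theta> * (\<phi> (- r) - \<phi> k) \<le> u (- r) s"
        proof (cases "s = 0")
          case True then show ?thesis using nonneg[of 0 "- r"] T' by simp
        next
          case False
          have "s powr \<theta> * (\<phi> (- r) - \<phi> k) \<le> s powr \<theta> * \<phi> (- r)"
            using \<phi>(1)[of k] k x r0 by (intro mult_left_mono) auto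
          also have "\<dots> \<le> u (- r) s" using d1(2)[of s] s False \<tau>1 by auto
          finally show ?thesis by simp
        qed
        moreover have "(s + 0) powr \<theta> * (\<phi> k - \<phi> k) \<le> u k s" using nonneg[of s k] s \<tau>1 by simp
        ultimately show "(s + 0) powr \<theta> * (\<phi> (- r) - \<phi> k) \<le> u (- r) s \<and> (s + 0) powr \<theta> * (\<phi> k - \<phi> k) \<le> u k s" ..
      next
        fix s assume s: "s \<in> {0<..\<tau>1}"
        show "((\<lambda>t. (t + 0) powr \<theta>) has_real_derivative \<theta> * ((s + 0) powr \<theta>) powr (p - 1)) (at s within {0<..\<tau>1})"
          by (rule Gderiv) (use s in simp)
        show "0 < (s + 0) powr \<theta>" using s by simp
      qed (use cF[of "- r" k] c\<phi>'_ac[of "- r" k] cG[of 0] cG'[of 0] r x t k in auto)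
      then show ?thesis by simp
    qed
    have "((\<lambda>k. t powr \<theta> * (\<phi> x - \<phi> k)) \<longlongrightarrow> t powr \<theta> * (\<phi> x - 0)) at_top"
      by (intro tendsto_intros \<phi>lim)
    then show ?thesis
      using bnd by (intro tendsto_upperbound[of _ "t powr \<theta> * \<phi> x" at_top "u x t"])
        (auto intro: eventually_mono[OF eventually_gt_at_top[of x]])
  qed

  \<comment> \<open>Upper bound\<close>
  have upper: "\<exists>\<tau>>0. \<tau> < T' \<and> (\<forall>x t. 0 \<le> x \<and> t \<in> {0..\<tau>} \<longrightarrow> u x t \<le> (t + \<epsilon>) powr \<theta> * \<phi> x)" if \<epsilon>: "0 < \<epsilon>" for \<epsilon>
  proof -
    \<comment> \<open>The value of the barrier (t + \<epsilon>)^\<theta> \<phi>(x) at x = 0, t = 0,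
      and its minimum over time at x = 0. Since u(0, t) tends to 0, it stays below \<open>M\<close>
      for a short time.\<close>
    define M where "M = \<epsilon> powr \<theta>"
    have M: "0 < M" using \<epsilon> by (simp add: M_def)
    have "\<forall>\<^sub>F t in at_right 0. u 0 t < M"
      using u_lim[of 0] u0_zero[of 0] M by (intro order_tendstoD(2)) auto
    then obtain d where d: "0 < d" "\<And>t. 0 < t \<Longrightarrow> t < d \<Longrightarrow> u 0 t < M"
      unfolding eventually_at_right_field by auto
    define \<tau> where "\<tau> = min (d / 2) (T' / 2)"
    have \<tau>: "0 < \<tau>" "\<tau> < d" "\<tau> < T'" using d(1) T' by (auto simp: \<tau>_def)
    have init: "u x 0 = 0" if "0 \<le> x" for x using u_init u0_zero[OF that] by simp
    have lateral: "u 0 t \<le> M" if "t \<in> {0..\<tau>}" for t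
      using d(2)[of t] that \<tau> init[of 0] M by (cases "t = 0") auto
    have bound: "u x t \<le> M" if "0 \<le> x" "t \<in> {0..\<tau>}" for x t
      using half_line_bound[OF p b sol \<tau>(1,3) T'(2) init lateral _ that] M by simp
    have "u x t \<le> (t + \<epsilon>) powr \<theta> * \<phi> x" if x: "0 \<le> x" and t: "t \<in> {0..\<tau>}" for x t
    proof -
      have Gge: "M \<le> (s + \<epsilon>) powr \<theta>" if "0 \<le> s" for s
        using that \<epsilon> \<theta> by (auto simp: M_def intro!: powr_mono2)
      \<comment> \<open>The right end \<open>k\<close> depends on \<open>\<eta>\<close> through the
        uniform decay, but the time \<open>\<tau>\<close> was fixed before; therefore
        \<open>\<eta>\<close> can be sent to 0 at fixed \<open>x\<close> and
        \<open>t\<close>.\<close>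
      have bnd: "u x t \<le> (t + \<epsilon>) powr \<theta> * (\<phi> x + \<eta>)" if \<eta>: "0 < \<eta>" for \<eta>
      proof -
        obtain R where R: "0 < R" "\<And>y s. R \<le> y \<Longrightarrow> s \<in> {0..\<tau>} \<Longrightarrow> u y s \<le> M * \<eta>"
          using uniform_decay[OF p b sol \<tau>(1,3) T'(2) init bound M, of "M * \<eta>"] M \<eta> by auto
        define k where "k = max R (x + 1)"
        have k: "0 < k" "R \<le> k" "x < k" using R x by (auto simp: k_def)
        have "u x t \<le> 0 + (t + \<epsilon>) powr \<theta> * (\<phi> x + \<eta>)"
        proof (rule separable_upper_comparison[OF p b sol k(1) \<tau>(1,3) T'(2), where f = "\<lambda>x. \<phi> x + \<eta>" and f' = \<phi>'
              and F = "\<lambda>x. \<theta> * \<phi> x + b * \<phi> x powr (p - 1)"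
              and G = "\<lambda>t. (t + \<epsilon>) powr \<theta>" and G' = "\<lambda>t. \<theta> * ((t + \<epsilon>) powr \<theta>) powr (p - 1)"])
          fix y assume y: "y \<in> {0..k}"
          then have yr: "- r0 \<le> y" using r0 by auto
          show "((\<lambda>x. \<phi> x + \<eta>) has_real_derivative \<phi>' y) (at y within {0..k})"
            using DERIV_add[OF \<phi>(3)[OF yr] DERIV_const] by (simp add: has_field_derivative_at_within)
          show "((\<lambda>y. plap_flux p (\<phi>' y)) has_real_derivative \<theta> * \<phi> y + b * \<phi> y powr (p - 1)) (at y within {0..k})"
            by (rule has_field_derivative_at_within[OF \<phi>(4)[OF yr]])
          show "u y 0 \<le> 0 + (0 + \<epsilon>) powr \<theta> * (\<phi> y + \<eta>)" using init[of y] y \<phi>(1)[OF yr] \<eta> by simp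
          fix s assume s: "s \<in> {0<..\<tau>}"
          define P where "P = ((s + \<epsilon>) powr \<theta>) powr (p - 1)"
          have pos: "0 < \<phi> y" by (rule \<phi>(1)[OF yr])
          show "0 \<le> 0 + (s + \<epsilon>) powr \<theta> * (\<phi> y + \<eta>)" using pos \<eta> by simp
          have "\<phi> y powr (p - 1) \<le> (\<phi> y + \<eta>) powr (p - 1)" using pos \<eta> p by (intro powr_mono2) auto
          then have "\<theta> * \<phi> y + b * \<phi> y powr (p - 1) \<le> \<theta> * (\<phi> y + \<eta>) + b * (\<phi> y + \<eta>) powr (p - 1)"
            using \<eta> b \<theta> by (intro add_mono mult_left_mono) auto
          then have "P * (\<theta> * \<phi> y + b * \<phi> y powr (p - 1)) \<le> P * (\<theta> * (\<phi> y + \<eta>) + b * (\<phi> y + \<eta>) powr (p - 1))"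
            by (intro mult_left_mono) (auto simp: P_def)
          also have "\<dots> = \<theta> * P * (\<phi> y + \<eta>) + b * (P * (\<phi> y + \<eta>) powr (p - 1))" by (simp add: algebra_simps)
          also have "P * (\<phi> y + \<eta>) powr (p - 1) = ((s + \<epsilon>) powr \<theta> * (\<phi> y + \<eta>)) powr (p - 1)"
            using pos \<eta> by (simp add: powr_mult P_def)
          finally show "((s + \<epsilon>) powr \<theta>) powr (p - 1) * (\<theta> * \<phi> y + b * \<phi> y powr (p - 1))
              \<le> \<theta> * ((s + \<epsilon>) powr \<theta>) powr (p - 1) * (\<phi> y + \<eta>) + b * (0 + (s + \<epsilon>) powr \<theta> * (\<phi> y + \<eta>)) powr (p - 1)"
            by (simp add: P_def)
        next
          fix s assume s: "s \<in> {0..\<tau>}"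
          have "u 0 s \<le> M * 1" using lateral[OF s] by simp
          also have "\<dots> \<le> (s + \<epsilon>) powr \<theta> * (\<phi> 0 + \<eta>)"
            using Gge[of s] s \<eta> \<phi>0 M by (intro mult_mono) auto
          finally have 1: "u 0 s \<le> 0 + (s + \<epsilon>) powr \<theta> * (\<phi> 0 + \<eta>)" by simp
          have "u k s \<le> M * \<eta>" by (rule R(2)[OF k(2) s])
          also have "\<dots> \<le> (s + \<epsilon>) powr \<theta> * (\<phi> k + \<eta>)"
            using Gge[of s] s \<eta> \<phi>(1)[of k] M k r0 by (intro mult_mono) auto
          finally show "u 0 s \<le> 0 + (s + \<epsilon>) powr \<theta> * (\<phi> 0 + \<eta>) \<and> u k s \<le> 0 + (s + \<epsilon>) powr \<theta> * (\<phi> k + \<eta>)"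
            using 1 by simp
        next
          fix s assume "s \<in> {0<..\<tau>}"
          then show "((\<lambda>t. (t + \<epsilon>) powr \<theta>) has_real_derivative \<theta> * ((s + \<epsilon>) powr \<theta>) powr (p - 1)) (at s within {0<..\<tau>})"
            "0 < (s + \<epsilon>) powr \<theta>"
            using \<epsilon> by (auto intro!: Gderiv)
        qed (use cF[of 0 k] c\<phi>'_ac[of 0 k] cG[of \<epsilon>] cG'[of \<epsilon>] \<epsilon> r0 x t k in auto)
        then show ?thesis by simp
      qed
      have "((\<lambda>\<eta>. (t + \<epsilon>) powr \<theta> * (\<phi> x + \<eta>)) \<longlongrightarrow> (t + \<epsilon>) powr \<theta> * (\<phi> x + 0)) (at_right 0)"
        by (intro tendsto_intros)
      then show ?thesis
        using bnd by (intro tendsto_lowerbound[of _ "(t + \<epsilon>) powr \<theta> * \<phi> x" "at_right 0" "u x t"])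
          (auto intro: eventually_mono[OF eventually_at_right_less[of 0]])
    qed
    then show ?thesis using \<tau> by blast
  qed

  have two_sided: "\<exists>\<delta>>0. ereal \<delta> \<le> T \<and> (\<forall>x t. 0 < x \<and> 0 \<le> t \<and> t \<le> \<delta> \<longrightarrow>
             t powr \<theta> * \<phi> x \<le> u x t \<and> u x t \<le> (t + \<epsilon>) powr \<theta> * \<phi> x)" if "0 < \<epsilon>" for \<epsilon>
  proof -
    obtain \<tau> where \<tau>: "0 < \<tau>" "\<tau> < T'" "\<And>x t. 0 \<le> x \<Longrightarrow> t \<in> {0..\<tau>} \<Longrightarrow> u x t \<le> (t + \<epsilon>) powr \<theta> * \<phi> x"
      using upper[OF \<open>0 < \<epsilon>\<close>] by blast
    have "ereal (min \<tau> \<tau>1) \<le> ereal T'" unfolding ereal_less_eq(3) using \<tau> by simp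
    then have "ereal (min \<tau> \<tau>1) \<le> T" using T'(2) by (rule order_trans)
    then show ?thesis using \<tau> \<tau>1 lower by (intro exI[of _ "min \<tau> \<tau>1"]) auto
  qed

  have speed: "\<forall>\<^sub>F t in at_right 0. interface (\<lambda>x. u x t) = \<infinity>"
    unfolding eventually_at_right_field
  proof (intro exI[of _ \<tau>1] conjI allI impI \<tau>1(1))
    fix t :: real assume t: "0 < t" "t < \<tau>1"
    show "interface (\<lambda>x. u x t) = \<infinity>"
    proof (rule ereal_top)
      fix B
      have "0 < t powr \<theta> * \<phi> (max B 1)" using t \<phi>(1)[of "max B 1"] r0 by auto
      also have "\<dots> \<le> u (max B 1) t" using t by (intro lower) auto
      finally have "ereal (max B 1) \<le> interface (\<lambda>x. u x t)"
        unfolding interface_def by (intro Sup_upper imageI) simp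
      then show "ereal B \<le> interface (\<lambda>x. u x t)" by (rule order_trans[rotated]) simp
    qed
  qed

  \<comment> \<open>Logarithmic asymptotics\<close>
  define c where "c = (b / (p - 1)) powr (1 / p)"
  have c: "0 < c" using b p by (simp add: c_def)
  \<comment> \<open>The single value \<epsilon> = 1 suffices: for fixed t > 0 the factors in front
    of \<phi>(x) are positive and independent of x, so their logarithms disappear after division by
    x.\<close>
  obtain \<delta> where \<delta>: "0 < \<delta>" "ereal \<delta> \<le> T" "\<And>x t. 0 < x \<Longrightarrow> 0 \<le> t \<Longrightarrow> t \<le> \<delta> \<Longrightarrow>
      t powr \<theta> * \<phi> x \<le> u x t \<and> u x t \<le> (t + 1) powr \<theta> * \<phi> x"
    using two_sided[of 1] by auto
  have "asymp_equiv (\<lambda>x. ln (u x t)) at_top (\<lambda>x. - c * x)" if t: "0 < t" "t \<le> \<delta>" for t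
  proof (rule asymp_equivI'_const)
    have lim: "((\<lambda>x. ln (s powr \<theta>) / x + ln (\<phi> x) / x) \<longlongrightarrow> 0 + (- c)) at_top" for s
      unfolding c_def by (intro tendsto_add \<phi>ln tendsto_divide_0[OF tendsto_const] filterlim_at_top_imp_at_infinity filterlim_ident)
    show "((\<lambda>x. ln (u x t) / x) \<longlongrightarrow> - c) at_top"
    proof (rule tendsto_sandwich)
      show "\<forall>\<^sub>F x in at_top. ln (t powr \<theta>) / x + ln (\<phi> x) / x \<le> ln (u x t) / x"
        using eventually_gt_at_top[of 0]
      proof eventually_elim
        case (elim x)
        have pos: "0 < \<phi> x" "0 < t powr \<theta>" using \<phi>(1)[of x] elim r0 t by auto
        then have "ln (t powr \<theta>) + ln (\<phi> x) = ln (t powr \<theta> * \<phi> x)" by (simp add: ln_mult)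
        also have "\<dots> \<le> ln (u x t)" using \<delta>(3)[OF elim, of t] t pos by (intro ln_mono) auto
        finally show ?case using elim by (simp add: divide_right_mono flip: add_divide_distrib)
      qed
      show "\<forall>\<^sub>F x in at_top. ln (u x t) / x \<le> ln ((t + 1) powr \<theta>) / x + ln (\<phi> x) / x"
        using eventually_gt_at_top[of 0]
      proof eventually_elim
        case (elim x)
        have pos: "0 < \<phi> x" "0 < t powr \<theta>" "0 < (t + 1) powr \<theta>" using \<phi>(1)[of x] elim r0 t by auto
        have "0 < t powr \<theta> * \<phi> x" using pos by simp
        then have "ln (u x t) \<le> ln ((t + 1) powr \<theta> * \<phi> x)" using \<delta>(3)[OF elim, of t] t by (intro ln_mono) auto
        also have "\<dots> = ln ((t + 1) powr \<theta>) + ln (\<phi> x)" using pos by (simp add: ln_mult)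
        finally show ?case using elim by (simp add: divide_right_mono flip: add_divide_distrib)
      qed
    qed (use lim[of t] lim[of "t + 1"] in auto)
  qed (use c in simp)
  then have logs: "\<exists>\<delta>>0. ereal \<delta> \<le> T \<and> (\<forall>t. 0 < t \<and> t \<le> \<delta> \<longrightarrow>
      asymp_equiv (\<lambda>x. ln (u x t)) at_top (\<lambda>x. - ((b / (p - 1)) powr (1 / p)) * x))"
    using \<delta>(1,2) unfolding c_def by blast
  show ?thesis
  proof (intro conjI speed logs exI[of _ \<phi>] prof allI impI)
    show "\<psi> x = \<phi> x" if "profile_solution p b \<psi>" "0 \<le> x" for \<psi> x by (rule uniq[OF that])
    show "\<exists>\<delta>>0. ereal \<delta> \<le> T \<and> (\<forall>x t. 0 < x \<and> 0 \<le> t \<and> t \<le> \<delta> \<longrightarrow>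
        t powr (1 / (2 - p)) * \<phi> x \<le> u x t \<and> u x t \<le> (t + \<epsilon>) powr (1 / (2 - p)) * \<phi> x)"
      if "0 < \<epsilon>" for \<epsilon>
      using two_sided[OF that] unfolding \<theta>_def by blast
  qed
qed

end
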